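(* Let $E$ be a barreled, Hausdorff, sequentially complete complex locally convex space, and let $C\in L(E)$ (not necessarily injective). Let $a>0$, $b>0$ and $\alpha>0$, and let $$E(a,b)=\{\lambda\in\mathbb{C}:\ \Re\lambda\geq b,\ |\Im\lambda|\leq e^{a\Re\lambda}\}.$$ Let $\Gamma_{a,b}$ denote the upwards oriented boundary of $E(a,b)$ and $\Omega_{a,b}$ the open region which lies to the right of $\Gamma_{a,b}$. Suppose that $\mathcal{A}$ is a closed multivalued linear operator in $E$ and that for every $\lambda\in E(a,b)$ there exists an operator $F(\lambda)\in L(E)$ such that: (1) $F(\lambda)\mathcal{A}\subseteq\mathcal{A}F(\lambda)$ for $\lambda\in E(a,b)$; (2) $F(\lambda)x\in(\lambda-\mathcal{A})^{-1}Cx$ for $\lambda\in E(a,b)$, $x\in E$; (3) $F(\lambda)C=CF(\lambda)$ for $\lambda\in E(a,b)$; (4) $\lambda F(\lambda)x-Cx=F(\lambda)y$ whenever $\lambda\in E(a,b)$ and $(x,y)\in\mathcal{A}$; (5) for every $x\in E$, the mapping $\lambda\mapsto F(\lambda)x$, defined on $E(a,b)$, is analytic on $\Omega_{a,b}$ and continuous on $\Gamma_{a,b}$ (i.e. continuous, as a map on $E(a,b)$, at the points of $\Gamma_{a,b}$); (6) the operator family $\{(1+|\lambda|)^{-\alpha}F(\lambda):\lambda\in E(a,b)\}\subseteq L(E)$ is equicontinuous. Set $$\mathcal{G}(\varphi)x:=(-i)\int_{\Gamma_{a,b}}\hat{\varphi}(\lambda)F(\lambda)x\,d\lambda,\qquad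 x\in E,\ \varphi\in\mathcal{D},$$ where $\hat{\varphi}(\lambda)=\frac{1}{2\pi}\int_{-\infty}^{\infty}e^{\lambda t}\varphi(t)\,dt$. Then $\mathcal{G}$ is a pre-(C-DS) in $E$ generated by an extension of $\mathcal{A}$, i.e. the (infinitesimal) generator of $\mathcal{G}$ contains $\mathcal{A}$.
   Context: Notation. $L(E)$ is the space of continuous linear operators on $E$ (with the topology of uniform convergence on bounded sets). $\mathcal{D}=C_0^\infty(\mathbb{R})$ is the usual space of scalar test functions, and $\mathcal{D}_0=\{\varphi\in\mathcal{D}:\mathrm{supp}(\varphi)\subseteq[0,\infty)\}$. $\mathcal{D}'_0(L(E))$ is the space of continuous linear maps $\mathcal{D}\to L(E)$ (i.e. $L(E)$-valued distributions) with support contained in $[0,\infty)$. For $\varphi,\psi\in\mathcal{D}$, $(\varphi*_0\psi)(t)=\int_0^t\varphi(t-s)\psi(s)\,ds$, $t\in\mathbb{R}$. Multivalued linear operators. A multivalued linear operator (MLO) $\mathcal{A}$ in $E$ is identified with its graph, a linear subspace of $E\times E$; $\mathcal{A}x=\{y:(x,y)\in\mathcal{A}\}$ and $D(\mathcal{A})=\{x:\mathcal{A}x\neq\emptyset\}$. $\mathcal{A}$ is closed if its graph is closed in $E\times E$. Inclusion $\mathcal{A}\subseteq\mathcal{B}$ means inclusion of graphs. The inverse is $\mathcal{A}^{-1}=\{(y,x):(x,y)\in\mathcal{A}\}$, and $\lambda-\mathcal{A}=\{(x,\lambda x-y):(x,y)\in\mathcal{A}\}$; thus $u\in(\lambda-\mathcal{A})^{-1}v$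 means $(u,\lambda u-v)\in\mathcal{A}$. For $F\in L(E)$, the condition $F\mathcal{A}\subseteq\mathcal{A}F$ means that $(x,y)\in\mathcal{A}$ implies $(Fx,Fy)\in\mathcal{A}$. Pre-(C-DS). A pre-(C-DS) in $E$ is a $\mathcal{G}\in\mathcal{D}'_0(L(E))$ with $C\mathcal{G}(\varphi)=\mathcal{G}(\varphi)C$ for all $\varphi\in\mathcal{D}$ and $\mathcal{G}(\varphi*_0\psi)C=\mathcal{G}(\varphi)\mathcal{G}(\psi)$ for all $\varphi,\psi\in\mathcal{D}$. Its (infinitesimal) generator is the closed MLO $$\{(x,y)\in E\times E:\ \mathcal{G}(-\varphi')x=\mathcal{G}(\varphi)y\ \text{ for all }\varphi\in\mathcal{D}_0\}.$$ *)

theory Defs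
  imports "HOL-Analysis.Analysis"
begin

class scaleC = scaleR +
  fixes scaleC :: "complex \<Rightarrow> 'a \<Rightarrow> 'a"  (infixr "*\<^sub>C" 75)
  assumes scaleR_scaleC: "scaleR r = scaleC (complex_of_real r)"

class complex_vector = scaleC + ab_group_add +
  assumes scaleC_add_right: "a *\<^sub>C (x + y) = a *\<^sub>C x + a *\<^sub>C y"
    and scaleC_add_left: "(a + b) *\<^sub>C x = a *\<^sub>C x + b *\<^sub>C x"
    and scaleC_scaleC: "a *\<^sub>C (b *\<^sub>C x) = (a * b) *\<^sub>C x"
    and scaleC_one: "1 *\<^sub>C x = x"

subclass (in complex_vector) real_vector
  by standard (simp_all add: scaleR_scaleC scaleC_add_right scaleC_add_left scaleC_scaleC scaleC_one)

interpretation complex_vector: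
  vector_space "scaleC :: complex \<Rightarrow> 'a \<Rightarrow> 'a::complex_vector"
  by standard (simp_all add: scaleC_add_right scaleC_add_left scaleC_scaleC scaleC_one)

instantiation prod :: (complex_vector, complex_vector) complex_vector
begin

definition scaleC_prod_def: "scaleC c p = (c *\<^sub>C fst p, c *\<^sub>C snd p)"

instance
proof
  show "((*\<^sub>R) r :: 'a \<times> 'b \<Rightarrow> 'a \<times> 'b) = (*\<^sub>C) (complex_of_real r)" for r
    by (rule ext) (simp add: scaleC_prod_def scaleR_prod_def scaleR_scaleC)
qed (simp_all add: scaleC_prod_def scaleC_add_right scaleC_add_left scaleC_scaleC scaleC_one)

end

text \<open>
  Uniform continuity of the group operations forces the uniformity to be the translation-invariant
  one generated by the sets \<open>{(x, y). x - y \<in> U}\<close>, \<open>U\<close> a neighbourhood of \<open>0\<close>; hence the library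
  notion \<^const>\<open>Cauchy\<close> is that of the topological vector space.  Hausdorffness is not included.
\<close>

class complex_lcs = complex_vector + uniform_topological_group_add + topological_ab_group_add +
  assumes tendsto_scaleC_Pair:
      "filterlim (\<lambda>p. fst p *\<^sub>C snd p) (nhds (c *\<^sub>C x)) (nhds c \<times>\<^sub>F nhds x)"
    and locally_convex: "open U \<Longrightarrow> 0 \<in> U \<Longrightarrow> \<exists>V. open V \<and> 0 \<in> V \<and> V \<subseteq> U \<and>
        (\<forall>x\<in>V. \<forall>y\<in>V. \<forall>u\<ge>0. \<forall>v\<ge>0. u + v = 1 \<longrightarrow> u *\<^sub>R x + v *\<^sub>R y \<in> V)"

lemma locally_convex_nhd:
  assumes "open U" "(0::'a::complex_lcs) \<in> U"
  shows "\<exists>V. open V \<and> 0 \<in> V \<and> V \<subseteq> U \<and> convex V"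
  using locally_convex[OF assms] unfolding convex_def by blast

class seq_complete_space = uniform_space +
  assumes seq_complete: "Cauchy X \<Longrightarrow> convergent X"

definition balanced :: "'a::complex_vector set \<Rightarrow> bool" where
  "balanced S \<longleftrightarrow> (\<forall>c. cmod c \<le> 1 \<longrightarrow> (\<lambda>x. c *\<^sub>C x) ` S \<subseteq> S)"

definition absorbs :: "'a::complex_vector set \<Rightarrow> 'a set \<Rightarrow> bool" where
  "absorbs W B \<longleftrightarrow> (\<exists>r>0. \<forall>c. r \<le> cmod c \<longrightarrow> B \<subseteq> (\<lambda>x. c *\<^sub>C x) ` W)"

definition absorbing :: "'a::complex_vector set \<Rightarrow> bool" where
  "absorbing W \<longleftrightarrow> (\<forall>x. absorbs W {x})"

definition tvs_bounded :: "'a::complex_lcs set \<Rightarrow> bool" where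
  "tvs_bounded B \<longleftrightarrow> (\<forall>W. open W \<and> 0 \<in> W \<longrightarrow> absorbs W B)"

definition barrel :: "'a::complex_lcs set \<Rightarrow> bool" where
  "barrel S \<longleftrightarrow> closed S \<and> convex S \<and> balanced S \<and> absorbing S"

definition barreled :: "'a::complex_lcs itself \<Rightarrow> bool" where
  "barreled _ \<longleftrightarrow> (\<forall>S::'a set. barrel S \<longrightarrow> 0 \<in> interior S)"

definition clin_ops :: "('a::complex_lcs \<Rightarrow> 'a) set" where
  "clin_ops = {T. Vector_Spaces.linear scaleC scaleC T \<and> continuous_on UNIV T}"

definition equicontinuous_ops :: "('a::complex_lcs \<Rightarrow> 'a) set \<Rightarrow> bool" where
  "equicontinuous_ops \<T> \<longleftrightarrow>
     (\<forall>U. open U \<and> 0 \<in> U \<longrightarrow> (\<exists>V. open V \<and> 0 \<in> V \<and> (\<forall>T\<in>\<T>. T ` V \<subseteq> U)))"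

text \<open>The topology of uniform convergence on bounded sets.\<close>

definition clin_ops_open :: "('a::complex_lcs \<Rightarrow> 'a) set \<Rightarrow> bool" where
  "clin_ops_open \<U> \<longleftrightarrow> \<U> \<subseteq> clin_ops \<and>
     (\<forall>T\<in>\<U>. \<exists>B W. tvs_bounded B \<and> open W \<and> 0 \<in> W \<and>
        {S \<in> clin_ops. \<forall>x\<in>B. S x - T x \<in> W} \<subseteq> \<U>)"

definition clin_ops_topology :: "('a::complex_lcs \<Rightarrow> 'a) topology" where
  "clin_ops_topology = topology clin_ops_open"

lemma tvs_bounded_empty: "tvs_bounded {}"
  by (auto simp: tvs_bounded_def absorbs_def intro: exI[of _ 1])

lemma tvs_bounded_Un:
  assumes "tvs_bounded A" "tvs_bounded B"
  shows "tvs_bounded (A \<union> B)"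
  unfolding tvs_bounded_def
proof (intro allI impI)
  fix W :: "'a set" assume W: "open W \<and> 0 \<in> W"
  have "absorbs W A" using assms(1) W by (simp add: tvs_bounded_def)
  then obtain r where r: "r > 0" "\<And>c. r \<le> cmod c \<Longrightarrow> A \<subseteq> (\<lambda>x. c *\<^sub>C x) ` W"
    unfolding absorbs_def by auto
  have "absorbs W B" using assms(2) W by (simp add: tvs_bounded_def)
  then obtain s where s: "s > 0" "\<And>c. s \<le> cmod c \<Longrightarrow> B \<subseteq> (\<lambda>x. c *\<^sub>C x) ` W"
    unfolding absorbs_def by auto
  show "absorbs W (A \<union> B)"
    unfolding absorbs_def
  proof (intro exI[of _ "max r s"] conjI allI impI)
    fix c assume "max r s \<le> cmod c"
    then show "A \<union> B \<subseteq> (\<lambda>x. c *\<^sub>C x) ` W"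
      using r(2)[of c] s(2)[of c] by simp
  qed (use r(1) in simp)
qed

lemma istopology_clin_ops: "istopology clin_ops_open"
  unfolding istopology_def
proof (intro conjI allI impI)
  fix S T :: "('a \<Rightarrow> 'a) set"
  assume S: "clin_ops_open S" and T: "clin_ops_open T"
  show "clin_ops_open (S \<inter> T)"
    unfolding clin_ops_open_def
  proof (intro conjI ballI)
    show "S \<inter> T \<subseteq> clin_ops" using S by (auto simp: clin_ops_open_def)
    fix R assume R: "R \<in> S \<inter> T"
    obtain B W where BW: "tvs_bounded B" "open W" "0 \<in> W"
        "{P \<in> clin_ops. \<forall>x\<in>B. P x - R x \<in> W} \<subseteq> S"
      using S R unfolding clin_ops_open_def by blast
    obtain B' W' where BW': "tvs_bounded B'" "open W'" "0 \<in> W'"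
        "{P \<in> clin_ops. \<forall>x\<in>B'. P x - R x \<in> W'} \<subseteq> T"
      using T R unfolding clin_ops_open_def by blast
    show "\<exists>B W. tvs_bounded B \<and> open W \<and> 0 \<in> W \<and>
        {P \<in> clin_ops. \<forall>x\<in>B. P x - R x \<in> W} \<subseteq> S \<inter> T"
    proof (intro exI conjI)
      show "tvs_bounded (B \<union> B')" by (rule tvs_bounded_Un[OF BW(1) BW'(1)])
      show "open (W \<inter> W')" using BW(2) BW'(2) by (rule open_Int)
      show "0 \<in> W \<inter> W'" using BW(3) BW'(3) by simp
      show "{P \<in> clin_ops. \<forall>x\<in>B \<union> B'. P x - R x \<in> W \<inter> W'} \<subseteq> S \<inter> T"
        using BW(4) BW'(4) by auto
    qed
  qed
next
  fix K :: "('a \<Rightarrow> 'a) set set"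
  assume K: "\<forall>S\<in>K. clin_ops_open S"
  show "clin_ops_open (\<Union>K)"
    unfolding clin_ops_open_def
  proof (intro conjI ballI)
    show "\<Union>K \<subseteq> clin_ops" using K by (auto simp: clin_ops_open_def)
    fix R assume "R \<in> \<Union>K"
    then obtain S where S: "S \<in> K" "R \<in> S" by blast
    then obtain B W where "tvs_bounded B" "open W" "0 \<in> W"
        "{P \<in> clin_ops. \<forall>x\<in>B. P x - R x \<in> W} \<subseteq> S"
      using K unfolding clin_ops_open_def by blast
    with S(1) show "\<exists>B W. tvs_bounded B \<and> open W \<and> 0 \<in> W \<and>
        {P \<in> clin_ops. \<forall>x\<in>B. P x - R x \<in> W} \<subseteq> \<Union>K"
      by (intro exI[where x = B] exI[where x = W]) auto
  qed
qed

lemma openin_clin_ops_topology: "openin clin_ops_topology = clin_ops_open"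
  unfolding clin_ops_topology_def
  by (rule topology_inverse'[OF istopology_clin_ops])

lemma topspace_clin_ops_topology [simp]: "topspace clin_ops_topology = clin_ops"
proof -
  have "clin_ops_open clin_ops"
    unfolding clin_ops_open_def
    by (intro conjI ballI exI[where x = "{}"] exI[where x = UNIV])
      (simp_all add: tvs_bounded_empty)
  then have "openin clin_ops_topology clin_ops"
    by (simp only: openin_clin_ops_topology)
  moreover have "clin_ops_open (topspace clin_ops_topology)"
    using openin_topspace[of clin_ops_topology] by (simp only: openin_clin_ops_topology)
  then have "topspace clin_ops_topology \<subseteq> clin_ops"
    unfolding clin_ops_open_def by (rule conjunct1)
  ultimately show ?thesis
    by (intro equalityI openin_subset)
qed

definition nth_vderiv :: "nat \<Rightarrow> (real \<Rightarrow> complex) \<Rightarrow> real \<Rightarrow> complex" where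
  "nth_vderiv k = ((\<lambda>f t. vector_derivative f (at t)) ^^ k)"

definition smooth :: "(real \<Rightarrow> complex) \<Rightarrow> bool" where
  "smooth f \<longleftrightarrow> (\<forall>k t. nth_vderiv k f differentiable (at t))"

definition supp :: "(real \<Rightarrow> complex) \<Rightarrow> real set" where
  "supp f = closure {t. f t \<noteq> 0}"

definition test_funs :: "(real \<Rightarrow> complex) set"  (\<open>\<D>\<close>) where
  "\<D> = {\<phi>. smooth \<phi> \<and> compact (supp \<phi>)}"

definition test_funs0 :: "(real \<Rightarrow> complex) set"  (\<open>\<D>\<^sub>0\<close>) where
  "\<D>\<^sub>0 = {\<phi> \<in> \<D>. supp \<phi> \<subseteq> {0..}}"

text \<open>
  The inductive limit topology of \<open>\<D>\<close>: a base of neighbourhoods of \<open>0\<close> is formed by the convex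
  balanced sets \<open>V \<subseteq> \<D>\<close> which meet each space \<open>\<D>\<^sub>K = {\<phi> \<in> \<D>. supp \<phi> \<subseteq> K}\<close>, \<open>K\<close> compact, in
  a neighbourhood of \<open>0\<close> for the Frechet topology given by the seminorms \<open>sup |\<phi>\<^sup>(\<^sup>k\<^sup>)|\<close>.  (Such \<open>V\<close>
  are automatically absorbing.)
\<close>

definition test_nhd0 :: "(real \<Rightarrow> complex) set \<Rightarrow> bool" where
  "test_nhd0 V \<longleftrightarrow> V \<subseteq> \<D> \<and>
     (\<forall>\<phi>\<in>V. \<forall>\<psi>\<in>V. \<forall>u\<in>{0..1}. (\<lambda>t. of_real u * \<phi> t + of_real (1 - u) * \<psi> t) \<in> V) \<and>
     (\<forall>\<phi>\<in>V. \<forall>c. cmod c \<le> 1 \<longrightarrow> (\<lambda>t. c * \<phi> t) \<in> V) \<and>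
     (\<forall>K. compact K \<longrightarrow> (\<exists>m. \<exists>\<epsilon>>0.
        {\<phi> \<in> \<D>. supp \<phi> \<subseteq> K \<and> (\<forall>k\<le>m. \<forall>t. cmod (nth_vderiv k \<phi> t) < \<epsilon>)} \<subseteq> V))"

definition test_open :: "(real \<Rightarrow> complex) set \<Rightarrow> bool" where
  "test_open U \<longleftrightarrow> U \<subseteq> \<D> \<and>
     (\<forall>\<phi>\<in>U. \<exists>V. test_nhd0 V \<and> (\<forall>\<psi>\<in>V. (\<lambda>t. \<phi> t + \<psi> t) \<in> U))"

definition test_topology :: "(real \<Rightarrow> complex) topology" where
  "test_topology = topology test_open"

lemma test_nhd0_Int:
  assumes V: "test_nhd0 V" and W: "test_nhd0 W"
  shows "test_nhd0 (V \<inter> W)"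
  unfolding test_nhd0_def
proof (intro conjI allI impI ballI)
  show "V \<inter> W \<subseteq> \<D>"
    using V by (auto simp only: test_nhd0_def)
next
  fix \<phi> \<psi> and u :: real
  assume "\<phi> \<in> V \<inter> W" "\<psi> \<in> V \<inter> W" "u \<in> {0..1}"
  then show "(\<lambda>t. of_real u * \<phi> t + of_real (1 - u) * \<psi> t) \<in> V \<inter> W"
    using V W unfolding test_nhd0_def by (intro IntI) (simp_all only: Int_iff)
next
  fix \<phi> and c :: complex
  assume "\<phi> \<in> V \<inter> W" "cmod c \<le> 1"
  then show "(\<lambda>t. c * \<phi> t) \<in> V \<inter> W"
    using V W unfolding test_nhd0_def by (intro IntI) (simp_all only: Int_iff)
next
  fix K :: "real set" assume K: "compact K"
  let ?N = "\<lambda>m \<epsilon>. {\<phi> \<in> \<D>. supp \<phi> \<subseteq> K \<and> (\<forall>k\<le>m. \<forall>t. cmod (nth_vderiv k \<phi> t) < \<epsilon>)}"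
  have "\<exists>m. \<exists>\<epsilon>>0. ?N m \<epsilon> \<subseteq> V" "\<exists>m. \<exists>\<epsilon>>0. ?N m \<epsilon> \<subseteq> W"
    using V W K unfolding test_nhd0_def by (simp_all only:)
  then obtain m \<epsilon> n \<delta> where 1: "\<epsilon> > 0" "?N m \<epsilon> \<subseteq> V" and 2: "\<delta> > 0" "?N n \<delta> \<subseteq> W"
    by (elim exE conjE)
  have "?N (max m n) (min \<epsilon> \<delta>) \<subseteq> ?N m \<epsilon>" "?N (max m n) (min \<epsilon> \<delta>) \<subseteq> ?N n \<delta>"
    by auto
  then have "?N (max m n) (min \<epsilon> \<delta>) \<subseteq> V \<inter> W"
    by (rule Int_greatest[OF order_trans[OF _ 1(2)] order_trans[OF _ 2(2)]])
  moreover have "min \<epsilon> \<delta> > 0"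
    using 1(1) 2(1) by simp
  ultimately show "\<exists>m. \<exists>\<epsilon>>0. ?N m \<epsilon> \<subseteq> V \<inter> W"
    by (intro exI conjI)
qed

lemma istopology_test: "istopology test_open"
  unfolding istopology_def
proof (intro conjI allI impI)
  fix S T assume S: "test_open S" and T: "test_open T"
  show "test_open (S \<inter> T)"
    unfolding test_open_def
  proof (intro conjI ballI)
    show "S \<inter> T \<subseteq> \<D>" using S by (auto simp: test_open_def)
    fix \<phi> assume \<phi>: "\<phi> \<in> S \<inter> T"
    obtain V where V: "test_nhd0 V" "\<forall>\<psi>\<in>V. (\<lambda>t. \<phi> t + \<psi> t) \<in> S"
      using S \<phi> unfolding test_open_def by blast
    obtain W where W: "test_nhd0 W" "\<forall>\<psi>\<in>W. (\<lambda>t. \<phi> t + \<psi> t) \<in> T"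
      using T \<phi> unfolding test_open_def by blast
    show "\<exists>V. test_nhd0 V \<and> (\<forall>\<psi>\<in>V. (\<lambda>t. \<phi> t + \<psi> t) \<in> S \<inter> T)"
      by (rule exI[of _ "V \<inter> W"]) (simp add: V W test_nhd0_Int)
  qed
next
  fix K assume K: "\<forall>S\<in>K. test_open S"
  show "test_open (\<Union>K)"
    unfolding test_open_def
  proof (intro conjI ballI)
    show "\<Union>K \<subseteq> \<D>" using K by (auto simp: test_open_def)
    fix \<phi> assume "\<phi> \<in> \<Union>K"
    then obtain S where S: "S \<in> K" "\<phi> \<in> S" by blast
    then obtain V where "test_nhd0 V" "\<forall>\<psi>\<in>V. (\<lambda>t. \<phi> t + \<psi> t) \<in> S"
      using K unfolding test_open_def by blast
    with S(1) show "\<exists>V. test_nhd0 V \<and> (\<forall>\<psi>\<in>V. (\<lambda>t. \<phi> t + \<psi> t) \<in> \<Union>K)"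
      by (intro exI[where x = V]) auto
  qed
qed

lemma openin_test_topology: "openin test_topology = test_open"
  unfolding test_topology_def by (rule topology_inverse'[OF istopology_test])

lemma nth_vderiv_Suc: "nth_vderiv (Suc k) f = (\<lambda>t. vector_derivative (nth_vderiv k f) (at t))"
  by (simp add: nth_vderiv_def)

lemma nth_vderiv_lincomb:
  assumes "smooth f" "smooth g"
  shows "nth_vderiv k (\<lambda>t. c * f t + d * g t) = (\<lambda>t. c * nth_vderiv k f t + d * nth_vderiv k g t)"
proof (induction k)
  case (Suc k)
  have f: "(nth_vderiv k f has_vector_derivative nth_vderiv (Suc k) f t) (at t)" for t
    using assms(1) by (simp only: smooth_def vector_derivative_works nth_vderiv_Suc)
  have g: "(nth_vderiv k g has_vector_derivative nth_vderiv (Suc k) g t) (at t)" for t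
    using assms(2) by (simp only: smooth_def vector_derivative_works nth_vderiv_Suc)
  have "((\<lambda>t. c * nth_vderiv k f t + d * nth_vderiv k g t) has_vector_derivative
          c * nth_vderiv (Suc k) f t + d * nth_vderiv (Suc k) g t) (at t)" for t
    by (intro has_vector_derivative_add has_vector_derivative_mult_right f g)
  then have "vector_derivative (\<lambda>t. c * nth_vderiv k f t + d * nth_vderiv k g t) (at t) =
      c * nth_vderiv (Suc k) f t + d * nth_vderiv (Suc k) g t" for t
    by (rule vector_derivative_at)
  then show ?case
    by (simp only: nth_vderiv_Suc[of k "\<lambda>t. c * f t + d * g t"] Suc.IH)
qed (simp add: nth_vderiv_def)

lemma test_funs_lincomb:
  assumes "f \<in> \<D>" "g \<in> \<D>"
  shows "(\<lambda>t. c * f t + d * g t) \<in> \<D>"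
proof -
  have f: "smooth f" "compact (supp f)" and g: "smooth g" "compact (supp g)"
    using assms by (auto simp: test_funs_def)
  have "smooth (\<lambda>t. c * f t + d * g t)"
    unfolding smooth_def nth_vderiv_lincomb[OF f(1) g(1)]
    using f(1) g(1) unfolding smooth_def
    by (intro allI derivative_intros differentiable_mult) auto
  moreover have "supp (\<lambda>t. c * f t + d * g t) \<subseteq> supp f \<union> supp g"
    unfolding supp_def closure_Un[symmetric] by (rule closure_mono) auto
  then have "compact (supp (\<lambda>t. c * f t + d * g t))"
    using compact_Un[OF f(2) g(2)] closed_closure
    by (metis compact_Int_closed inf.absorb_iff2 supp_def)
  ultimately show ?thesis by (simp add: test_funs_def)
qed

lemma topspace_test_topology [simp]: "topspace test_topology = \<D>"
proof -
  have "test_nhd0 \<D>"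
    unfolding test_nhd0_def
  proof (intro conjI ballI allI impI)
    show "(\<lambda>t. c * \<phi> t) \<in> \<D>" if "\<phi> \<in> \<D>" for \<phi> c
      using test_funs_lincomb[OF that that, of c 0] by simp
    show "\<exists>m. \<exists>\<epsilon>>0. {\<phi> \<in> \<D>. supp \<phi> \<subseteq> K \<and> (\<forall>k\<le>m. \<forall>t. cmod (nth_vderiv k \<phi> t) < \<epsilon>)} \<subseteq> \<D>" for K
      by (auto intro: exI[of _ 1])
  qed (auto intro: test_funs_lincomb)
  then have "test_open \<D>"
    unfolding test_open_def using test_funs_lincomb[of _ _ 1 1] by auto
  then have "openin test_topology \<D>"
    by (simp only: openin_test_topology)
  moreover have "test_open (topspace test_topology)"
    using openin_topspace[of test_topology] by (simp only: openin_test_topology)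
  then have "topspace test_topology \<subseteq> \<D>"
    unfolding test_open_def by (rule conjunct1)
  ultimately show ?thesis
    by (intro equalityI openin_subset)
qed

text \<open>The convolution \<open>\<phi> *\<^sub>0 \<psi>\<close>; the integral is oriented, so \<open>t < 0\<close> is covered.\<close>

definition conv0 :: "(real \<Rightarrow> complex) \<Rightarrow> (real \<Rightarrow> complex) \<Rightarrow> real \<Rightarrow> complex"
    (infixl \<open>*\<^sub>0\<close> 70) where
  "(\<phi> *\<^sub>0 \<psi>) t = (LBINT s=ereal 0..ereal t. \<phi> (t - s) * \<psi> s)"

definition hat :: "(real \<Rightarrow> complex) \<Rightarrow> complex \<Rightarrow> complex" where
  "hat \<phi> \<mu> = complex_of_real (1 / (2 * pi)) * (LBINT t. exp (\<mu> * complex_of_real t) * \<phi> t)"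

text \<open>An operator-valued distribution is a function of which only the values on \<open>\<D>\<close> matter.\<close>

definition op_distribution :: "((real \<Rightarrow> complex) \<Rightarrow> 'a \<Rightarrow> 'a::complex_lcs) \<Rightarrow> bool" where
  "op_distribution G \<longleftrightarrow>
     (\<forall>\<phi>\<in>\<D>. G \<phi> \<in> clin_ops) \<and>
     (\<forall>\<phi>\<in>\<D>. \<forall>\<psi>\<in>\<D>. \<forall>x. G (\<lambda>t. \<phi> t + \<psi> t) x = G \<phi> x + G \<psi> x) \<and>
     (\<forall>\<phi>\<in>\<D>. \<forall>c x. G (\<lambda>t. c * \<phi> t) x = c *\<^sub>C G \<phi> x) \<and>
     continuous_map test_topology clin_ops_topology G"

definition distr_supp :: "((real \<Rightarrow> complex) \<Rightarrow> 'a \<Rightarrow> 'a::complex_lcs) \<Rightarrow> real set" where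
  "distr_supp G = - \<Union>{U. open U \<and> (\<forall>\<phi>\<in>\<D>. supp \<phi> \<subseteq> U \<longrightarrow> (\<forall>x. G \<phi> x = 0))}"

definition pre_C_DS :: "('a \<Rightarrow> 'a) \<Rightarrow> ((real \<Rightarrow> complex) \<Rightarrow> 'a \<Rightarrow> 'a::complex_lcs) \<Rightarrow> bool" where
  "pre_C_DS C G \<longleftrightarrow>
     op_distribution G \<and> distr_supp G \<subseteq> {0..} \<and>
     (\<forall>\<phi>\<in>\<D>. C \<circ> G \<phi> = G \<phi> \<circ> C) \<and>
     (\<forall>\<phi>\<in>\<D>. \<forall>\<psi>\<in>\<D>. G (\<phi> *\<^sub>0 \<psi>) \<circ> C = G \<phi> \<circ> G \<psi>)"

definition generator :: "((real \<Rightarrow> complex) \<Rightarrow> 'a \<Rightarrow> 'a::complex_lcs) \<Rightarrow> ('a \<times> 'a) set" where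
  "generator G = {(x, y). \<forall>\<phi>\<in>\<D>\<^sub>0. G (\<lambda>t. - vector_derivative \<phi> (at t)) x = G \<phi> y}"

definition closed_MLO :: "('a \<times> 'a::complex_lcs) set \<Rightarrow> bool" where
  "closed_MLO A \<longleftrightarrow> complex_vector.subspace A \<and> closed A"

definition shift_MLO :: "complex \<Rightarrow> ('a \<times> 'a::complex_lcs) set \<Rightarrow> ('a \<times> 'a) set" where
  "shift_MLO \<mu> A = {(x, \<mu> *\<^sub>C x - y) | x y. (x, y) \<in> A}"

definition has_riemann_integral ::
    "(real \<Rightarrow> 'a::complex_lcs) \<Rightarrow> 'a \<Rightarrow> real \<Rightarrow> real \<Rightarrow> bool" where
  "has_riemann_integral f I r s \<longleftrightarrow>
     (\<forall>U. open U \<and> I \<in> U \<longrightarrow> (\<exists>\<delta>>0. \<forall>p. p tagged_division_of {r..s} \<and> (\<lambda>x. ball x \<delta>) fine p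
        \<longrightarrow> (\<Sum>(x, k)\<in>p. measure lborel k *\<^sub>R f x) \<in> U))"

text \<open>
  The improper line integral of \<open>f\<close> along a curve \<open>\<gamma> : \<real> \<rightarrow> \<complex>\<close>; both ends tend to infinity
  independently.  At the finitely many corners of a piecewise smooth curve
  \<^const>\<open>vector_derivative\<close> is an unspecified number, which does not affect the integral.
\<close>

definition has_line_integral ::
    "(real \<Rightarrow> complex) \<Rightarrow> (complex \<Rightarrow> 'a::complex_lcs) \<Rightarrow> 'a \<Rightarrow> bool" where
  "has_line_integral \<gamma> f I \<longleftrightarrow>
     (\<exists>J. (\<forall>r s. r \<le> s \<longrightarrow>
            has_riemann_integral (\<lambda>t. vector_derivative \<gamma> (at t) *\<^sub>C f (\<gamma> t)) (J r s) r s) \<and>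
          ((\<lambda>(r, s). J r s) \<longlongrightarrow> I) (at_bot \<times>\<^sub>F at_top))"

definition line_integrable :: "(real \<Rightarrow> complex) \<Rightarrow> (complex \<Rightarrow> 'a::complex_lcs) \<Rightarrow> bool" where
  "line_integrable \<gamma> f \<longleftrightarrow> (\<exists>I. has_line_integral \<gamma> f I)"

definition line_integral :: "(real \<Rightarrow> complex) \<Rightarrow> (complex \<Rightarrow> 'a::complex_lcs) \<Rightarrow> 'a" where
  "line_integral \<gamma> f = (THE I. has_line_integral \<gamma> f I)"

definition analytic_into :: "complex set \<Rightarrow> (complex \<Rightarrow> 'a::complex_lcs) \<Rightarrow> bool" where
  "analytic_into S f \<longleftrightarrow>
     (\<forall>z\<in>S. \<exists>d. ((\<lambda>w. inverse (w - z) *\<^sub>C (f w - f z)) \<longlongrightarrow> d) (at z))"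

definition exp_region :: "real \<Rightarrow> real \<Rightarrow> complex set" where
  "exp_region a b = {\<mu>. b \<le> Re \<mu> \<and> \<bar>Im \<mu>\<bar> \<le> exp (a * Re \<mu>)}"

text \<open>
  The upwards oriented boundary of the region, parametrized by the imaginary part: the vertical
  segment \<open>Re \<mu> = b\<close> and the curves \<open>\<bar>Im \<mu>\<bar> = exp (a * Re \<mu>)\<close>.
\<close>

definition Gamma_curve :: "real \<Rightarrow> real \<Rightarrow> real \<Rightarrow> complex" where
  "Gamma_curve a b s = Complex (if \<bar>s\<bar> \<le> exp (a * b) then b else ln \<bar>s\<bar> / a) s"

definition Omega_region :: "real \<Rightarrow> real \<Rightarrow> complex set" where
  "Omega_region a b = {\<mu>. Re (Gamma_curve a b (Im \<mu>)) < Re \<mu>}"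

lemma Omega_region_eq:
  assumes "a > 0"
  shows "Omega_region a b = {\<mu>. b < Re \<mu> \<and> \<bar>Im \<mu>\<bar> < exp (a * Re \<mu>)}"
proof -
  have "Re (Gamma_curve a b (Im z)) < Re z \<longleftrightarrow> b < Re z \<and> \<bar>Im z\<bar> < exp (a * Re z)" for z
  proof (cases "\<bar>Im z\<bar> \<le> exp (a * b)")
    case True
    have "\<bar>Im z\<bar> < exp (a * Re z)" if "b < Re z"
      using True that assms by (smt (verit) exp_less_mono mult_strict_left_mono)
    then show ?thesis using True by (auto simp: Gamma_curve_def)
  next
    case False
    then have pos: "\<bar>Im z\<bar> > 0" by (smt (verit) exp_gt_zero)
    have "ln \<bar>Im z\<bar> / a < Re z \<longleftrightarrow> ln \<bar>Im z\<bar> < a * Re z"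
      using assms by (simp add: pos_divide_less_eq mult.commute)
    also have "\<dots> \<longleftrightarrow> \<bar>Im z\<bar> < exp (a * Re z)"
      using pos by (metis exp_ln exp_less_cancel_iff)
    finally have *: "ln \<bar>Im z\<bar> / a < Re z \<longleftrightarrow> \<bar>Im z\<bar> < exp (a * Re z)" .
    have "b < Re z" if "\<bar>Im z\<bar> < exp (a * Re z)"
    proof -
      have "exp (a * b) < exp (a * Re z)" using that False by linarith
      then show ?thesis using assms by simp
    qed
    then show ?thesis using False * by (auto simp: Gamma_curve_def)
  qed
  then show ?thesis by (auto simp: Omega_region_def)
qed

lemma Gamma_curve_range:
  assumes "a > 0"
  shows "range (Gamma_curve a b) = exp_region a b - Omega_region a b"
proof (intro equalityI subsetI)
  fix z assume "z \<in> range (Gamma_curve a b)"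
  then obtain s where z: "z = Gamma_curve a b s" by auto
  have "exp (a * b) < \<bar>s\<bar> \<Longrightarrow> a * b < ln \<bar>s\<bar> \<and> exp (ln \<bar>s\<bar>) = \<bar>s\<bar>"
    by (smt (verit) exp_gt_zero exp_ln exp_less_cancel_iff)
  then show "z \<in> exp_region a b - Omega_region a b"
    using assms
    by (auto simp: z Omega_region_def exp_region_def Gamma_curve_def field_simps not_le
        intro: less_imp_le)
next
  fix z assume z: "z \<in> exp_region a b - Omega_region a b"
  have "Re z = (if \<bar>Im z\<bar> \<le> exp (a * b) then b else ln \<bar>Im z\<bar> / a)"
  proof (cases "\<bar>Im z\<bar> \<le> exp (a * b)")
    case True
    then show ?thesis using z by (auto simp: exp_region_def Omega_region_def Gamma_curve_def)
  next
    case False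
    then have pos: "\<bar>Im z\<bar> > 0" by (smt (verit) exp_gt_zero)
    have "ln \<bar>Im z\<bar> \<le> a * Re z"
      using z pos ln_mono[of "\<bar>Im z\<bar>" "exp (a * Re z)"] by (simp add: exp_region_def)
    then have "ln \<bar>Im z\<bar> / a \<le> Re z" using assms by (simp add: pos_divide_le_eq mult.commute)
    then show ?thesis
      using z False by (auto simp: Omega_region_def Gamma_curve_def)
  qed
  then have "z = Gamma_curve a b (Im z)"
    by (simp add: Gamma_curve_def complex_eq_iff)
  then show "z \<in> range (Gamma_curve a b)" by blast
qed

lemma Gamma_curve_frontier:
  assumes "a > 0"
  shows "range (Gamma_curve a b) = frontier (exp_region a b)"
proof -
  have "closed (exp_region a b)"
    unfolding exp_region_def
    by (intro closed_Collect_conj closed_Collect_le continuous_intros)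
  moreover have "interior (exp_region a b) = Omega_region a b"
  proof (rule interior_unique)
    show "Omega_region a b \<subseteq> exp_region a b"
      by (auto simp: Omega_region_eq[OF assms] exp_region_def)
    show "open (Omega_region a b)"
      unfolding Omega_region_eq[OF assms]
      by (intro open_Collect_conj open_Collect_less continuous_intros)
    fix T assume T: "T \<subseteq> exp_region a b" "open T"
    show "T \<subseteq> Omega_region a b"
    proof
      fix z assume "z \<in> T"
      then obtain e where e: "e > 0" "cball z e \<subseteq> T"
        using T(2) open_contains_cball by blast
      have "z - of_real e \<in> cball z e" using e(1) by (simp add: dist_norm)
      then have "z - of_real e \<in> exp_region a b" using e T by blast
      then have *: "b \<le> Re z - e" "\<bar>Im z\<bar> \<le> exp (a * (Re z - e))" by (auto simp: exp_region_def)
      have "exp (a * (Re z - e)) < exp (a * Re z)" using assms e(1) by simp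
      then show "z \<in> Omega_region a b"
        unfolding Omega_region_eq[OF assms] mem_Collect_eq using * e(1) by linarith
    qed
  qed
  ultimately show ?thesis
    by (simp add: Gamma_curve_range[OF assms] frontier_def)
qed

end

theory Submission
  imports Defs "HOL-Complex_Analysis.Complex_Analysis" "HOL-Probability.Sinc_Integral"
begin

text \<open>
  For weights \<open>g\<close> that decay rapidly on the contour let \<open>S g x\<close> be the integral of \<open>g(\<mu>) F(\<mu>) x\<close>
  along it, so that \<open>G(\<phi>) = -\<i> S(hat \<phi>)\<close>. On the contour \<open>Re \<mu> = ln |Im \<mu>| / a\<close> far out, so
  \<open>exp(c Re \<mu>)\<close> is only a power of \<open>|Im \<mu>|\<close> there; hence transforms of test functions, which are at most of order
  \<open>exp(m Re \<mu>) / |\<mu>|^k\<close> for every \<open>k\<close>, are such weights, and remain so after multiplication by \<open>exp(h \<mu>)\<close>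
  with real \<open>h\<close>.

  Vectors are handled through continuous functionals \<open>f\<close>: by the Hahn-Banach theorem they separate
  points, and every continuous seminorm is a supremum of functionals. Since \<open>f(S g x)\<close> is an absolutely
  convergent scalar integral, scalar estimates that are uniform in \<open>f\<close> give, with sequential
  completeness, the existence of the integrals (\<open>line_integral_weak\<close>), their linearity and the bounds
  that make \<open>G\<close> continuous. They also give the support property: if \<open>\<phi>\<close> vanishes on the positive half
  line, its transform decays in the whole right half plane, and Cauchy's theorem (\<open>contour_int_eq_zero\<close>) yields
  \<open>G(\<phi>) = 0\<close>.

  The product formula comes from a differential equation instead of a double contour integral. Inserting
  the pair \<open>(F(\<mu>) x, \<mu> F(\<mu>) x - C x)\<close> of \<open>A\<close> into \<open>\<nu> F(\<nu>) u - C u = F(\<nu>) v\<close> gives the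
  resolvent identity \<open>(\<nu> - \<mu>) F(\<nu>) F(\<mu>) = F(\<mu>) C - F(\<nu>) C\<close>, which integrates to
  \<open>S(\<mu> g) S(k) - S(g) S(\<mu> k) = j(g) S(k) C - j(k) S(g) C\<close>, where \<open>j\<close> denotes the scalar contour
  integral and \<open>\<mu> g\<close> the weight \<open>g\<close> multiplied by the variable (\<open>S_S\<close>). Moreover \<open>j(hat \<phi>) = \<i> \<phi>(0)\<close> by
  Fourier inversion (\<open>contour_int_hat\<close>). Now translate \<open>\<phi>\<close> to the left and \<open>\<psi>\<close> to the right by \<open>h\<close>, and put
  \<open>W(h) = S(exp(-h \<mu>) hat \<phi>) S(exp(h \<mu>) hat \<psi>) x\<close>. The integrated resolvent identity says that
  \<open>W'(h) = \<i> (\<psi>(-h) S(exp(-h \<mu>) hat \<phi>) C x - \<phi>(h) S(exp(h \<mu>) hat \<psi>) C x)\<close>.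
  The right-hand side has an explicit primitive \<open>V\<close> with \<open>V(0) = 0\<close>, whose value for large \<open>h\<close> is
  \<open>-\<i> S(hat(\<phi> *\<^sub>0 \<psi>)) C x\<close> (\<open>hat_conv0\<close>). For large \<open>h\<close> the translate of \<open>\<phi>\<close> lives on the negative half line,
  so \<open>W(h) = 0\<close> there, and comparing \<open>W - V\<close> at both ends gives
  \<open>S(hat \<phi>) S(hat \<psi>) x = \<i> S(hat(\<phi> *\<^sub>0 \<psi>)) C x\<close> (\<open>S_hat_product\<close>).

  Finally, for \<open>(x, y)\<close> in the graph of \<open>A\<close>, the equation \<open>\<mu> F(\<mu>) x - C x = F(\<mu>) y\<close> integrates
  to \<open>S(\<mu> hat \<phi>) x - S(hat \<phi>) y = \<i> \<phi>(0) C x\<close>.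
  For \<open>\<phi>\<close> supported in \<open>[0, \<infinity>)\<close> the right-hand side vanishes, and \<open>\<mu> hat \<phi>\<close> is the transform of
  \<open>-\<phi>'\<close>: this is membership in the generator.
\<close>

section \<open>The Hahn-Banach theorem\<close>

definition sublinear :: "('a::real_vector \<Rightarrow> real) \<Rightarrow> bool" where
  "sublinear q \<longleftrightarrow> (\<forall>x y. q (x + y) \<le> q x + q y) \<and> (\<forall>t\<ge>0. \<forall>x. q (t *\<^sub>R x) = t * q x)"

lemma sublinear_add: "sublinear q \<Longrightarrow> q (x + y) \<le> q x + q y"
  and sublinear_scaleR: "sublinear q \<Longrightarrow> t \<ge> 0 \<Longrightarrow> q (t *\<^sub>R x) = t * q x"
  by (auto simp: sublinear_def)

lemma sublinear_zero: "sublinear q \<Longrightarrow> q 0 = 0"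
  using sublinear_scaleR[of q 0 0] by simp

lemma sublinear_minus_le: "sublinear q \<Longrightarrow> - q (- x) \<le> q x"
  using sublinear_add[of q x "- x"] sublinear_zero[of q] by simp

text \<open>
  The functional \<open>flatten q y\<close> lies below \<open>q\<close> and satisfies \<open>flatten q y (- y) \<le> - q y\<close>. So a minimal
  sublinear functional, which equals all its flattenings, is additive.
\<close>

definition flatten :: "('a::real_vector \<Rightarrow> real) \<Rightarrow> 'a \<Rightarrow> 'a \<Rightarrow> real" where
  "flatten q y x = (INF t\<in>{0..}. q (x + t *\<^sub>R y) - t * q y)"

lemma flatten_bdd:
  assumes "sublinear q"
  shows "bdd_below ((\<lambda>t. q (x + t *\<^sub>R y) - t * q y) ` {0..})"
proof (rule bdd_belowI2[where m = "- q (- x)"])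
  fix t :: real assume "t \<in> {0..}"
  then have "t * q y = q (t *\<^sub>R y)" using sublinear_scaleR[OF assms] by simp
  also have "\<dots> \<le> q (x + t *\<^sub>R y) + q (- x)"
    using sublinear_add[OF assms, of "x + t *\<^sub>R y" "- x"] by simp
  finally show "- q (- x) \<le> q (x + t *\<^sub>R y) - t * q y" by simp
qed

lemma flatten_le:
  assumes "sublinear q" "t \<ge> 0"
  shows "flatten q y x \<le> q (x + t *\<^sub>R y) - t * q y"
  unfolding flatten_def using assms by (intro cINF_lower flatten_bdd) auto

lemma flatten_greatest:
  assumes "\<And>t. t \<ge> 0 \<Longrightarrow> c \<le> q (x + t *\<^sub>R y) - t * q y"
  shows "c \<le> flatten q y x"
  unfolding flatten_def using assms by (intro cINF_greatest) auto

lemma sublinear_flatten: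
  assumes q: "sublinear q"
  shows "sublinear (flatten q y)"
proof -
  have add: "flatten q y (x + z) \<le> flatten q y x + flatten q y z" for x z
  proof -
    have "flatten q y (x + z) - (q (z + s *\<^sub>R y) - s * q y) \<le> q (x + t *\<^sub>R y) - t * q y"
      if "s \<ge> 0" "t \<ge> 0" for s t
    proof -
      have "flatten q y (x + z) \<le> q (x + z + (s + t) *\<^sub>R y) - (s + t) * q y"
        using that by (intro flatten_le q) auto
      also have "x + z + (s + t) *\<^sub>R y = (x + t *\<^sub>R y) + (z + s *\<^sub>R y)"
        by (simp add: scaleR_add_left algebra_simps)
      finally show ?thesis
        using sublinear_add[OF q, of "x + t *\<^sub>R y" "z + s *\<^sub>R y"] by (simp add: algebra_simps)
    qed
    then have "flatten q y (x + z) - (q (z + s *\<^sub>R y) - s * q y) \<le> flatten q y x" if "s \<ge> 0" for s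
      using that by (intro flatten_greatest) auto
    then have "flatten q y (x + z) - flatten q y x \<le> flatten q y z"
      by (intro flatten_greatest) (smt (verit))
    then show ?thesis by simp
  qed
  have le: "flatten q y (s *\<^sub>R x) \<le> s * flatten q y x" if "s > 0" for s x
  proof -
    have "flatten q y (s *\<^sub>R x) / s \<le> q (x + t *\<^sub>R y) - t * q y" if "t \<ge> 0" for t
    proof -
      have "flatten q y (s *\<^sub>R x) \<le> q (s *\<^sub>R x + (s * t) *\<^sub>R y) - s * t * q y"
        using that \<open>s > 0\<close> by (intro flatten_le q) auto
      also have "s *\<^sub>R x + (s * t) *\<^sub>R y = s *\<^sub>R (x + t *\<^sub>R y)" by (simp add: scaleR_add_right)
      also have "q \<dots> = s * q (x + t *\<^sub>R y)" using sublinear_scaleR[OF q] \<open>s > 0\<close> by simp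
      finally show ?thesis using \<open>s > 0\<close> by (simp add: field_simps)
    qed
    then have "flatten q y (s *\<^sub>R x) / s \<le> flatten q y x" by (intro flatten_greatest)
    then show ?thesis using that by (simp add: field_simps)
  qed
  have "flatten q y (s *\<^sub>R x) = s * flatten q y x" if "s \<ge> 0" for s x
  proof (cases "s = 0")
    case True
    have "q (t *\<^sub>R y) - t * q y = 0" if "t \<ge> 0" for t using sublinear_scaleR[OF q that] by simp
    then have "flatten q y 0 = 0"
      using flatten_le[OF q, of 0 y 0] sublinear_zero[OF q]
      by (intro antisym flatten_greatest) auto
    then show ?thesis using True by simp
  next
    case False
    then have s: "s > 0" using that by simp
    have "s * flatten q y x \<le> flatten q y (s *\<^sub>R x)"
      using le[of "inverse s" "s *\<^sub>R x"] s by (simp add: field_simps)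
    then show ?thesis using le[OF s, of x] by simp
  qed
  then show ?thesis using add by (auto simp: sublinear_def)
qed

text \<open>
  Zorn's lemma applies to the sublinear functionals below \<open>p\<close>: on a chain the values at \<open>x\<close> are bounded
  below by \<open>- p (- x)\<close>, and subadditivity passes to the pointwise infimum because any two members
  of the chain are comparable.
\<close>

lemma exists_minimal_sublinear:
  assumes p: "sublinear p"
  obtains m where "sublinear m" "\<And>x. m x \<le> p x"
    "\<And>q. sublinear q \<Longrightarrow> (\<And>x. q x \<le> m x) \<Longrightarrow> q = m"
proof -
  define A where "A = {q. sublinear q \<and> (\<forall>x. q x \<le> p x)}"
  define P where "P q q' \<longleftrightarrow> (\<forall>x. q' x \<le> q x)" for q q' :: "'a \<Rightarrow> real"
  have "\<exists>m\<in>A. \<forall>q\<in>A. P m q \<longrightarrow> q = m"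
  proof (rule predicate_Zorn)
    show "partial_order_on A (relation_of P A)"
      by (rule partial_order_on_relation_ofI) (auto simp: P_def fun_eq_iff intro: order_trans antisym)
  next
    fix K assume K: "K \<in> Chains (relation_of P A)"
    have KA: "K \<subseteq> A" and tot: "\<And>q q'. q \<in> K \<Longrightarrow> q' \<in> K \<Longrightarrow> P q q' \<or> P q' q"
      using K by (auto simp: Chains_def relation_of_def)
    show "\<exists>u\<in>A. \<forall>q\<in>K. P q u"
    proof (cases "K = {}")
      case True
      then show ?thesis using p by (auto simp: A_def)
    next
      case False
      define u where "u x = (INF q\<in>K. q x)" for x
      have bdd: "bdd_below ((\<lambda>q. q x) ` K)" for x
      proof (rule bdd_belowI2)
        fix q assume "q \<in> K"
        then have "sublinear q" "q (- x) \<le> p (- x)" using KA by (auto simp: A_def)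
        then show "- p (- x) \<le> q x" using sublinear_minus_le[of q x] by linarith
      qed
      have u_le: "u x \<le> q x" if "q \<in> K" for q x
        unfolding u_def using that bdd by (intro cINF_lower)
      have u_ge: "c \<le> u x" if "\<And>q. q \<in> K \<Longrightarrow> c \<le> q x" for c x
        unfolding u_def using that False by (intro cINF_greatest)
      have add: "u (x + y) \<le> u x + u y" for x y
      proof -
        have "u (x + y) - q' y \<le> q x" if q: "q \<in> K" "q' \<in> K" for q q'
        proof -
          obtain r where r: "r \<in> K" "r x \<le> q x" "r y \<le> q' y"
            using tot[OF q] q by (auto simp: P_def)
          have "u (x + y) \<le> r (x + y)" using u_le r by simp
          also have "\<dots> \<le> r x + r y" using r KA by (intro sublinear_add) (auto simp: A_def)
          finally show ?thesis using r by linarith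
        qed
        then have "u (x + y) - q' y \<le> u x" if "q' \<in> K" for q'
          using that by (intro u_ge) auto
        then have "u (x + y) - u x \<le> u y" by (intro u_ge) (smt (verit))
        then show ?thesis by simp
      qed
      have hom: "u (t *\<^sub>R x) = t * u x" if "t \<ge> 0" for t x
      proof (cases "t = 0")
        case True
        have "q 0 = 0" if "q \<in> K" for q using that KA sublinear_zero by (auto simp: A_def)
        then have "u 0 = 0"
          using False u_le[of _ 0] u_ge[of 0 0] by (metis all_not_in_conv antisym order_refl)
        then show ?thesis using True by simp
      next
        case False
        then have t: "t > 0" using that by simp
        have eq: "q (t *\<^sub>R x) = t * q x" if "q \<in> K" for q
          using that KA t sublinear_scaleR[of q t x] by (auto simp: A_def)
        have "u (t *\<^sub>R x) / t \<le> u x"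
        proof (rule u_ge)
          fix q assume "q \<in> K"
          then show "u (t *\<^sub>R x) / t \<le> q x"
            using u_le[of q "t *\<^sub>R x"] eq[of q] t by (simp add: field_simps)
        qed
        moreover have "t * u x \<le> u (t *\<^sub>R x)"
        proof (rule u_ge)
          fix q assume "q \<in> K"
          then show "t * u x \<le> q (t *\<^sub>R x)" using u_le[of q x] eq[of q] t by simp
        qed
        ultimately show ?thesis using t by (simp add: field_simps)
      qed
      have "u x \<le> p x" for x
      proof -
        obtain q where "q \<in> K" using False by blast
        then have "q x \<le> p x" using KA by (auto simp: A_def)
        then show ?thesis using u_le[OF \<open>q \<in> K\<close>, of x] by simp
      qed
      then have "u \<in> A" using add hom by (auto simp: A_def sublinear_def)
      then show ?thesis using u_le by (auto simp: P_def)
    qed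
  qed
  then obtain m where m: "m \<in> A" "\<And>q. q \<in> A \<Longrightarrow> P m q \<Longrightarrow> q = m" by blast
  show thesis
  proof (rule that)
    fix q assume "sublinear q" "\<And>x. q x \<le> m x"
    then show "q = m" using m by (intro m(2)) (auto simp: A_def P_def intro: order_trans)
  qed (use m(1) in \<open>auto simp: A_def\<close>)
qed

text \<open>
  A minimal sublinear functional is linear. Starting from \<open>flatten p y\<close> instead of \<open>p\<close> forces the
  value at \<open>y\<close> up to \<open>p y\<close>.
\<close>

theorem real_Hahn_Banach:
  assumes p: "sublinear p"
  obtains g where "\<And>x y. g (x + y) = g x + g y" "\<And>t x. g (t *\<^sub>R x) = t * g x"
    "\<And>x. g x \<le> p x" "g y = p y"
proof -
  obtain m where m: "sublinear m" "\<And>x. m x \<le> flatten p y x"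
    "\<And>q. sublinear q \<Longrightarrow> (\<And>x. q x \<le> m x) \<Longrightarrow> q = m"
    using exists_minimal_sublinear[OF sublinear_flatten[OF p, of y]] by blast
  have add: "m (x + z) = m x + m z" for x z
  proof -
    have "flatten m z = m"
      using flatten_le[OF m(1), of 0 z] by (intro m(3) sublinear_flatten m(1)) auto
    then have "m x \<le> m (x + 1 *\<^sub>R z) - 1 * m z"
      using flatten_le[OF m(1), of 1 z x] by simp
    then show ?thesis using sublinear_add[OF m(1), of x z] by simp
  qed
  have minus: "m (- x) = - m x" for x
    using add[of x "- x"] sublinear_zero[OF m(1)] by simp
  have scale: "m (t *\<^sub>R x) = t * m x" for t x
    using sublinear_scaleR[OF m(1), of t x] sublinear_scaleR[OF m(1), of "- t" x] minus[of "t *\<^sub>R x"]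
    by (cases "t \<ge> 0") auto
  have le: "m x \<le> p x" for x
    using m(2)[of x] flatten_le[OF p, of 0 y x] by simp
  have "m (- y) \<le> - p y"
    using m(2)[of "- y"] flatten_le[OF p, of 1 y "- y"] sublinear_zero[OF p] by simp
  then have "m y = p y" using minus[of y] le[of y] by simp
  then show thesis using that[of m] add scale le by blast
qed

definition seminorm :: "('a::complex_vector \<Rightarrow> real) \<Rightarrow> bool" where
  "seminorm p \<longleftrightarrow> (\<forall>x y. p (x + y) \<le> p x + p y) \<and> (\<forall>c x. p (c *\<^sub>C x) = cmod c * p x)"

definition functional_le :: "('a::complex_vector \<Rightarrow> complex) \<Rightarrow> ('a \<Rightarrow> real) \<Rightarrow> bool" where
  "functional_le f p \<longleftrightarrow>
     (\<forall>x y. f (x + y) = f x + f y) \<and> (\<forall>c x. f (c *\<^sub>C x) = c * f x) \<and> (\<forall>x. cmod (f x) \<le> p x)"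

lemma seminorm_add: "seminorm p \<Longrightarrow> p (x + y) \<le> p x + p y"
  and seminorm_scaleC: "seminorm p \<Longrightarrow> p (c *\<^sub>C x) = cmod c * p x"
  by (auto simp: seminorm_def)

lemma seminorm_zero: "seminorm p \<Longrightarrow> p 0 = 0"
  using seminorm_scaleC[of p 0 0] by simp

lemma seminorm_minus: "seminorm p \<Longrightarrow> p (- x) = p x"
  using seminorm_scaleC[of p "- 1" x]
  by (simp add: complex_vector.scale_minus_left scaleC_one)

lemma seminorm_diff: "seminorm p \<Longrightarrow> p (x - y) \<le> p x + p y"
  using seminorm_add[of p x "- y"] seminorm_minus[of p y] by simp

lemma seminorm_nonneg: "seminorm p \<Longrightarrow> 0 \<le> p x"
  using seminorm_diff[of p x x] seminorm_zero[of p] by simp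

lemma seminorm_scaleR: "seminorm p \<Longrightarrow> p (t *\<^sub>R x) = \<bar>t\<bar> * p x"
  using seminorm_scaleC[of p "of_real t" x] by (simp add: scaleR_scaleC)

lemma seminorm_minus_commute: "seminorm p \<Longrightarrow> p (x - y) = p (y - x)"
  using seminorm_minus[of p "x - y"] by simp

lemma seminorm_diff_abs: "seminorm p \<Longrightarrow> \<bar>p x - p y\<bar> \<le> p (x - y)"
  using seminorm_add[of p "x - y" y] seminorm_add[of p "y - x" x] seminorm_minus_commute[of p x y]
  by simp

lemma seminorm_sum: "seminorm p \<Longrightarrow> p (sum f S) \<le> (\<Sum>i\<in>S. p (f i))"
proof (induction S rule: infinite_finite_induct)
  case (insert i S)
  then show ?case using seminorm_add[of p "f i" "sum f S"] by simp
qed (simp_all add: seminorm_zero)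

lemma seminorm_sublinear: "seminorm p \<Longrightarrow> sublinear p"
  by (simp add: sublinear_def seminorm_add seminorm_scaleR)

lemma functional_add: "functional_le f p \<Longrightarrow> f (x + y) = f x + f y"
  and functional_scaleC: "functional_le f p \<Longrightarrow> f (c *\<^sub>C x) = c * f x"
  and functional_bound: "functional_le f p \<Longrightarrow> cmod (f x) \<le> p x"
  by (auto simp: functional_le_def)

lemma functional_zero: "functional_le f p \<Longrightarrow> f 0 = 0"
  using functional_scaleC[of f p 0 0] by simp

lemma functional_minus: "functional_le f p \<Longrightarrow> f (- x) = - f x"
  using functional_add[of f p x "- x"] functional_zero[of f p]
  by (metis add.right_inverse minus_unique)

lemma functional_diff: "functional_le f p \<Longrightarrow> f (x - y) = f x - f y"
  using functional_add[of f p x "- y"] functional_minus[of f p y] by simp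

lemma functional_scaleR: "functional_le f p \<Longrightarrow> f (t *\<^sub>R x) = t *\<^sub>R f x"
  by (simp add: scaleR_scaleC functional_scaleC scaleR_conv_of_real)

lemma functional_sum: "functional_le f p \<Longrightarrow> f (sum g S) = (\<Sum>i\<in>S. f (g i))"
  by (induction S rule: infinite_finite_induct) (simp_all add: functional_zero functional_add)

text \<open>
  The functional is recovered from its real part \<open>g\<close> as \<open>g x - \<i> g (\<i> x)\<close>. Rotating \<open>x\<close> by a number of
  modulus 1 makes \<open>f x\<close> real and nonnegative, which turns \<open>g \<le> p\<close> into \<open>|f| \<le> p\<close>.
\<close>

theorem Hahn_Banach:
  fixes p :: "'a::complex_vector \<Rightarrow> real"
  assumes p: "seminorm p"
  obtains f where "functional_le f p" "f y = complex_of_real (p y)"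
proof -
  obtain g where g: "\<And>x y. g (x + y) = g x + g y" "\<And>t x. g (t *\<^sub>R x) = t * g x"
    "\<And>x. g x \<le> p x" "g y = p y"
    using real_Hahn_Banach[OF seminorm_sublinear[OF p], of y] by blast
  define f where "f x = Complex (g x) (- g (\<i> *\<^sub>C x))" for x
  have g_C: "g (c *\<^sub>C x) = Re c * g x + Im c * g (\<i> *\<^sub>C x)" for c x
  proof -
    have "c *\<^sub>C x = Re c *\<^sub>R x + Im c *\<^sub>R (\<i> *\<^sub>C x)"
      by (simp add: scaleR_scaleC scaleC_scaleC scaleC_add_left[symmetric] complex_eq mult.commute)
    then show ?thesis using g by simp
  qed
  have fC: "f (c *\<^sub>C x) = c * f x" for c x
    using g_C[of c x] g_C[of "\<i> * c" x] by (simp add: f_def complex_eq_iff scaleC_scaleC)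
  have bd: "cmod (f x) \<le> p x" for x
  proof -
    define c where "c = (if f x = 0 then 1 else cnj (f x) / cmod (f x))"
    have c: "cmod c = 1" "c * f x = cmod (f x)"
      by (auto simp: c_def norm_divide mult.commute[of "cnj _"] complex_norm_square[symmetric]
          power2_eq_square)
    have "cmod (f x) = Re (f (c *\<^sub>C x))" by (simp add: fC c)
    also have "\<dots> \<le> p (c *\<^sub>C x)" using g(3) by (simp add: f_def)
    finally show ?thesis using seminorm_scaleC[OF p] c by simp
  qed
  have fadd: "f (x + z) = f x + f z" for x z
    by (simp add: f_def complex_eq_iff g(1) scaleC_add_right)
  have fp: "functional_le f p"
    using fC fadd bd by (auto simp: functional_le_def)
  have "Re (f y) = p y" using g by (simp add: f_def)
  moreover have "Im (f y) = 0"
  proof -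
    have "(Re (f y))\<^sup>2 + (Im (f y))\<^sup>2 \<le> (p y)\<^sup>2"
      using power_mono[OF bd[of y], of 2] by (simp add: cmod_power2)
    then show ?thesis using \<open>Re (f y) = p y\<close> by simp
  qed
  ultimately show thesis using that[OF fp] by (simp add: complex_eq_iff)
qed

text \<open>
  Through this rule every estimate in the space reduces to a scalar estimate that is uniform in \<open>f\<close>.
\<close>

lemma seminorm_le_functional:
  assumes "seminorm p" "\<And>f. functional_le f p \<Longrightarrow> cmod (f x) \<le> B"
  shows "p x \<le> B"
proof -
  obtain f where f: "functional_le f p" "f x = complex_of_real (p x)"
    using Hahn_Banach[OF assms(1)] .
  then show ?thesis using assms(2)[OF f(1)] seminorm_nonneg[OF assms(1)] by simp
qed

section \<open>Continuous seminorms\<close>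

definition cseminorm :: "('a::complex_lcs \<Rightarrow> real) \<Rightarrow> bool" where
  "cseminorm p \<longleftrightarrow> seminorm p \<and> continuous_on UNIV p"

lemma cseminorm_seminorm: "cseminorm p \<Longrightarrow> seminorm p"
  by (simp add: cseminorm_def)

lemma continuous_on_scaleC [continuous_intros]:
  fixes f :: "_ \<Rightarrow> 'a::complex_lcs"
  assumes "continuous_on S c" "continuous_on S f"
  shows "continuous_on S (\<lambda>x. c x *\<^sub>C f x)"
  unfolding continuous_on_def
proof
  fix x assume "x \<in> S"
  then have "((\<lambda>y. (c y, f y)) \<longlongrightarrow> (c x, f x)) (at x within S)"
    using assms by (auto simp: continuous_on_def intro: tendsto_Pair)
  then have "filterlim (\<lambda>y. (c y, f y)) (nhds (c x) \<times>\<^sub>F nhds (f x)) (at x within S)"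
    by (simp add: nhds_prod)
  from filterlim_compose[OF tendsto_scaleC_Pair this]
  show "((\<lambda>y. c y *\<^sub>C f y) \<longlongrightarrow> c x *\<^sub>C f x) (at x within S)" by simp
qed

lemma seminorm_continuousI:
  fixes p :: "'a::complex_lcs \<Rightarrow> real"
  assumes p: "seminorm p" and N: "open N" "0 \<in> N" and bd: "\<And>x. x \<in> N \<Longrightarrow> p x \<le> B"
  shows "cseminorm p"
  unfolding cseminorm_def
proof (intro conjI p)
  have small: "\<forall>\<^sub>F z in nhds x. p (z - x) < e" if "e > 0" for x e
  proof -
    define r where "r = (\<bar>B\<bar> + 1) / e"
    have r: "r > 0" using that by (simp add: r_def)
    have "continuous_on UNIV (\<lambda>z. complex_of_real r *\<^sub>C (z - x))"
      by (intro continuous_intros)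
    then have "open ((\<lambda>z. complex_of_real r *\<^sub>C (z - x)) -` N)"
      using N(1) by (simp add: open_vimage)
    moreover have "x \<in> (\<lambda>z. complex_of_real r *\<^sub>C (z - x)) -` N" using N(2) by simp
    ultimately have "\<forall>\<^sub>F z in nhds x. complex_of_real r *\<^sub>C (z - x) \<in> N"
      by (auto simp: eventually_nhds)
    then show ?thesis
    proof eventually_elim
      case (elim z)
      have "r * p (z - x) \<le> B"
        using bd[OF elim] seminorm_scaleC[OF p] r by simp
      then have "r * p (z - x) < \<bar>B\<bar> + 1" by linarith
      then have "(\<bar>B\<bar> + 1) * p (z - x) < (\<bar>B\<bar> + 1) * e"
        using that by (simp add: r_def pos_divide_less_eq mult.commute)
      then show ?case by (simp add: mult_less_cancel_left_pos)
    qed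
  qed
  have "(p \<longlongrightarrow> p x) (nhds x)" for x
    unfolding tendsto_iff
  proof (intro allI impI)
    fix e :: real assume "e > 0"
    from small[OF this, of x] show "\<forall>\<^sub>F z in nhds x. dist (p z) (p x) < e"
    proof eventually_elim
      case (elim z)
      then show ?case using seminorm_diff_abs[OF p, of z x] by (simp add: dist_real_def)
    qed
  qed
  then show "continuous_on UNIV p"
    unfolding continuous_on_def at_within_def by (intro ballI, rule tendsto_mono[OF inf_le1])
qed

lemma open_cseminorm_ball:
  fixes p :: "'a::complex_lcs \<Rightarrow> real"
  assumes "cseminorm p"
  shows "open {x. p (x - y) < e}"
proof -
  have "continuous_on UNIV (\<lambda>x. p (x - y))"
    using assms unfolding cseminorm_def
    by (intro continuous_on_compose2[of UNIV p UNIV "\<lambda>x. x - y"]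
        continuous_on_diff continuous_on_id continuous_on_const) auto
  then show ?thesis by (intro open_Collect_less continuous_intros) auto
qed

text \<open>
  The seminorm is the Minkowski functional of \<open>W\<close>, the largest balanced subset of a convex
  neighbourhood. Joint continuity of scalar multiplication makes \<open>W\<close> a neighbourhood of 0 again.
\<close>

lemma exists_cseminorm:
  fixes U :: "'a::complex_lcs set"
  assumes "open U" "0 \<in> U"
  obtains p where "cseminorm p" "{x. p x < 1} \<subseteq> U"
proof -
  obtain V where V: "open V" "0 \<in> V" "V \<subseteq> U" "convex V"
    using locally_convex_nhd[OF assms] by blast
  define W where "W = {x. \<forall>c. cmod c \<le> 1 \<longrightarrow> c *\<^sub>C x \<in> V}"
  have "\<forall>\<^sub>F q in nhds 0 \<times>\<^sub>F nhds 0. fst q *\<^sub>C snd q \<in> V"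
    using tendsto_scaleC_Pair[of 0 "0::'a"] V by (simp add: tendsto_def)
  then obtain P Q where PQ: "\<forall>\<^sub>F c in nhds 0. P c" "\<forall>\<^sub>F x in nhds 0. Q x"
    "\<And>c x. P c \<Longrightarrow> Q x \<Longrightarrow> c *\<^sub>C x \<in> V"
    unfolding eventually_prod_filter by auto
  obtain d where d: "d > 0" "\<And>c. cmod c < d \<Longrightarrow> P c"
    using PQ(1) unfolding eventually_nhds_metric by auto
  obtain N where N: "open N" "0 \<in> N" "\<And>x. x \<in> N \<Longrightarrow> Q x"
    using PQ(2) unfolding eventually_nhds by auto
  define r where "r = d / 2"
  have r: "r > 0" using d by (simp add: r_def)
  have N_W: "r *\<^sub>R x \<in> W" if "x \<in> N" for x
  proof -
    have "c *\<^sub>C r *\<^sub>R x \<in> V" if c: "cmod c \<le> 1" for c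
    proof -
      have "cmod (c * of_real r) \<le> 1 * r" using c r by (auto simp: norm_mult intro!: mult_right_mono)
      also have "\<dots> < d" using d by (simp add: r_def)
      finally have "(c * of_real r) *\<^sub>C x \<in> V" using PQ(3) d N \<open>x \<in> N\<close> by blast
      then show ?thesis by (simp add: scaleR_scaleC scaleC_scaleC)
    qed
    then show ?thesis by (simp add: W_def)
  qed
  have W_bal: "c *\<^sub>C x \<in> W" if "x \<in> W" "cmod c \<le> 1" for c x
    using that mult_mono[of "cmod _" 1 "cmod c" 1] by (auto simp: W_def scaleC_scaleC norm_mult)
  have W_conv: "u *\<^sub>R x + v *\<^sub>R y \<in> W" if "x \<in> W" "y \<in> W" "u \<ge> 0" "v \<ge> 0" "u + v = 1" for u v x y
  proof -
    have "c *\<^sub>C (u *\<^sub>R x + v *\<^sub>R y) = u *\<^sub>R (c *\<^sub>C x) + v *\<^sub>R (c *\<^sub>C y)" for c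
      by (simp add: scaleC_add_right scaleR_scaleC scaleC_scaleC mult.commute)
    then show ?thesis using that V(4) by (auto simp: W_def convex_def)
  qed
  have W_V: "W \<subseteq> V" by (auto simp: W_def dest!: spec[of _ 1] simp: scaleC_one)
  define R where "R x = {t. t > 0 \<and> (1 / t) *\<^sub>R x \<in> W}" for x
  define p where "p x = Inf (R x)" for x
  have R_ne: "R x \<noteq> {}" for x
  proof -
    have "continuous_on UNIV (\<lambda>c. complex_of_real c *\<^sub>C x)" by (intro continuous_intros)
    then have "open ((\<lambda>c. complex_of_real c *\<^sub>C x) -` N)" using N(1) by (simp add: open_vimage)
    moreover have "0 \<in> (\<lambda>c. complex_of_real c *\<^sub>C x) -` N" using N(2) by simp
    ultimately obtain e where e: "e > 0" "\<forall>c. dist c 0 < e \<longrightarrow> c \<in> (\<lambda>c. complex_of_real c *\<^sub>C x) -` N"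
      unfolding open_dist by blast
    then have "(e / 2) *\<^sub>R x \<in> N" using e(2)[rule_format, of "e / 2"] by (simp add: scaleR_scaleC)
    then have "r *\<^sub>R (e / 2) *\<^sub>R x \<in> W" by (rule N_W)
    then have "2 / (r * e) \<in> R x" using r e by (simp add: R_def)
    then show ?thesis by blast
  qed
  have bdd: "bdd_below (R x)" for x by (intro bdd_belowI[of _ 0]) (auto simp: R_def)
  have p_le: "p x \<le> t" if "t \<in> R x" for x t unfolding p_def using that bdd by (intro cInf_lower)
  have p_ge: "c \<le> p x" if "\<And>t. t \<in> R x \<Longrightarrow> c \<le> t" for c x
    unfolding p_def using that R_ne by (intro cInf_greatest)
  have p_nonneg: "0 \<le> p x" for x by (rule p_ge) (auto simp: R_def)
  have add: "p (x + y) \<le> p x + p y" for x y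
  proof -
    have "p (x + y) - t \<le> s" if st: "s \<in> R x" "t \<in> R y" for s t
    proof -
      have pos: "s > 0" "t > 0" using st by (auto simp: R_def)
      have "(s / (s + t)) *\<^sub>R ((1 / s) *\<^sub>R x) + (t / (s + t)) *\<^sub>R ((1 / t) *\<^sub>R y) \<in> W"
        using st pos by (intro W_conv) (auto simp: R_def add_divide_distrib[symmetric])
      also have "(s / (s + t)) *\<^sub>R ((1 / s) *\<^sub>R x) + (t / (s + t)) *\<^sub>R ((1 / t) *\<^sub>R y)
          = (1 / (s + t)) *\<^sub>R (x + y)"
        using pos by (simp add: scaleR_add_right)
      finally have "s + t \<in> R (x + y)" using pos by (simp add: R_def)
      then show ?thesis using p_le by fastforce
    qed
    then have "p (x + y) - t \<le> p x" if "t \<in> R y" for t using that by (intro p_ge) auto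
    then have "p (x + y) - p x \<le> p y" by (intro p_ge) (smt (verit))
    then show ?thesis by simp
  qed
  have le: "p (c *\<^sub>C x) \<le> cmod c * p x" if "c \<noteq> 0" for c x
  proof -
    have "p (c *\<^sub>C x) / cmod c \<le> p x"
    proof (rule p_ge)
      fix t assume t: "t \<in> R x"
      have "sgn c *\<^sub>C ((1 / t) *\<^sub>R x) \<in> W"
        using t that by (intro W_bal) (auto simp: R_def norm_sgn)
      also have "sgn c *\<^sub>C ((1 / t) *\<^sub>R x) = (1 / (cmod c * t)) *\<^sub>R (c *\<^sub>C x)"
        using that by (simp add: scaleR_scaleC scaleC_scaleC sgn_eq)
      finally have "cmod c * t \<in> R (c *\<^sub>C x)" using t that by (simp add: R_def)
      then have "p (c *\<^sub>C x) \<le> cmod c * t" by (rule p_le)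
      then show "p (c *\<^sub>C x) / cmod c \<le> t" using that by (simp add: field_simps)
    qed
    then show ?thesis using that by (simp add: field_simps)
  qed
  have hom: "p (c *\<^sub>C x) = cmod c * p x" for c x
  proof (cases "c = 0")
    case True
    have "p 0 \<le> t" if "t > 0" for t
      using that N_W[OF N(2)] by (intro p_le) (simp add: R_def)
    then have "p 0 \<le> 0" by (meson dense not_less)
    then show ?thesis using True p_nonneg[of 0] by simp
  next
    case False
    have "p x = p (inverse c *\<^sub>C (c *\<^sub>C x))" using False by (simp add: scaleC_scaleC scaleC_one)
    also have "\<dots> \<le> cmod (inverse c) * p (c *\<^sub>C x)" using False by (intro le) auto
    finally have "cmod c * p x \<le> p (c *\<^sub>C x)" using False by (simp add: norm_inverse norm_divide field_simps)
    then show ?thesis using le[OF False, of x] by simp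
  qed
  have sn: "seminorm p" using add hom by (simp add: seminorm_def)
  have "p x \<le> 1 / r" if "x \<in> N" for x
    using N_W[OF that] r by (intro p_le) (simp add: R_def)
  then have "cseminorm p" by (intro seminorm_continuousI[OF sn N(1,2)])
  moreover have "x \<in> U" if "p x < 1" for x
  proof -
    have "Inf (R x) < 1" using that by (simp add: p_def)
    then obtain t where t: "t \<in> R x" "t < 1" using cInf_lessD[OF R_ne] by blast
    have "of_real t *\<^sub>C ((1 / t) *\<^sub>R x) \<in> W"
      using t by (intro W_bal) (auto simp: R_def)
    then have "x \<in> W" using t by (simp add: R_def scaleR_scaleC scaleC_scaleC scaleC_one)
    then show ?thesis using W_V V(3) by blast
  qed
  ultimately show thesis using that by blast
qed

lemma cseminorm_compose:
  assumes p: "cseminorm p" and T: "T \<in> clin_ops"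
  shows "cseminorm (\<lambda>x. p (T x))"
proof -
  have T': "Vector_Spaces.linear scaleC scaleC T" "continuous_on UNIV T"
    using T by (auto simp: clin_ops_def)
  interpret T: Vector_Spaces.linear scaleC scaleC T by fact
  show ?thesis
    using p continuous_on_compose2[of UNIV p UNIV T] T'(2)
    by (simp add: cseminorm_def seminorm_def T.add T.scale)
qed

lemma cseminorm_tendstoI:
  fixes l :: "'a::complex_lcs"
  assumes "\<And>p e. cseminorm p \<Longrightarrow> e > 0 \<Longrightarrow> \<forall>\<^sub>F x in F. p (f x - l) < e"
  shows "(f \<longlongrightarrow> l) F"
proof (rule topological_tendstoI)
  fix S assume S: "open S" "l \<in> S"
  have "continuous_on UNIV (\<lambda>x. x + l)" by (intro continuous_intros)
  then have "open ((\<lambda>x. x + l) -` S)" using S(1) by (simp add: open_vimage)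
  then obtain p where p: "cseminorm p" "{x. p x < 1} \<subseteq> (\<lambda>x. x + l) -` S"
    using exists_cseminorm[of "(\<lambda>x. x + l) -` S"] S(2) by auto
  from assms[OF p(1) zero_less_one] show "\<forall>\<^sub>F x in F. f x \<in> S"
  proof eventually_elim
    case (elim x)
    then have "f x - l \<in> (\<lambda>x. x + l) -` S" using p(2) by blast
    then show ?case by simp
  qed
qed

lemma cseminorm_tendstoD:
  fixes l :: "'a::complex_lcs"
  assumes "(f \<longlongrightarrow> l) F" "cseminorm p" "e > 0"
  shows "\<forall>\<^sub>F x in F. p (f x - l) < e"
  using topological_tendstoD[OF assms(1) open_cseminorm_ball[OF assms(2)], of l e] assms
  by (simp add: seminorm_zero[OF cseminorm_seminorm])

lemma cseminorm_separates:
  fixes x y :: "'a::{complex_lcs, t2_space}"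
  assumes "\<And>p. cseminorm p \<Longrightarrow> p (x - y) = 0"
  shows "x = y"
proof (rule ccontr)
  assume "x \<noteq> y"
  have "((\<lambda>_::nat. x) \<longlongrightarrow> y) sequentially"
    by (rule cseminorm_tendstoI) (simp add: assms)
  then show False using \<open>x \<noteq> y\<close> by (simp add: tendsto_const_iff)
qed

lemma functional_eqI:
  fixes x y :: "'a::{complex_lcs, t2_space}"
  assumes "\<And>f p. cseminorm p \<Longrightarrow> functional_le f p \<Longrightarrow> f x = f y"
  shows "x = y"
proof (rule cseminorm_separates)
  fix p :: "'a \<Rightarrow> real" assume p: "cseminorm p"
  have "p (x - y) \<le> 0"
  proof (rule seminorm_le_functional[OF cseminorm_seminorm[OF p]])
    fix f assume f: "functional_le f p"
    show "cmod (f (x - y)) \<le> 0" using assms[OF p f] functional_diff[OF f, of x y] by simp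
  qed
  then show "p (x - y) = 0" using seminorm_nonneg[OF cseminorm_seminorm[OF p], of "x - y"] by simp
qed

lemma cseminorm_CauchyI:
  fixes X :: "nat \<Rightarrow> 'a::complex_lcs"
  assumes "\<And>p e. cseminorm p \<Longrightarrow> e > 0 \<Longrightarrow> \<exists>N. \<forall>m\<ge>N. \<forall>n\<ge>N. p (X m - X n) < e"
  shows "Cauchy X"
  unfolding Cauchy_uniform_iff
proof (intro allI impI)
  fix P :: "'a \<times> 'a \<Rightarrow> bool" assume "eventually P uniformity"
  then obtain Q where Q: "eventually Q uniformity" "\<And>a b c. Q (a, b) \<Longrightarrow> P (a + c, b + c)"
    using uniformity_of_uniform_continuous_invariant[OF uniformly_continuous_add'[where ?'a = 'a]]
    by metis
  have "\<forall>\<^sub>F x in nhds 0. Q (0, x)"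
    unfolding eventually_nhds_uniformity
    by (rule eventually_mono[OF Q(1)]) auto
  then obtain U where U: "open U" "0 \<in> U" "\<And>x. x \<in> U \<Longrightarrow> Q (0, x)"
    unfolding eventually_nhds by auto
  obtain p where p: "cseminorm p" "{x. p x < 1} \<subseteq> U"
    using exists_cseminorm[OF U(1,2)] by blast
  obtain N where N: "\<And>m n. m \<ge> N \<Longrightarrow> n \<ge> N \<Longrightarrow> p (X m - X n) < 1"
    using assms[OF p(1), of 1] by auto
  have "P (X n, X m)" if "n \<ge> N" "m \<ge> N" for m n
    using Q(2)[of 0 "X m - X n" "X n"] U(3)[of "X m - X n"] p(2) N[OF that(2,1)] by auto
  then show "\<exists>N. \<forall>n\<ge>N. \<forall>m\<ge>N. P (X n, X m)" by blast
qed

lemma functional_compose: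
  assumes "functional_le f p" "T \<in> clin_ops"
  shows "functional_le (\<lambda>x. f (T x)) (\<lambda>x. p (T x))"
proof -
  interpret T: Vector_Spaces.linear scaleC scaleC T using assms by (simp add: clin_ops_def)
  show ?thesis using assms(1) by (simp add: functional_le_def T.add T.scale)
qed

lemma equicontinuous_ops_cseminorm:
  fixes \<T> :: "('a::complex_lcs \<Rightarrow> 'a) set"
  assumes eq: "equicontinuous_ops \<T>" and p: "cseminorm p"
    and lin: "\<And>T c x. T \<in> \<T> \<Longrightarrow> T (c *\<^sub>C x) = c *\<^sub>C T x"
  shows "\<exists>q. cseminorm q \<and> (\<forall>T\<in>\<T>. \<forall>x. p (T x) \<le> q x)"
proof -
  have p': "seminorm p" using p by (rule cseminorm_seminorm)
  have "open {x. p (x - 0) < 1}" by (rule open_cseminorm_ball[OF p])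
  moreover have "0 \<in> {x. p (x - 0) < 1}" by (simp add: seminorm_zero[OF p'])
  ultimately obtain V where V: "open V" "0 \<in> V" "\<forall>T\<in>\<T>. T ` V \<subseteq> {x. p (x - 0) < 1}"
    using eq unfolding equicontinuous_ops_def by blast
  then obtain q where q: "cseminorm q" "{x. q x < 1} \<subseteq> V"
    using exists_cseminorm by blast
  have q': "seminorm q" using q(1) by (rule cseminorm_seminorm)
  have "p (T x) \<le> q x" if "T \<in> \<T>" for T x
  proof (rule field_le_epsilon)
    fix e :: real assume e: "e > 0"
    define r where "r = q x + e"
    have r: "r > 0" using seminorm_nonneg[OF q', of x] e by (simp add: r_def)
    have "q (of_real (1 / r) *\<^sub>C x) = q x / r"
      using seminorm_scaleC[OF q', of "of_real (1 / r)" x] r by (simp add: norm_divide)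
    also have "\<dots> < 1" using r e by (simp add: r_def)
    finally have "of_real (1 / r) *\<^sub>C x \<in> V" using q by blast
    then have "p (T (of_real (1 / r) *\<^sub>C x)) < 1" using V(3) that by auto
    then have "p (T x) / r < 1"
      using seminorm_scaleC[OF p', of "of_real (1 / r)" "T x"] r lin[OF that, of "of_real (1 / r)" x]
      by (simp add: norm_divide)
    then show "p (T x) \<le> q x + e" using r by (simp add: r_def)
  qed
  then show ?thesis using q(1) by blast
qed

section \<open>Weak computation of Riemann and line integrals\<close>

definition riemann_sum :: "(real \<Rightarrow> 'a::real_vector) \<Rightarrow> (real \<times> real set) set \<Rightarrow> 'a" where
  "riemann_sum u P = (\<Sum>(x, k)\<in>P. measure lborel k *\<^sub>R u x)"

text \<open>
  The integrands along the contour are discontinuous where the contour has a corner; \<open>K\<close> holds these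
  parameters. Continuity is required only between points that no element of \<open>K\<close> separates, and at
  the points of \<open>K\<close> themselves the values are merely bounded.
\<close>

definition piecewise_ucont :: "real set \<Rightarrow> (real \<Rightarrow> 'a::complex_lcs) \<Rightarrow> bool" where
  "piecewise_ucont K u \<longleftrightarrow> (\<forall>p r s. cseminorm p \<longrightarrow>
     (\<exists>B. \<forall>x\<in>{r..s}. p (u x) \<le> B) \<and>
     (\<forall>e>0. \<exists>d>0. \<forall>x\<in>{r..s}. \<forall>y\<in>{r..s}.
        \<bar>x - y\<bar> < d \<longrightarrow> closed_segment x y \<inter> K = {} \<longrightarrow> p (u x - u y) \<le> e))"

lemma piecewise_ucont_bound:
  assumes "piecewise_ucont K u" "cseminorm p"
  obtains B where "B \<ge> 0" "\<And>x. x \<in> {r..s} \<Longrightarrow> p (u x) \<le> B"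
proof -
  have "\<exists>B. \<forall>x\<in>{r..s}. p (u x) \<le> B" using assms unfolding piecewise_ucont_def by blast
  then obtain B where "\<And>x. x \<in> {r..s} \<Longrightarrow> p (u x) \<le> B" by blast
  then show thesis by (intro that[of "max B 0"]) (auto simp: le_max_iff_disj)
qed

lemma piecewise_ucont_osc:
  assumes "piecewise_ucont K u" "cseminorm p" "e > 0"
  obtains d where "d > 0" "\<And>x y. x \<in> {r..s} \<Longrightarrow> y \<in> {r..s} \<Longrightarrow> \<bar>x - y\<bar> < d \<Longrightarrow>
      closed_segment x y \<inter> K = {} \<Longrightarrow> p (u x - u y) \<le> e"
proof -
  have "\<exists>d>0. \<forall>x\<in>{r..s}. \<forall>y\<in>{r..s}.
        \<bar>x - y\<bar> < d \<longrightarrow> closed_segment x y \<inter> K = {} \<longrightarrow> p (u x - u y) \<le> e"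
    using assms unfolding piecewise_ucont_def by blast
  then show thesis using that by blast
qed

text \<open>
  On each tagged interval the error is at most the oscillation of \<open>u\<close> times the length. The oscillation
  is at most \<open>e\<close> unless an element of \<open>K\<close> lies between the tag and another point of the interval; the
  exceptional points lie within \<open>2 d\<close> of \<open>K\<close>, so each element of \<open>K\<close> costs at most \<open>2 B\<close> on a set of length
  \<open>4 d\<close>. The bound is the same for all \<open>f\<close> below \<open>p\<close>.
\<close>

lemma functional_riemann_sum_error:
  fixes u :: "real \<Rightarrow> 'a::complex_lcs"
  assumes f: "functional_le f p" and p: "seminorm p"
    and P: "P tagged_division_of {r..s}" "(\<lambda>x. ball x d) fine P" and d: "d > 0"
    and K: "finite K" and rs: "r \<le> s"
    and osc: "\<And>x y. x \<in> {r..s} \<Longrightarrow> y \<in> {r..s} \<Longrightarrow> \<bar>x - y\<bar> < d \<Longrightarrow>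
      closed_segment x y \<inter> K = {} \<Longrightarrow> p (u x - u y) \<le> e"
    and B: "B \<ge> 0" "\<And>x. x \<in> {r..s} \<Longrightarrow> p (u x) \<le> B"
    and e: "e \<ge> 0"
    and int: "(\<lambda>t. f (u t)) integrable_on {r..s}"
  shows "cmod (f (riemann_sum u P) - integral {r..s} (\<lambda>t. f (u t)))
    \<le> e * (s - r) + 8 * B * d * card K"
proof -
  define I where "I c = {c - 2 * d..c + 2 * d}" for c
  define M where "M y = e + 2 * B * (\<Sum>c\<in>K. if y \<in> I c then 1 else 0)" for y
  have int_ind: "(\<lambda>y. if y \<in> I c then 1 else 0 :: real) integrable_on {r..s}" for c
  proof -
    have "(\<lambda>y. 1::real) integrable_on (I c \<inter> {r..s})"
      unfolding I_def by (simp add: Int_atLeastAtMost integrable_const_ivl)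
    then show ?thesis by (simp add: integrable_restrict_Int)
  qed
  have M_int: "M integrable_on {r..s}"
    unfolding M_def
    by (intro integrable_add integrable_on_mult_right integrable_sum integrable_const_ivl int_ind K)
  have ind_le: "integral {r..s} (\<lambda>y. if y \<in> I c then 1 else 0 :: real) \<le> 4 * d" for c
  proof -
    have "integral {r..s} (\<lambda>y. if y \<in> I c then 1 else 0 :: real) = integral (I c \<inter> {r..s}) (\<lambda>y. 1)"
      by (rule integral_restrict_Int)
    also have "\<dots> \<le> 4 * d"
      using d by (auto simp: I_def Int_atLeastAtMost)
    finally show ?thesis .
  qed
  have "integral {r..s} M = e * (s - r) + 2 * B * (\<Sum>c\<in>K. integral {r..s} (\<lambda>y. if y \<in> I c then 1 else 0))"
    unfolding M_def using rs
    by (subst integral_add)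
      (auto simp: integral_sum K int_ind integral_mult_right
        intro!: integrable_on_mult_right integrable_sum integrable_const_ivl)
  also have "\<dots> \<le> e * (s - r) + 2 * B * (\<Sum>c\<in>K. 4 * d)"
    by (intro add_left_mono mult_left_mono sum_mono ind_le) (use B(1) in auto)
  finally have M_le: "integral {r..s} M \<le> e * (s - r) + 8 * B * d * card K"
    by (simp add: mult_ac)
  have fin: "finite P" using P(1) by (simp add: tagged_division_of_finite)
  have sub: "x \<in> k \<and> k \<subseteq> {r..s} \<and> (\<exists>a b. k = cbox a b)" if "(x, k) \<in> P" for x k
    using tagged_division_ofD(2,3,4)[OF P(1) that] by auto
  have int_k: "(\<lambda>t. f (u t)) integrable_on k" "M integrable_on k" if "(x, k) \<in> P" for x k
    using sub[OF that] integrable_on_subcbox[OF int] integrable_on_subcbox[OF M_int] by metis+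
  have key: "cmod (measure lborel k *\<^sub>R f (u x) - integral k (\<lambda>t. f (u t))) \<le> integral k M"
    if xk: "(x, k) \<in> P" for x k
  proof -
    obtain a b where k: "k = cbox a b" using sub[OF xk] by blast
    have "measure lborel k *\<^sub>R f (u x) - integral k (\<lambda>t. f (u t)) = integral k (\<lambda>t. f (u x) - f (u t))"
      using int_k(1)[OF xk] by (simp add: k integral_diff integrable_const_ivl)
    also have "cmod \<dots> \<le> integral k M"
    proof (rule Henstock_Kurzweil_Integration.integral_norm_bound_integral)
      show "(\<lambda>t. f (u x) - f (u t)) integrable_on k"
        using int_k(1)[OF xk] by (auto simp: k intro: integrable_diff)
      show "M integrable_on k" by (rule int_k(2)[OF xk])
      fix y assume y: "y \<in> k"
      have xy: "x \<in> {r..s}" "y \<in> {r..s}" "\<bar>x - y\<bar> < d"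
        using sub[OF xk] y P(2) xk by (auto simp: fine_def dist_real_def subset_iff)
      have "cmod (f (u x) - f (u y)) \<le> p (u x - u y)"
        using functional_bound[OF f, of "u x - u y"] functional_diff[OF f] by simp
      also have "\<dots> \<le> M y"
      proof (cases "closed_segment x y \<inter> K = {}")
        case True
        then show ?thesis using osc[OF xy] B(1) by (auto simp: M_def intro!: add_increasing2 mult_nonneg_nonneg sum_nonneg)
      next
        case False
        then obtain c where c: "c \<in> K" "c \<in> closed_segment x y" by blast
        then have "y \<in> I c" using xy by (auto simp: I_def closed_segment_eq_real_ivl split: if_splits)
        then have "1 \<le> (\<Sum>c\<in>K. if y \<in> I c then 1 else 0 :: real)"
          using member_le_sum[of c K "\<lambda>c. if y \<in> I c then 1 else 0 :: real"] c K by simp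
        then have "2 * B * 1 \<le> 2 * B * (\<Sum>c\<in>K. if y \<in> I c then 1 else 0)"
          using B(1) by (intro mult_left_mono) auto
        moreover have "p (u x - u y) \<le> 2 * B"
          using seminorm_diff[OF p, of "u x" "u y"] B(2)[OF xy(1)] B(2)[OF xy(2)] by simp
        ultimately show ?thesis using e by (simp add: M_def)
      qed
      finally show "cmod (f (u x) - f (u y)) \<le> M y" .
    qed
    finally show ?thesis .
  qed
  have "f (riemann_sum u P) - integral {r..s} (\<lambda>t. f (u t)) =
      (\<Sum>(x, k)\<in>P. measure lborel k *\<^sub>R f (u x) - integral k (\<lambda>t. f (u t)))"
    using integral_combine_tagged_division_topdown[of "\<lambda>t. f (u t)" r s P] int P(1)
    by (simp add: riemann_sum_def functional_sum[OF f] case_prod_unfold functional_scaleR[OF f]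
        sum_subtractf box_real)
  also have "cmod \<dots> \<le> (\<Sum>(x, k)\<in>P. integral k M)"
    using key by (intro sum_norm_le) auto
  also have "\<dots> = integral {r..s} M"
    using integral_combine_tagged_division_topdown[of M r s P] M_int P(1) by (simp add: box_real)
  finally show ?thesis using M_le by linarith
qed

lemma riemann_sum_error:
  fixes u :: "real \<Rightarrow> 'a::complex_lcs"
  assumes u: "piecewise_ucont K u" and K: "finite K" and p: "cseminorm p"
    and int: "\<And>f. functional_le f p \<Longrightarrow> (\<lambda>t. f (u t)) integrable_on {r..s}"
    and rs: "r \<le> s" and e: "e > 0"
  obtains d where "d > 0"
    "\<And>P f d'. d' \<le> d \<Longrightarrow> 0 < d' \<Longrightarrow> P tagged_division_of {r..s} \<Longrightarrow> (\<lambda>x. ball x d') fine P \<Longrightarrow>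
      functional_le f p \<Longrightarrow>
      cmod (f (riemann_sum u P) - integral {r..s} (\<lambda>t. f (u t))) \<le> e"
proof -
  define e' where "e' = e / (2 * (s - r + 1))"
  have e': "e' > 0" "e' * (s - r) \<le> e / 2"
    using e rs by (auto simp: e'_def field_simps)
  obtain B where B: "B \<ge> 0" "\<And>x. x \<in> {r..s} \<Longrightarrow> p (u x) \<le> B"
    using piecewise_ucont_bound[OF u p] by blast
  obtain d0 where d0: "d0 > 0" "\<And>x y. x \<in> {r..s} \<Longrightarrow> y \<in> {r..s} \<Longrightarrow> \<bar>x - y\<bar> < d0 \<Longrightarrow>
      closed_segment x y \<inter> K = {} \<Longrightarrow> p (u x - u y) \<le> e'"
    using piecewise_ucont_osc[OF u p e'(1)] by blast
  define D where "D = 16 * B * card K + 1"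
  have D: "D > 0" using B by (simp add: D_def add_nonneg_pos)
  define d where "d = min d0 (e / D)"
  show thesis
  proof (rule that[of d])
    show "d > 0" using d0 e D by (simp add: d_def)
    fix P f d' assume d': "d' \<le> d" "0 < d'" and P: "P tagged_division_of {r..s}" "(\<lambda>x. ball x d') fine P"
      and f: "functional_le f p"
    have "cmod (f (riemann_sum u P) - integral {r..s} (\<lambda>t. f (u t))) \<le> e' * (s - r) + 8 * B * d' * card K"
      using d' d0 e'
      by (intro functional_riemann_sum_error[OF f cseminorm_seminorm[OF p] P _ K rs _ B _ int[OF f]])
        (auto simp: d_def)
    moreover have "8 * B * d' * card K \<le> e / 2"
    proof -
      have "16 * B * card K * d' \<le> D * d'" using d' by (intro mult_right_mono) (auto simp: D_def)
      also have "\<dots> \<le> D * (e / D)" using d' D by (intro mult_left_mono) (auto simp: d_def)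
      also have "\<dots> = e" using D by simp
      finally show ?thesis by (simp add: algebra_simps)
    qed
    ultimately show "cmod (f (riemann_sum u P) - integral {r..s} (\<lambda>t. f (u t))) \<le> e"
      using e'(2) by linarith
  qed
qed

lemma fine_tagged_division_exists:
  fixes r s d :: real
  assumes "d > 0"
  obtains P where "P tagged_division_of {r..s}" "(\<lambda>x. ball x d) fine P"
  using fine_division_exists_real[of "\<lambda>x. ball x d" r s] gauge_ball[OF assms] by blast

text \<open>
  Riemann sums are compared with the scalar integrals of \<open>f \<circ> u\<close> and not with each other, so no common
  refinement of partitions is needed.
\<close>

lemma exists_riemann_integral:
  fixes u :: "real \<Rightarrow> 'a::{complex_lcs, seq_complete_space}"
  assumes u: "piecewise_ucont K u" and K: "finite K"
    and int: "\<And>f p. cseminorm p \<Longrightarrow> functional_le f p \<Longrightarrow> (\<lambda>t. f (u t)) integrable_on {r..s}"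
    and rs: "r \<le> s"
  shows "\<exists>J. has_riemann_integral u J r s \<and>
    (\<forall>f p. cseminorm p \<longrightarrow> functional_le f p \<longrightarrow> f J = integral {r..s} (\<lambda>t. f (u t)))"
proof -
  have "\<exists>P. P tagged_division_of {r..s} \<and> (\<lambda>x. ball x (1 / Suc n)) fine P" for n
    by (rule fine_tagged_division_exists[of "1 / Suc n" r s]) auto
  then obtain P where P: "\<And>n. P n tagged_division_of {r..s}" "\<And>n. (\<lambda>x. ball x (1 / Suc n)) fine P n"
    by metis
  define X where "X n = riemann_sum u (P n)" for n
  have close: "\<exists>N d. d > 0 \<and> (\<forall>n\<ge>N. \<forall>f. functional_le f p \<longrightarrow>
      cmod (f (X n) - integral {r..s} (\<lambda>t. f (u t))) \<le> e) \<and>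
      (\<forall>Q f. Q tagged_division_of {r..s} \<longrightarrow> (\<lambda>x. ball x d) fine Q \<longrightarrow> functional_le f p \<longrightarrow>
        cmod (f (riemann_sum u Q) - integral {r..s} (\<lambda>t. f (u t))) \<le> e)"
    if p: "cseminorm p" and e: "e > 0" for p e
  proof -
    obtain d where d: "d > 0" "\<And>P f d'. d' \<le> d \<Longrightarrow> 0 < d' \<Longrightarrow> P tagged_division_of {r..s} \<Longrightarrow>
        (\<lambda>x. ball x d') fine P \<Longrightarrow> functional_le f p \<Longrightarrow>
        cmod (f (riemann_sum u P) - integral {r..s} (\<lambda>t. f (u t))) \<le> e"
      using riemann_sum_error[OF u K p int[OF p] rs e] by blast
    obtain N where N: "1 / Suc N < d" using d(1) nat_approx_posE by metis
    have "1 / Suc n \<le> d" if "n \<ge> N" for n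
    proof -
      have "1 / Suc n \<le> 1 / Suc N" using that by (intro divide_left_mono) auto
      then show ?thesis using N by simp
    qed
    then have "\<forall>n\<ge>N. \<forall>f. functional_le f p \<longrightarrow> cmod (f (X n) - integral {r..s} (\<lambda>t. f (u t))) \<le> e"
      unfolding X_def using d(2)[OF _ _ P] by simp
    then show ?thesis using d by blast
  qed
  have "Cauchy X"
  proof (rule cseminorm_CauchyI)
    fix p :: "'a \<Rightarrow> real" and e :: real assume p: "cseminorm p" and e: "e > 0"
    have "e / 3 > 0" using e by simp
    from close[OF p this] obtain N where
      N: "\<And>n f. n \<ge> N \<Longrightarrow> functional_le f p \<Longrightarrow> cmod (f (X n) - integral {r..s} (\<lambda>t. f (u t))) \<le> e / 3"
      by blast
    have "p (X m - X n) < e" if "m \<ge> N" "n \<ge> N" for m n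
    proof -
      have "p (X m - X n) \<le> e / 3 + e / 3"
      proof (rule seminorm_le_functional[OF cseminorm_seminorm[OF p]])
        fix f assume f: "functional_le f p"
        show "cmod (f (X m - X n)) \<le> e / 3 + e / 3"
          unfolding functional_diff[OF f]
          by (rule norm_diff_triangle_le[OF N[OF that(1) f]])
            (use N[OF that(2) f] in \<open>simp add: norm_minus_commute\<close>)
      qed
      then show ?thesis using e by simp
    qed
    then show "\<exists>N. \<forall>m\<ge>N. \<forall>n\<ge>N. p (X m - X n) < e" by blast
  qed
  then obtain J where J: "X \<longlonglongrightarrow> J" using seq_complete by (auto simp: convergent_def)
  have J_close: "cmod (f J - integral {r..s} (\<lambda>t. f (u t))) \<le> e"
    if p: "cseminorm p" and f: "functional_le f p" and e: "e > 0" for f p e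
  proof -
    have e2: "e / 2 > 0" using e by simp
    from close[OF p e2] obtain N where
      N: "\<And>n. n \<ge> N \<Longrightarrow> cmod (f (X n) - integral {r..s} (\<lambda>t. f (u t))) \<le> e / 2" using f by blast
    obtain n where n: "n \<ge> N" "p (X n - J) < e / 2"
      using eventually_conj[OF eventually_ge_at_top[of N] cseminorm_tendstoD[OF J p e2]]
      by (auto dest: eventually_happens)
    have "cmod (f J - f (X n)) \<le> e / 2"
      using functional_bound[OF f, of "X n - J"] n(2) functional_diff[OF f]
      by (simp add: norm_minus_commute)
    from norm_diff_triangle_le[OF this N[OF n(1)]] show ?thesis by simp
  qed
  have fJ: "f J = integral {r..s} (\<lambda>t. f (u t))" if "cseminorm p" "functional_le f p" for f p
  proof -
    have "cmod (f J - integral {r..s} (\<lambda>t. f (u t))) \<le> 0"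
      by (rule field_le_epsilon) (use J_close[OF that] in simp)
    then show ?thesis by simp
  qed
  have "has_riemann_integral u J r s"
    unfolding has_riemann_integral_def
  proof (intro allI impI)
    fix U :: "'a set" assume U: "open U \<and> J \<in> U"
    have "continuous_on UNIV (\<lambda>x. x + J)" by (intro continuous_intros)
    then have "open ((\<lambda>x. x + J) -` U)" using U by (simp add: open_vimage)
    then obtain p where p: "cseminorm p" "{x. p x < 1} \<subseteq> (\<lambda>x. x + J) -` U"
      using exists_cseminorm[of "(\<lambda>x. x + J) -` U"] U by auto
    have "(1/2::real) > 0" by simp
    from close[OF p(1) this] obtain d where d: "d > 0"
      "\<And>Q f. Q tagged_division_of {r..s} \<Longrightarrow> (\<lambda>x. ball x d) fine Q \<Longrightarrow> functional_le f p \<Longrightarrow>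
        cmod (f (riemann_sum u Q) - integral {r..s} (\<lambda>t. f (u t))) \<le> 1 / 2"
      by blast
    have "riemann_sum u Q \<in> U" if Q: "Q tagged_division_of {r..s}" "(\<lambda>x. ball x d) fine Q" for Q
    proof -
      have "p (riemann_sum u Q - J) \<le> 1 / 2"
      proof (rule seminorm_le_functional[OF cseminorm_seminorm[OF p(1)]])
        fix f assume f: "functional_le f p"
        show "cmod (f (riemann_sum u Q - J)) \<le> 1 / 2"
          using d(2)[OF Q f] fJ[OF p(1) f] functional_diff[OF f] by simp
      qed
      then have "riemann_sum u Q - J \<in> {x. p x < 1}" by simp
      then have "riemann_sum u Q - J \<in> (\<lambda>x. x + J) -` U" using p(2) by blast
      then show ?thesis by simp
    qed
    then show "\<exists>\<delta>>0. \<forall>p. p tagged_division_of {r..s} \<and> (\<lambda>x. ball x \<delta>) fine p \<longrightarrow>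
        (\<Sum>(x, k)\<in>p. measure lborel k *\<^sub>R u x) \<in> U"
      using d(1) unfolding riemann_sum_def by blast
  qed
  then show ?thesis using fJ by blast
qed

lemma has_riemann_integral_unique:
  fixes u :: "real \<Rightarrow> 'a::{complex_lcs, t2_space}"
  assumes "has_riemann_integral u I r s" "has_riemann_integral u J r s"
  shows "I = J"
proof (rule ccontr)
  assume "I \<noteq> J"
  from hausdorff[OF this] obtain U V where UV: "open U" "open V" "I \<in> U" "J \<in> V" "U \<inter> V = {}"
    by auto
  obtain d where d: "d > 0" "\<And>P. P tagged_division_of {r..s} \<Longrightarrow> (\<lambda>x. ball x d) fine P \<Longrightarrow>
      (\<Sum>(x, k)\<in>P. measure lborel k *\<^sub>R u x) \<in> U"
    using assms(1)[unfolded has_riemann_integral_def, rule_format, OF conjI[OF UV(1,3)]] by auto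
  obtain d' where d': "d' > 0" "\<And>P. P tagged_division_of {r..s} \<Longrightarrow> (\<lambda>x. ball x d') fine P \<Longrightarrow>
      (\<Sum>(x, k)\<in>P. measure lborel k *\<^sub>R u x) \<in> V"
    using assms(2)[unfolded has_riemann_integral_def, rule_format, OF conjI[OF UV(2,4)]] by auto
  obtain P where P: "P tagged_division_of {r..s}" "(\<lambda>x. ball x (min d d')) fine P"
    using fine_tagged_division_exists[of "min d d'" r s] d(1) d'(1) by auto
  have "k \<subseteq> ball x d \<and> k \<subseteq> ball x d'" if "(x, k) \<in> P" for x k
  proof -
    have "k \<subseteq> ball x (min d d')" by (rule fineD[OF P(2) that])
    then show ?thesis
      using subset_ball[of "min d d'" d x] subset_ball[of "min d d'" d' x] by auto
  qed
  then have "(\<lambda>x. ball x d) fine P" "(\<lambda>x. ball x d') fine P"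
    by (auto intro!: fineI)
  then show False using d(2)[OF P(1)] d'(2)[OF P(1)] UV(5) by blast
qed

lemma has_line_integral_unique:
  fixes f :: "complex \<Rightarrow> 'a::{complex_lcs, t2_space}"
  assumes "has_line_integral \<gamma> f I" "has_line_integral \<gamma> f J"
  shows "I = J"
proof -
  let ?u = "\<lambda>t. vector_derivative \<gamma> (at t) *\<^sub>C f (\<gamma> t)"
  obtain R where R: "\<And>r s. r \<le> s \<Longrightarrow> has_riemann_integral ?u (R r s) r s"
      "((\<lambda>(r, s). R r s) \<longlongrightarrow> I) (at_bot \<times>\<^sub>F at_top)"
    using assms(1) unfolding has_line_integral_def by blast
  obtain S where S: "\<And>r s. r \<le> s \<Longrightarrow> has_riemann_integral ?u (S r s) r s"
      "((\<lambda>(r, s). S r s) \<longlongrightarrow> J) (at_bot \<times>\<^sub>F at_top)"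
    using assms(2) unfolding has_line_integral_def by blast
  have "\<forall>\<^sub>F x in at_bot \<times>\<^sub>F at_top. fst x \<le> (0::real) \<and> snd x \<ge> (0::real)"
    by (intro eventually_prodI eventually_le_at_bot eventually_ge_at_top)
  then have "\<forall>\<^sub>F x in at_bot \<times>\<^sub>F at_top. (\<lambda>(r, s). R r s) x = (\<lambda>(r, s). S r s) x"
    by eventually_elim (auto intro!: has_riemann_integral_unique[OF R(1) S(1)])
  then have "((\<lambda>(r, s). S r s) \<longlongrightarrow> I) (at_bot \<times>\<^sub>F at_top)"
    using R(2) tendsto_cong by blast
  moreover have "(at_bot \<times>\<^sub>F at_top :: (real \<times> real) filter) \<noteq> bot"
    by (simp add: prod_filter_eq_bot)
  ultimately show ?thesis using S(2) tendsto_unique by blast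
qed

section \<open>Absolutely convergent integrals over the real line\<close>

lemma integrable_inverse_1_plus_square_real: "integrable lborel (\<lambda>t::real. 1 / (1 + t\<^sup>2))"
  and integral_inverse_1_plus_square_real: "(LBINT t. 1 / (1 + t\<^sup>2)) = pi"
  using integrable_inverse_1_plus_square LBINT_inverse_1_plus_square
  by (simp_all add: set_integrable_def interval_lebesgue_integral_def set_lebesgue_integral_def
      einterval_eq inverse_eq_divide)

lemma integrable_decay:
  fixes g :: "real \<Rightarrow> complex"
  assumes "g \<in> borel_measurable borel" "\<And>t. cmod (g t) \<le> K / (1 + t\<^sup>2)"
  shows "integrable lborel g"
proof (rule Bochner_Integration.integrable_bound)
  show "integrable lborel (\<lambda>t::real. K * (1 / (1 + t\<^sup>2)))"
    by (intro integrable_mult_right integrable_inverse_1_plus_square_real)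
  have "cmod (g t) \<le> \<bar>K * (1 / (1 + t\<^sup>2))\<bar>" for t
    using order_trans[OF assms(2)[of t] abs_ge_self] by simp
  then show "AE t in lborel. norm (g t) \<le> norm (K * (1 / (1 + t\<^sup>2)))" by simp
qed (use assms(1) in simp)

lemma integral_decay_bound:
  fixes g :: "real \<Rightarrow> complex"
  assumes "g \<in> borel_measurable borel" "\<And>t. cmod (g t) \<le> K / (1 + t\<^sup>2)"
  shows "cmod (LBINT t. g t) \<le> K * pi"
proof -
  have "cmod (LBINT t. g t) \<le> (LBINT t. K * (1 / (1 + t\<^sup>2)))"
    using integrable_decay[OF assms] assms(2)
    by (intro Bochner_Integration.integral_norm_bound_integral integrable_mult_right integrable_inverse_1_plus_square_real) auto
  then show ?thesis by (simp only: integral_mult_right_zero integral_inverse_1_plus_square_real)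
qed

lemma integral_decay_tail:
  fixes g :: "real \<Rightarrow> complex"
  assumes "g \<in> borel_measurable borel" "\<And>t. cmod (g t) \<le> K / (1 + t\<^sup>2)" "r \<le> s"
  shows "cmod (integral {r..s} g - (LBINT t. g t)) \<le> K * (pi - (arctan s - arctan r))"
proof -
  have g: "integrable lborel g" by (rule integrable_decay[OF assms(1,2)])
  have int: "integrable lborel (\<lambda>t. indicator {r..s} t *\<^sub>R g t)"
    by (rule integrable_mult_indicator[OF _ g]) auto
  have w: "integrable lborel (\<lambda>t::real. 1 / (1 + t\<^sup>2))" by (rule integrable_inverse_1_plus_square_real)
  have w': "integrable lborel (\<lambda>t::real. indicator {r..s} t *\<^sub>R (1 / (1 + t\<^sup>2)))"
    by (rule integrable_mult_indicator[OF _ w]) auto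
  have "integral {r..s} g = (LBINT t. indicator {r..s} t *\<^sub>R g t)"
    using set_borel_integral_eq_integral(2)[of "{r..s}" g] int
    by (simp add: set_integrable_def set_lebesgue_integral_def)
  then have "integral {r..s} g - (LBINT t. g t) = (LBINT t. indicator {r..s} t *\<^sub>R g t - g t)"
    using int g by simp
  also have "cmod \<dots> \<le> (LBINT t. K * (1 / (1 + t\<^sup>2) - indicator {r..s} t *\<^sub>R (1 / (1 + t\<^sup>2))))"
  proof (rule Bochner_Integration.integral_norm_bound_integral)
    fix t :: real
    show "cmod (indicator {r..s} t *\<^sub>R g t - g t)
        \<le> K * (1 / (1 + t\<^sup>2) - indicator {r..s} t *\<^sub>R (1 / (1 + t\<^sup>2)))"
      using assms(2)[of t] by (auto simp: indicator_def)
  qed (use int g w w' in auto)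
  also have "\<dots> = K * (pi - (LBINT t. indicator {r..s} t *\<^sub>R (1 / (1 + t\<^sup>2))))"
    using w w' integral_inverse_1_plus_square_real by simp
  also have "(LBINT t. indicator {r..s} t *\<^sub>R (1 / (1 + t\<^sup>2))) = integral {r..s} (\<lambda>t::real. 1 / (1 + t\<^sup>2))"
    using set_borel_integral_eq_integral(2)[of "{r..s}" "\<lambda>t::real. 1 / (1 + t\<^sup>2)"] w'
    by (simp add: set_integrable_def set_lebesgue_integral_def)
  also have "\<dots> = arctan s - arctan r"
    using assms(3)
    by (intro integral_unique fundamental_theorem_of_calculus)
      (auto intro!: derivative_eq_intros simp: has_real_derivative_iff_has_vector_derivative[symmetric]
        inverse_eq_divide)
  finally show ?thesis .
qed

lemma arctan_tail_tendsto_0: "(\<lambda>n. K * (pi - (arctan (real n) - arctan (- real n)))) \<longlonglongrightarrow> 0"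
proof -
  have "(\<lambda>n. K * (pi - (arctan (real n) - arctan (- real n)))) \<longlonglongrightarrow> K * (pi - (pi / 2 - - (pi / 2)))"
    by (intro tendsto_intros filterlim_compose[OF tendsto_arctan_at_top filterlim_real_sequentially]
        filterlim_compose[OF tendsto_arctan_at_bot] filterlim_compose[OF filterlim_uminus_at_bot_at_top
        filterlim_real_sequentially])
  then show ?thesis by simp
qed

text \<open>
  The integrals over \<open>[-n, n]\<close> form a Cauchy sequence, because their distance is bounded by a tail of the
  integral of \<open>1 / (1 + t\<^sup>2)\<close>, uniformly in the functionals below a given seminorm.
\<close>

theorem line_integral_weak:
  fixes F :: "complex \<Rightarrow> 'a::{complex_lcs, seq_complete_space, t2_space}"
  assumes u_def: "u = (\<lambda>t. vector_derivative \<gamma> (at t) *\<^sub>C F (\<gamma> t))"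
    and u: "piecewise_ucont K u" "finite K"
    and meas: "\<And>f p. cseminorm p \<Longrightarrow> functional_le f p \<Longrightarrow> (\<lambda>t. f (u t)) \<in> borel_measurable borel"
    and decay: "\<And>p. cseminorm p \<Longrightarrow> \<exists>K. \<forall>t. p (u t) \<le> K / (1 + t\<^sup>2)"
  shows "has_line_integral \<gamma> F (line_integral \<gamma> F)"
    and "cseminorm p \<Longrightarrow> functional_le f p \<Longrightarrow> f (line_integral \<gamma> F) = (LBINT t. f (u t))"
proof -
  have dec: "\<exists>K. \<forall>f. functional_le f p \<longrightarrow> (\<forall>t. cmod (f (u t)) \<le> K / (1 + t\<^sup>2))"
    if p: "cseminorm p" for p
    using decay[OF p] functional_bound order_trans by metis
  have int: "(\<lambda>t. f (u t)) integrable_on {r..s}" if p: "cseminorm p" and f: "functional_le f p" for f p r s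
  proof -
    obtain K where "\<And>t. cmod (f (u t)) \<le> K / (1 + t\<^sup>2)" using dec[OF p] f by blast
    then have "integrable lborel (\<lambda>t. f (u t))" using meas[OF p f] integrable_decay by blast
    then have "set_integrable lborel {r..s} (\<lambda>t. f (u t))"
      unfolding set_integrable_def by (intro integrable_mult_indicator) auto
    then show ?thesis by (rule set_borel_integral_eq_integral)
  qed
  have "\<exists>J. r \<le> s \<longrightarrow> has_riemann_integral u J r s \<and>
    (\<forall>f p. cseminorm p \<longrightarrow> functional_le f p \<longrightarrow> f J = integral {r..s} (\<lambda>t. f (u t)))"
    for r s
    by (cases "r \<le> s") (use exists_riemann_integral[OF u int] in auto)
  then obtain J where J: "\<And>r s. r \<le> s \<Longrightarrow> has_riemann_integral u (J r s) r s"
    "\<And>r s f p. r \<le> s \<Longrightarrow> cseminorm p \<Longrightarrow> functional_le f p \<Longrightarrow> f (J r s) = integral {r..s} (\<lambda>t. f (u t))"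
    by metis
  have tail: "\<exists>K. \<forall>f r s. functional_le f p \<longrightarrow> r \<le> s \<longrightarrow>
      cmod (f (J r s) - (LBINT t. f (u t))) \<le> K * (pi - (arctan s - arctan r))"
    if p: "cseminorm p" for p
  proof -
    obtain K where K: "\<And>f t. functional_le f p \<Longrightarrow> cmod (f (u t)) \<le> K / (1 + t\<^sup>2)" using dec[OF p] by blast
    have "cmod (f (J r s) - (LBINT t. f (u t))) \<le> K * (pi - (arctan s - arctan r))"
      if f: "functional_le f p" and "r \<le> s" for f r s
      using integral_decay_tail[OF meas[OF p f] K[OF f] \<open>r \<le> s\<close>] J(2)[OF \<open>r \<le> s\<close> p f] by simp
    then show ?thesis by blast
  qed
  have arc: "\<forall>\<^sub>F x in at_bot \<times>\<^sub>F at_top. fst x \<le> snd x \<and> K * (pi - (arctan (snd x) - arctan (fst x))) < e"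
    if "e > 0" for K e :: real
  proof -
    have "((\<lambda>x. K * (pi - (arctan (snd x) - arctan (fst x)))) \<longlongrightarrow> K * (pi - (pi / 2 - - (pi / 2))))
        (at_bot \<times>\<^sub>F at_top)"
      by (intro tendsto_intros filterlim_compose[OF tendsto_arctan_at_top filterlim_snd]
          filterlim_compose[OF tendsto_arctan_at_bot filterlim_fst])
    then have "\<forall>\<^sub>F x in at_bot \<times>\<^sub>F at_top. K * (pi - (arctan (snd x) - arctan (fst x))) < e"
      using that by (intro order_tendstoD(2)) auto
    moreover have "\<forall>\<^sub>F x in at_bot \<times>\<^sub>F at_top. fst x \<le> (0::real) \<and> snd x \<ge> (0::real)"
      by (intro eventually_prodI eventually_le_at_bot eventually_ge_at_top)
    ultimately show ?thesis by eventually_elim auto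
  qed
  define X where "X n = J (- real n) (real n)" for n
  have "Cauchy X"
  proof (rule cseminorm_CauchyI)
    fix p :: "'a \<Rightarrow> real" and e :: real assume p: "cseminorm p" and e: "e > 0"
    obtain K where K: "\<And>f r s. functional_le f p \<Longrightarrow> r \<le> s \<Longrightarrow>
      cmod (f (J r s) - (LBINT t. f (u t))) \<le> K * (pi - (arctan s - arctan r))"
      using tail[OF p] by blast
    have "\<forall>\<^sub>F n in sequentially. K * (pi - (arctan (real n) - arctan (- real n))) < e / 2"
      using e by (intro order_tendstoD(2)[OF arctan_tail_tendsto_0]) auto
    then obtain N where N: "\<And>n. n \<ge> N \<Longrightarrow> K * (pi - (arctan (real n) - arctan (- real n))) < e / 2"
      by (auto simp: eventually_sequentially)
    define c where "c = (\<lambda>n. K * (pi - (arctan (real n) - arctan (- real n))))"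
    have "p (X m - X n) < e" if "m \<ge> N" "n \<ge> N" for m n
    proof -
      have "p (X m - X n) \<le> c m + c n"
      proof (rule seminorm_le_functional[OF cseminorm_seminorm[OF p]])
        fix f assume f: "functional_le f p"
        show "cmod (f (X m - X n)) \<le> c m + c n"
          unfolding functional_diff[OF f]
          by (rule norm_diff_triangle_le[where y = "LBINT t. f (u t)"])
            (use K[OF f, of "- real m" "real m"] K[OF f, of "- real n" "real n"] in
              \<open>simp_all add: norm_minus_commute X_def c_def\<close>)
      qed
      then show ?thesis using N[OF that(1)] N[OF that(2)] by (simp add: c_def)
    qed
    then show "\<exists>N. \<forall>m\<ge>N. \<forall>n\<ge>N. p (X m - X n) < e" by blast
  qed
  then obtain I where I: "X \<longlonglongrightarrow> I" using seq_complete by (auto simp: convergent_def)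
  have fI: "f I = (LBINT t. f (u t))" if p: "cseminorm p" and f: "functional_le f p" for f p
  proof -
    obtain K where K: "\<And>r s. r \<le> s \<Longrightarrow>
      cmod (f (J r s) - (LBINT t. f (u t))) \<le> K * (pi - (arctan s - arctan r))"
      using tail[OF p] f by blast
    have lim1: "(\<lambda>n. f (X n)) \<longlonglongrightarrow> f I"
    proof (rule tendstoI)
      fix e :: real assume "e > 0"
      from cseminorm_tendstoD[OF I p this] show "\<forall>\<^sub>F n in sequentially. dist (f (X n)) (f I) < e"
      proof eventually_elim
        case (elim n)
        then show ?case
          using functional_bound[OF f, of "X n - I"] functional_diff[OF f] by (simp add: dist_norm)
      qed
    qed
    have "(\<lambda>n. f (X n) - (LBINT t. f (u t))) \<longlonglongrightarrow> 0"
      by (rule Lim_null_comparison[OF _ arctan_tail_tendsto_0[of K]]) (use K in \<open>auto simp: X_def\<close>)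
    then have "(\<lambda>n. f (X n)) \<longlonglongrightarrow> (LBINT t. f (u t))" by (simp add: LIM_zero_iff)
    with lim1 show ?thesis by (rule LIMSEQ_unique)
  qed
  have "((\<lambda>(r, s). J r s) \<longlongrightarrow> I) (at_bot \<times>\<^sub>F at_top)"
  proof (rule cseminorm_tendstoI)
    fix p :: "'a \<Rightarrow> real" and e :: real assume p: "cseminorm p" and e: "e > 0"
    obtain K where K: "\<And>f r s. functional_le f p \<Longrightarrow> r \<le> s \<Longrightarrow>
      cmod (f (J r s) - (LBINT t. f (u t))) \<le> K * (pi - (arctan s - arctan r))"
      using tail[OF p] by blast
    from arc[OF e, of K] show "\<forall>\<^sub>F x in at_bot \<times>\<^sub>F at_top. p ((case x of (r, s) \<Rightarrow> J r s) - I) < e"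
    proof eventually_elim
      case (elim x)
      have "p (J (fst x) (snd x) - I) \<le> K * (pi - (arctan (snd x) - arctan (fst x)))"
      proof (rule seminorm_le_functional[OF cseminorm_seminorm[OF p]])
        fix f assume f: "functional_le f p"
        show "cmod (f (J (fst x) (snd x) - I)) \<le> K * (pi - (arctan (snd x) - arctan (fst x)))"
          using K[OF f, of "fst x" "snd x"] fI[OF p f] elim functional_diff[OF f] by simp
      qed
      then show ?case using elim by (simp add: case_prod_unfold)
    qed
  qed
  then have hl: "has_line_integral \<gamma> F I"
    unfolding has_line_integral_def using J(1) unfolding u_def by blast
  then have "line_integral \<gamma> F = I"
    unfolding line_integral_def by (intro the_equality) (auto intro: has_line_integral_unique)
  then show "has_line_integral \<gamma> F (line_integral \<gamma> F)"
    and "cseminorm p \<Longrightarrow> functional_le f p \<Longrightarrow> f (line_integral \<gamma> F) = (LBINT t. f (u t))"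
    using hl fI by auto
qed

section \<open>Test functions and their transforms\<close>

definition vd :: "(real \<Rightarrow> complex) \<Rightarrow> real \<Rightarrow> complex" where
  "vd \<phi> t = vector_derivative \<phi> (at t)"

lemma nth_vderiv_0 [simp]: "nth_vderiv 0 \<phi> = \<phi>"
  by (simp add: nth_vderiv_def)

lemma nth_vderiv_Suc_vd: "nth_vderiv (Suc k) \<phi> = vd (nth_vderiv k \<phi>)"
  by (simp add: nth_vderiv_Suc vd_def fun_eq_iff)

lemma nth_vderiv_vd: "nth_vderiv k (vd \<phi>) = nth_vderiv (Suc k) \<phi>"
  by (induction k) (simp_all add: nth_vderiv_Suc_vd)

lemma test_fun_zero: "t \<notin> supp \<phi> \<Longrightarrow> \<phi> t = 0"
  using closure_subset[of "{t. \<phi> t \<noteq> 0}"] by (auto simp: supp_def)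

lemma test_fun_has_derivative:
  assumes "\<phi> \<in> \<D>"
  shows "(\<phi> has_vector_derivative vd \<phi> t) (at t)"
proof -
  have "nth_vderiv 0 \<phi> differentiable (at t)" using assms by (simp only: test_funs_def smooth_def mem_Collect_eq)
  then show ?thesis by (simp add: vector_derivative_works vd_def)
qed

lemma test_fun_continuous: "\<phi> \<in> \<D> \<Longrightarrow> continuous_on S \<phi>"
  using test_fun_has_derivative
  by (meson continuous_at_imp_continuous_on has_vector_derivative_continuous)

lemma supp_vd: "supp (vd \<phi>) \<subseteq> supp \<phi>"
proof -
  have "t \<in> supp \<phi>" if "vd \<phi> t \<noteq> 0" for t
  proof (rule ccontr)
    assume "t \<notin> supp \<phi>"
    moreover have "open (- supp \<phi>)" by (simp add: supp_def open_Compl)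
    moreover have "((\<lambda>_. 0) has_vector_derivative 0) (at t)" by simp
    ultimately have "(\<phi> has_vector_derivative 0) (at t)"
      using has_vector_derivative_transform_within_open[of "\<lambda>_. 0" 0 t "- supp \<phi>" \<phi>]
        test_fun_zero[of _ \<phi>] by auto
    then show False using that vector_derivative_at by (auto simp: vd_def)
  qed
  then have "closure {t. vd \<phi> t \<noteq> 0} \<subseteq> supp \<phi>"
    by (intro closure_minimal) (auto simp: supp_def)
  then show ?thesis by (simp only: supp_def[of "vd \<phi>"])
qed

lemma vd_test_fun: "\<phi> \<in> \<D> \<Longrightarrow> vd \<phi> \<in> \<D>"
proof -
  assume \<phi>: "\<phi> \<in> \<D>"
  have "smooth (vd \<phi>)"
    using \<phi> unfolding test_funs_def smooth_def nth_vderiv_vd by blast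
  moreover have "compact (supp (vd \<phi>))"
    using \<phi> supp_vd[of \<phi>] compact_Int_closed[of "supp \<phi>" "supp (vd \<phi>)"]
    by (simp add: test_funs_def supp_def Int_absorb1)
  ultimately show ?thesis by (simp add: test_funs_def)
qed

lemma nth_vderiv_test_fun: "\<phi> \<in> \<D> \<Longrightarrow> nth_vderiv k \<phi> \<in> \<D>"
  by (induction k) (simp_all add: nth_vderiv_Suc_vd vd_test_fun)

lemma supp_nth_vderiv: "supp (nth_vderiv k \<phi>) \<subseteq> supp \<phi>"
  by (induction k) (use supp_vd in \<open>auto simp: nth_vderiv_Suc_vd\<close>)

lemma test_fun_bounded:
  assumes "\<phi> \<in> \<D>"
  obtains B where "B \<ge> 0" "\<And>t. cmod (\<phi> t) \<le> B"
proof -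
  have "compact (\<phi> ` supp \<phi>)"
    using assms test_fun_continuous compact_continuous_image by (auto simp: test_funs_def)
  then obtain B where B: "\<And>t. t \<in> supp \<phi> \<Longrightarrow> cmod (\<phi> t) \<le> B"
    using compact_imp_bounded bounded_iff by (metis image_eqI)
  have "cmod (\<phi> t) \<le> max B 0" for t
    using B[of t] test_fun_zero[of t \<phi>] by (cases "t \<in> supp \<phi>") auto
  then show thesis using that[of "max B 0"] by auto
qed

lemma test_fun_support:
  assumes "\<phi> \<in> \<D>"
  obtains m where "m > 0" "supp \<phi> \<subseteq> {-m..m}"
proof -
  have "bounded (supp \<phi>)" using assms by (simp add: test_funs_def compact_imp_bounded)
  then obtain m where m: "m > 0" "\<And>t. t \<in> supp \<phi> \<Longrightarrow> \<bar>t\<bar> \<le> m"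
    unfolding bounded_pos by auto
  then have "supp \<phi> \<subseteq> {-m..m}" by (auto simp: abs_le_iff minus_le_iff)
  with m(1) show thesis using that by blast
qed

lemma hat_integrand_integrable:
  assumes \<phi>: "\<phi> \<in> \<D>"
  shows "integrable lborel (\<lambda>t. exp (\<mu> * complex_of_real t) * \<phi> t)"
proof -
  obtain m where m: "m > 0" "supp \<phi> \<subseteq> {-m..m}" using test_fun_support[OF \<phi>] .
  have "set_integrable lborel {-m..m} (\<lambda>t. exp (\<mu> * complex_of_real t) * \<phi> t)"
    by (intro borel_integrable_atLeastAtMost' continuous_intros test_fun_continuous \<phi>)
  moreover have "indicator {-m..m} t *\<^sub>R (exp (\<mu> * complex_of_real t) * \<phi> t) = exp (\<mu> * complex_of_real t) * \<phi> t" for t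
    using m(2) test_fun_zero[of t \<phi>] by (cases "t \<in> supp \<phi>") (auto simp: indicator_def)
  ultimately show ?thesis by (simp add: set_integrable_def)
qed

lemma hat_eq_integral:
  assumes \<phi>: "\<phi> \<in> \<D>" and m: "supp \<phi> \<subseteq> {l..m}"
  shows "hat \<phi> \<mu> = complex_of_real (1 / (2 * pi)) * integral {l..m} (\<lambda>t. exp (\<mu> * complex_of_real t) * \<phi> t)"
proof -
  have int: "set_integrable lborel {l..m} (\<lambda>t. exp (\<mu> * complex_of_real t) * \<phi> t)"
    by (intro borel_integrable_atLeastAtMost' continuous_intros test_fun_continuous \<phi>)
  have "indicator {l..m} t *\<^sub>R (exp (\<mu> * complex_of_real t) * \<phi> t) = exp (\<mu> * complex_of_real t) * \<phi> t" for t
    using m test_fun_zero[of t \<phi>] by (cases "t \<in> supp \<phi>") (auto simp: indicator_def)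
  then have "(LBINT t. exp (\<mu> * complex_of_real t) * \<phi> t) = integral {l..m} (\<lambda>t. exp (\<mu> * complex_of_real t) * \<phi> t)"
    using set_borel_integral_eq_integral(2)[OF int] by (simp add: set_lebesgue_integral_def)
  then show ?thesis by (simp add: hat_def)
qed

lemma hat_lincomb:
  assumes "\<phi> \<in> \<D>" "\<psi> \<in> \<D>"
  shows "hat (\<lambda>t. c * \<phi> t + d * \<psi> t) \<mu> = c * hat \<phi> \<mu> + d * hat \<psi> \<mu>"
proof -
  have "(\<lambda>t. exp (\<mu> * complex_of_real t) * (c * \<phi> t + d * \<psi> t)) =
      (\<lambda>t. c * (exp (\<mu> * complex_of_real t) * \<phi> t) + d * (exp (\<mu> * complex_of_real t) * \<psi> t))"
    by (simp add: algebra_simps)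
  then show ?thesis
    using hat_integrand_integrable[OF assms(1), of \<mu>] hat_integrand_integrable[OF assms(2), of \<mu>]
    by (simp add: hat_def algebra_simps)
qed

lemma hat_bound:
  assumes \<phi>: "\<phi> \<in> \<D>" "supp \<phi> \<subseteq> {l..m}" and lm: "l \<le> m"
    and B: "\<And>t. cmod (\<phi> t) \<le> B" and \<mu>: "Re \<mu> \<ge> 0"
  shows "cmod (hat \<phi> \<mu>) \<le> (m - l) * B * exp (m * Re \<mu>)"
proof -
  have B0: "B \<ge> 0" using order_trans[OF norm_ge_zero B] .
  have "cmod (integral {l..m} (\<lambda>t. exp (\<mu> * complex_of_real t) * \<phi> t))
      \<le> (exp (m * Re \<mu>) * B) * (m - l)"
  proof (rule integral_bound[OF lm])
    show "continuous_on {l..m} (\<lambda>t. exp (\<mu> * complex_of_real t) * \<phi> t)"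
      by (intro continuous_intros test_fun_continuous \<phi>)
    fix t assume t: "t \<in> {l..m}"
    have "t * Re \<mu> \<le> m * Re \<mu>" using t \<mu> by (intro mult_right_mono) auto
    then show "cmod (exp (\<mu> * complex_of_real t) * \<phi> t) \<le> exp (m * Re \<mu>) * B"
      unfolding norm_mult by (intro mult_mono B) (auto simp: norm_exp_eq_Re mult.commute)
  qed
  moreover have "cmod (complex_of_real (1 / (2 * pi))) \<le> 1"
    using pi_gt3 by (simp add: norm_divide)
  ultimately have "cmod (hat \<phi> \<mu>) \<le> 1 * ((exp (m * Re \<mu>) * B) * (m - l))"
    unfolding hat_eq_integral[OF \<phi>] norm_mult using B0 lm by (intro mult_mono) auto
  then show ?thesis by (simp add: mult_ac)
qed

lemma hat_vd:
  assumes \<phi>: "\<phi> \<in> \<D>"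
  shows "hat (vd \<phi>) \<mu> = - \<mu> * hat \<phi> \<mu>"
proof -
  \<comment> \<open>On the enlarged interval \<open>\<phi>\<close> vanishes at both end points, so integration by parts has no boundary terms.\<close>
  obtain m where m: "m > 0" "supp \<phi> \<subseteq> {-m..m}" using test_fun_support[OF \<phi>] .
  let ?l = "- m - 1" and ?r = "m + 1"
  have s: "supp \<phi> \<subseteq> {?l..?r}" "supp (vd \<phi>) \<subseteq> {?l..?r}" using m supp_vd[of \<phi>] by force+
  have z: "\<phi> ?l = 0" "\<phi> ?r = 0" using m by (auto intro!: test_fun_zero)
  have "((\<lambda>t. exp (\<mu> * complex_of_real t) * vd \<phi> t + \<mu> * exp (\<mu> * complex_of_real t) * \<phi> t) has_integral
      (exp (\<mu> * complex_of_real ?r) * \<phi> ?r - exp (\<mu> * complex_of_real ?l) * \<phi> ?l)) {?l..?r}"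
    using m(1)
    by (intro fundamental_theorem_of_calculus)
      (auto intro!: derivative_eq_intros has_vector_derivative_at_within[OF test_fun_has_derivative[OF \<phi>]]
          has_vector_derivative_real_field simp: algebra_simps)
  then have "integral {?l..?r} (\<lambda>t. exp (\<mu> * complex_of_real t) * vd \<phi> t + \<mu> * exp (\<mu> * complex_of_real t) * \<phi> t) = 0"
    using z by (simp add: integral_unique)
  moreover have "integral {?l..?r} (\<lambda>t. exp (\<mu> * complex_of_real t) * vd \<phi> t + \<mu> * exp (\<mu> * complex_of_real t) * \<phi> t)
    = integral {?l..?r} (\<lambda>t. exp (\<mu> * complex_of_real t) * vd \<phi> t)
      + \<mu> * integral {?l..?r} (\<lambda>t. exp (\<mu> * complex_of_real t) * \<phi> t)"
  proof -
    have "(\<lambda>t. exp (\<mu> * complex_of_real t) * vd \<phi> t) integrable_on {?l..?r}"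
      by (intro integrable_continuous_real continuous_intros test_fun_continuous vd_test_fun \<phi>)
    moreover have "(\<lambda>t. exp (\<mu> * complex_of_real t) * \<phi> t) integrable_on {?l..?r}"
      by (intro integrable_continuous_real continuous_intros test_fun_continuous \<phi>)
    ultimately show ?thesis
      by (simp add: integral_add integrable_on_mult_right mult.assoc)
  qed
  ultimately have "integral {?l..?r} (\<lambda>t. exp (\<mu> * complex_of_real t) * vd \<phi> t)
      = - \<mu> * integral {?l..?r} (\<lambda>t. exp (\<mu> * complex_of_real t) * \<phi> t)"
    by (simp add: eq_neg_iff_add_eq_0)
  then show ?thesis
    by (simp add: hat_eq_integral[OF \<phi> s(1)] hat_eq_integral[OF vd_test_fun[OF \<phi>] s(2)])
qed

lemma hat_nth_vderiv: "\<phi> \<in> \<D> \<Longrightarrow> hat (nth_vderiv k \<phi>) \<mu> = (- \<mu>) ^ k * hat \<phi> \<mu>"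
  by (induction k) (simp_all add: nth_vderiv_Suc_vd hat_vd nth_vderiv_test_fun)

text \<open>
  Every derivative of \<open>\<phi>\<close> gains a factor \<open>\<mu>\<close>. Only the right end \<open>m\<close> of the support enters the
  exponential; with \<open>m = 0\<close> there is decay in the whole right half plane.
\<close>

lemma hat_decay:
  assumes \<phi>: "\<phi> \<in> \<D>" "supp \<phi> \<subseteq> {l..m}" and lm: "l \<le> m"
    and B: "\<And>t. cmod (nth_vderiv k \<phi> t) \<le> B" and \<mu>: "Re \<mu> \<ge> 0"
  shows "cmod \<mu> ^ k * cmod (hat \<phi> \<mu>) \<le> (m - l) * B * exp (m * Re \<mu>)"
  using hat_bound[OF nth_vderiv_test_fun[OF \<phi>(1), of k] order_trans[OF supp_nth_vderiv \<phi>(2)] lm B \<mu>]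
  by (simp add: hat_nth_vderiv[OF \<phi>(1)] norm_mult norm_power)

lemma hat_holomorphic:
  assumes \<phi>: "\<phi> \<in> \<D>"
  shows "hat \<phi> holomorphic_on S"
proof -
  obtain m where m: "m > 0" "supp \<phi> \<subseteq> {-m..m}" using test_fun_support[OF \<phi>] .
  have "(\<lambda>\<mu>. integral (cbox (-m) m) (\<lambda>t. exp (\<mu> * complex_of_real t) * \<phi> t)) holomorphic_on UNIV"
  proof (rule leibniz_rule_holomorphic)
    fix \<mu> :: complex and t :: real
    show "((\<lambda>\<mu>. exp (\<mu> * complex_of_real t) * \<phi> t) has_field_derivative
        complex_of_real t * exp (\<mu> * complex_of_real t) * \<phi> t) (at \<mu> within UNIV)"
      by (auto intro!: derivative_eq_intros)
    show "(\<lambda>t. exp (\<mu> * complex_of_real t) * \<phi> t) integrable_on cbox (-m) m"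
      by (intro integrable_continuous continuous_intros test_fun_continuous \<phi>)
    have "continuous_on (UNIV \<times> cbox (-m) m) (\<lambda>x. \<phi> (snd x))"
      by (rule continuous_on_compose2[OF test_fun_continuous[OF \<phi>, of UNIV]]) (auto intro: continuous_intros)
    then show "continuous_on (UNIV \<times> cbox (-m) m) (\<lambda>(\<mu>, t). complex_of_real t * exp (\<mu> * complex_of_real t) * \<phi> t)"
      unfolding case_prod_unfold by (intro continuous_intros) auto
  qed auto
  then have "(\<lambda>\<mu>. complex_of_real (1 / (2 * pi)) * integral {-m..m} (\<lambda>t. exp (\<mu> * complex_of_real t) * \<phi> t))
      holomorphic_on S"
    by (intro holomorphic_intros) (auto intro: holomorphic_on_subset)
  then show ?thesis using hat_eq_integral[OF \<phi> m(2)] by (simp add: fun_eq_iff cong: holomorphic_cong)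
qed

lemma hat_continuous: "\<phi> \<in> \<D> \<Longrightarrow> continuous_on S (hat \<phi>)"
  by (simp add: hat_holomorphic holomorphic_on_imp_continuous_on)

definition shift :: "real \<Rightarrow> (real \<Rightarrow> complex) \<Rightarrow> real \<Rightarrow> complex" where
  "shift h \<phi> t = \<phi> (t + h)"

lemma shift_has_derivative:
  assumes "\<phi> \<in> \<D>"
  shows "(shift h \<phi> has_vector_derivative shift h (vd \<phi>) t) (at t)"
proof -
  have "((\<lambda>t. t + h) has_vector_derivative 1) (at t)"
    by (auto intro!: derivative_eq_intros)
  from vector_diff_chain_at[OF this test_fun_has_derivative[OF assms]]
  show ?thesis by (simp add: shift_def[abs_def] o_def)
qed

lemma vd_shift: "\<phi> \<in> \<D> \<Longrightarrow> vd (shift h \<phi>) = shift h (vd \<phi>)"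
  by (rule ext) (simp add: vd_def[of "shift h \<phi>"] vector_derivative_at shift_has_derivative)

lemma nth_vderiv_shift: "\<phi> \<in> \<D> \<Longrightarrow> nth_vderiv k (shift h \<phi>) = shift h (nth_vderiv k \<phi>)"
  by (induction k) (simp_all add: nth_vderiv_Suc_vd vd_shift nth_vderiv_test_fun)

lemma shift_support: "supp \<phi> \<subseteq> {l..m} \<Longrightarrow> supp (shift h \<phi>) \<subseteq> {l - h..m - h}"
proof -
  assume *: "supp \<phi> \<subseteq> {l..m}"
  have "t \<in> {l - h..m - h}" if "shift h \<phi> t \<noteq> 0" for t
    using * that test_fun_zero[of "t + h" \<phi>] by (fastforce simp: shift_def)
  then have "closure {t. shift h \<phi> t \<noteq> 0} \<subseteq> {l - h..m - h}"
    by (intro closure_minimal) auto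
  then show ?thesis by (simp only: supp_def[of "shift h \<phi>"])
qed

lemma shift_test_fun:
  assumes "\<phi> \<in> \<D>"
  shows "shift h \<phi> \<in> \<D>"
proof -
  obtain m where m: "supp \<phi> \<subseteq> {-m..m}" using test_fun_support[OF assms] .
  have "smooth (shift h \<phi>)"
    unfolding smooth_def nth_vderiv_shift[OF assms]
    using shift_has_derivative[OF nth_vderiv_test_fun[OF assms]]
    by (auto simp: differentiable_def has_vector_derivative_def)
  moreover have "compact (supp (shift h \<phi>))"
    using shift_support[OF m, of h] compact_Int_closed[of "{- m - h..m - h}" "supp (shift h \<phi>)"]
    by (simp add: supp_def Int_absorb1)
  ultimately show ?thesis by (simp add: test_funs_def)
qed

lemma hat_shift: "hat (shift h \<phi>) \<mu> = exp (- (of_real h * \<mu>)) * hat \<phi> \<mu>"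
proof -
  have "(LBINT t. exp (\<mu> * complex_of_real t) * \<phi> t)
      = (LBINT t. exp (\<mu> * complex_of_real (h + 1 * t)) * \<phi> (h + 1 * t))"
    using lborel_integral_real_affine[of 1 "\<lambda>t. exp (\<mu> * complex_of_real t) * \<phi> t" h] by simp
  also have "\<dots> = (LBINT t. exp (of_real h * \<mu>) * (exp (\<mu> * complex_of_real t) * \<phi> (t + h)))"
    by (simp add: exp_add algebra_simps)
  also have "\<dots> = exp (of_real h * \<mu>) * (LBINT t. exp (\<mu> * complex_of_real t) * \<phi> (t + h))"
    by (rule integral_mult_right_zero)
  finally show ?thesis by (simp add: hat_def shift_def exp_minus field_simps)
qed

section \<open>The contour\<close>

locale exp_contour =
  fixes a b :: real
  assumes a_pos: "a > 0" and b_pos: "b > 0"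
begin

abbreviation \<Gamma> :: "real \<Rightarrow> complex" where "\<Gamma> \<equiv> Gamma_curve a b"
abbreviation d\<Gamma> :: "real \<Rightarrow> complex" where "d\<Gamma> t \<equiv> vector_derivative \<Gamma> (at t)"
abbreviation E :: "complex set" where "E \<equiv> exp_region a b"
abbreviation \<Omega> :: "complex set" where "\<Omega> \<equiv> Omega_region a b"

text \<open>
  The corners of the contour are at the parameters \<open>T\<close> and \<open>- T\<close>.
\<close>

definition T :: real where "T = exp (a * b)"

lemma T_gt_1: "T > 1"
  using a_pos b_pos by (simp add: T_def)

lemma Im_\<Gamma> [simp]: "Im (\<Gamma> t) = t"
  by (simp add: Gamma_curve_def)

lemma Re_\<Gamma>: "Re (\<Gamma> t) = ln (max \<bar>t\<bar> T) / a"
  using a_pos by (auto simp: Gamma_curve_def T_def max_def)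

lemma \<Gamma>_eq: "\<Gamma> = (\<lambda>t. complex_of_real (ln (max \<bar>t\<bar> T) / a) + \<i> * complex_of_real t)"
  by (rule ext, rule complex_eqI) (simp_all add: Re_\<Gamma>)

lemma \<Gamma>_range: "\<Gamma> t \<in> range \<Gamma>"
  by simp

lemma \<Gamma>_in_E: "\<Gamma> t \<in> E"
  using Gamma_curve_range[OF a_pos, of b] \<Gamma>_range by blast

lemma E_Re: "z \<in> E \<Longrightarrow> Re z \<ge> b"
  by (simp add: exp_region_def)

lemma E_norm: "z \<in> E \<Longrightarrow> cmod z \<ge> b"
  using E_Re complex_Re_le_cmod order_trans by blast

lemma E_shift: "z \<in> E \<Longrightarrow> s > 0 \<Longrightarrow> z + complex_of_real s \<in> \<Omega>"
proof -
  assume z: "z \<in> E" "s > 0"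
  have "exp (a * Re z) < exp (a * (Re z + s))" using a_pos z by simp
  moreover have "\<bar>Im z\<bar> \<le> exp (a * Re z)" "b \<le> Re z" using z by (auto simp: exp_region_def)
  ultimately have "\<bar>Im z\<bar> < exp (a * (Re z + s))" "b < Re z + s" using z by linarith+
  then show ?thesis by (simp add: Omega_region_eq[OF a_pos])
qed

lemma \<Omega>_subset_E: "\<Omega> \<subseteq> E"
  by (auto simp: Omega_region_eq[OF a_pos] exp_region_def)

lemma open_\<Omega>: "open \<Omega>"
  unfolding Omega_region_eq[OF a_pos]
  by (intro open_Collect_conj open_Collect_less continuous_intros)

lemma continuous_\<Gamma>: "continuous_on S \<Gamma>"
  unfolding \<Gamma>_eq using T_gt_1 a_pos by (intro continuous_intros) (auto simp: max_def)

lemma \<Gamma>_deriv_inner: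
  assumes "\<bar>t\<bar> < T"
  shows "(\<Gamma> has_vector_derivative \<i>) (at t)"
proof (rule has_vector_derivative_transform_within_open)
  show "((\<lambda>t. complex_of_real b + \<i> * complex_of_real t) has_vector_derivative \<i>) (at t)"
    by (auto intro!: derivative_eq_intros has_vector_derivative_real_field)
  show "open {-T<..<T}" "t \<in> {-T<..<T}" using assms by auto
  fix x assume "x \<in> {-T<..<T}"
  then have "\<bar>x\<bar> \<le> T" by auto
  then have "max \<bar>x\<bar> T = exp (a * b)" by (simp add: T_def)
  then show "complex_of_real b + \<i> * complex_of_real x = \<Gamma> x" using a_pos by (simp add: \<Gamma>_eq)
qed

lemma \<Gamma>_deriv_outer:
  assumes "\<bar>t\<bar> > T"
  shows "(\<Gamma> has_vector_derivative (complex_of_real (1 / (a * t)) + \<i>)) (at t)"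
proof -
  define s where "s = sgn t"
  have s: "s = 1 \<or> s = -1" "s * t > T" using assms T_gt_1 by (auto simp: s_def sgn_if)
  show ?thesis
  proof (rule has_vector_derivative_transform_within_open)
    have st: "s * t > 0" using s T_gt_1 by linarith
    have "((\<lambda>x. ln (s * x) / a) has_real_derivative (1 / (a * t))) (at t)"
      using st s a_pos by (auto intro!: derivative_eq_intros simp: field_simps)
    then have "((\<lambda>x. complex_of_real (ln (s * x) / a)) has_vector_derivative complex_of_real (1 / (a * t))) (at t)"
      by (rule has_vector_derivative_of_real)
    moreover have "((\<lambda>x. \<i> * complex_of_real x) has_vector_derivative \<i>) (at t)"
      by (auto intro!: derivative_eq_intros has_vector_derivative_real_field)
    ultimately show "((\<lambda>x. complex_of_real (ln (s * x) / a) + \<i> * complex_of_real x) has_vector_derivative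
        (complex_of_real (1 / (a * t)) + \<i>)) (at t)"
      by (rule has_vector_derivative_add)
    show "open {x. s * x > T}" by (intro open_Collect_less continuous_intros)
    show "t \<in> {x. s * x > T}" using s by simp
    fix x assume "x \<in> {x. s * x > T}"
    then have "max \<bar>x\<bar> T = s * x" using s T_gt_1 by auto
    then show "complex_of_real (ln (s * x) / a) + \<i> * complex_of_real x = \<Gamma> x" by (simp add: \<Gamma>_eq)
  qed
qed

lemma d\<Gamma>_eq: "d\<Gamma> t = (if t = T then d\<Gamma> T else if t = - T then d\<Gamma> (- T)
    else if \<bar>t\<bar> < T then \<i> else complex_of_real (1 / (a * t)) + \<i>)"
proof -
  consider "t = T" | "t = - T" | "\<bar>t\<bar> < T" | "\<bar>t\<bar> > T" by linarith
  then show ?thesis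
    using vector_derivative_at[OF \<Gamma>_deriv_inner] vector_derivative_at[OF \<Gamma>_deriv_outer]
    by cases auto
qed

lemma \<Gamma>_deriv: "t \<notin> {T, - T} \<Longrightarrow> (\<Gamma> has_vector_derivative d\<Gamma> t) (at t)"
proof -
  assume "t \<notin> {T, - T}"
  then have "\<bar>t\<bar> < T \<or> \<bar>t\<bar> > T" by auto
  then show ?thesis
    using vector_derivative_at[OF \<Gamma>_deriv_inner] vector_derivative_at[OF \<Gamma>_deriv_outer]
      \<Gamma>_deriv_inner \<Gamma>_deriv_outer by metis
qed

lemma d\<Gamma>_measurable [measurable]: "(\<lambda>t. d\<Gamma> t) \<in> borel_measurable borel"
  by (subst d\<Gamma>_eq) measurable

lemma d\<Gamma>_bounded: obtains c where "c > 0" "\<And>t. cmod (d\<Gamma> t) \<le> c"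
proof (rule that[of "1 / (a * T) + 1 + cmod (d\<Gamma> T) + cmod (d\<Gamma> (- T))"])
  have aT: "a * T > 0" using a_pos T_gt_1 by simp
  then show "1 / (a * T) + 1 + cmod (d\<Gamma> T) + cmod (d\<Gamma> (- T)) > 0"
    by (intro add_pos_nonneg) auto
  fix t
  consider "t = T" | "t = - T" | "\<bar>t\<bar> < T" | "\<bar>t\<bar> > T" by linarith
  then show "cmod (d\<Gamma> t) \<le> 1 / (a * T) + 1 + cmod (d\<Gamma> T) + cmod (d\<Gamma> (- T))"
  proof cases
    case 4
    have "cmod (d\<Gamma> t) \<le> cmod (complex_of_real (1 / (a * t))) + cmod \<i>"
      unfolding vector_derivative_at[OF \<Gamma>_deriv_outer[OF 4]] by (rule norm_triangle_ineq)
    also have "cmod (complex_of_real (1 / (a * t))) = 1 / (a * \<bar>t\<bar>)"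
      using a_pos unfolding norm_of_real by (simp add: abs_mult)
    also have "1 / (a * \<bar>t\<bar>) \<le> 1 / (a * T)"
      using 4 a_pos T_gt_1 by (intro divide_left_mono mult_left_mono mult_pos_pos) auto
    finally have "cmod (d\<Gamma> t) \<le> 1 / (a * T) + 1" by simp
    then show ?thesis using norm_ge_zero[of "d\<Gamma> T"] norm_ge_zero[of "d\<Gamma> (- T)"] by linarith
  next
    case 3
    then show ?thesis using aT by (simp add: vector_derivative_at[OF \<Gamma>_deriv_inner[OF 3]])
  qed (use aT in auto)
qed

lemma d\<Gamma>_osc:
  assumes "closed_segment x y \<inter> {T, - T} = {}"
  shows "cmod (d\<Gamma> x - d\<Gamma> y) \<le> \<bar>x - y\<bar> / a"
proof -
  have ne: "x \<noteq> T" "x \<noteq> - T" "y \<noteq> T" "y \<noteq> - T" using assms by auto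
  have "T \<notin> closed_segment x y" "- T \<notin> closed_segment x y" using assms by auto
  then consider "\<bar>x\<bar> < T" "\<bar>y\<bar> < T" | "x > T" "y > T" | "x < - T" "y < - T"
    using ne by (auto simp: closed_segment_eq_real_ivl split: if_splits)
  then have "(\<bar>x\<bar> < T \<and> \<bar>y\<bar> < T) \<or> (\<bar>x\<bar> > T \<and> \<bar>y\<bar> > T)" using T_gt_1 by cases auto
  then show ?thesis
  proof
    assume "\<bar>x\<bar> < T \<and> \<bar>y\<bar> < T"
    then show ?thesis using a_pos by (simp add: vector_derivative_at[OF \<Gamma>_deriv_inner])
  next
    assume *: "\<bar>x\<bar> > T \<and> \<bar>y\<bar> > T"
    then have nz: "x \<noteq> 0" "y \<noteq> 0" using T_gt_1 by auto
    have "d\<Gamma> x - d\<Gamma> y = complex_of_real (1 / (a * x) - 1 / (a * y))"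
      using * by (simp add: vector_derivative_at[OF \<Gamma>_deriv_outer])
    then have "cmod (d\<Gamma> x - d\<Gamma> y) = \<bar>1 / (a * x) - 1 / (a * y)\<bar>"
      using norm_of_real[of "1 / (a * x) - 1 / (a * y)", where ?'a = complex] by presburger
    also have "1 / (a * x) - 1 / (a * y) = (y - x) / (a * (x * y))"
      using nz a_pos by (simp add: field_simps)
    also have "\<bar>\<dots>\<bar> = \<bar>x - y\<bar> / (a * (\<bar>x\<bar> * \<bar>y\<bar>))"
      using a_pos by (simp add: abs_mult abs_minus_commute)
    also have "\<dots> \<le> \<bar>x - y\<bar> / (a * 1)"
    proof (intro divide_left_mono mult_left_mono mult_pos_pos)
      show "1 \<le> \<bar>x\<bar> * \<bar>y\<bar>" using * T_gt_1 mult_mono[of 1 "\<bar>x\<bar>" 1 "\<bar>y\<bar>"] by simp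
    qed (use nz a_pos in auto)
    finally show ?thesis by simp
  qed
qed

lemma Re_\<Gamma>_ge: "Re (\<Gamma> t) \<ge> b"
  using \<Gamma>_in_E E_Re by blast

lemma Re_\<Gamma>_pos: "Re (\<Gamma> t) > 0"
  using Re_\<Gamma>_ge[of t] b_pos by linarith

text \<open>
  On the curved part of the contour \<open>exp (m * Re \<mu>)\<close> is the power \<open>m / a\<close> of \<open>\<bar>Im \<mu>\<bar>\<close>.
\<close>

lemma exp_Re_\<Gamma>_growth:
  obtains c n where "c > 0" "\<And>t. exp (m * Re (\<Gamma> t)) \<le> c * (1 + \<bar>t\<bar>) ^ n"
proof -
  define n where "n = nat \<lceil>\<bar>m\<bar> / a\<rceil>"
  have n: "\<bar>m\<bar> / a \<le> real n" unfolding n_def by linarith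
  show thesis
  proof (rule that[of "T ^ n" n])
    show "T ^ n > 0" using T_gt_1 by simp
    fix t
    have mx: "max \<bar>t\<bar> T > 1" using T_gt_1 by auto
    have "exp (m * Re (\<Gamma> t)) \<le> exp (\<bar>m\<bar> * Re (\<Gamma> t))"
      using Re_\<Gamma>_pos[of t] by (simp add: mult_right_mono)
    also have "\<dots> = exp (ln (max \<bar>t\<bar> T) * (\<bar>m\<bar> / a))" by (simp add: Re_\<Gamma> mult.commute)
    also have "\<dots> \<le> exp (ln (max \<bar>t\<bar> T) * real n)"
      using n mx by (simp only: exp_le_cancel_iff, intro mult_left_mono) auto
    also have "\<dots> = max \<bar>t\<bar> T ^ n"
      using mx by (simp add: exp_of_nat2_mult)
    also have "\<dots> \<le> (T * (1 + \<bar>t\<bar>)) ^ n"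
    proof (rule power_mono)
      have "1 * \<bar>t\<bar> \<le> T * \<bar>t\<bar>" using T_gt_1 by (intro mult_right_mono) auto
      then show "max \<bar>t\<bar> T \<le> T * (1 + \<bar>t\<bar>)" using T_gt_1 by (auto simp: algebra_simps)
    qed (use mx in auto)
    finally show "exp (m * Re (\<Gamma> t)) \<le> T ^ n * (1 + \<bar>t\<bar>) ^ n" by (simp add: power_mult_distrib)
  qed
qed

lemma norm_\<Gamma>_growth: obtains c where "c > 0" "\<And>t. 1 + cmod (\<Gamma> t) \<le> c * (1 + \<bar>t\<bar>)"
proof (rule that[of "1 + T / a + 1 / a + 1"])
  show "1 + T / a + 1 / a + 1 > 0" using a_pos T_gt_1 by (simp add: add_pos_pos)
  fix t
  have mx: "max \<bar>t\<bar> T > 1" using T_gt_1 by auto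
  have "cmod (\<Gamma> t) \<le> \<bar>Re (\<Gamma> t)\<bar> + \<bar>t\<bar>" using cmod_le[of "\<Gamma> t"] by simp
  also have "\<bar>Re (\<Gamma> t)\<bar> = ln (max \<bar>t\<bar> T) / a" using Re_\<Gamma>_pos[of t] Re_\<Gamma>[of t] by linarith
  also have "\<dots> \<le> (\<bar>t\<bar> + T) / a"
    using a_pos mx ln_le_minus_one[of "max \<bar>t\<bar> T"] T_gt_1 by (intro divide_right_mono) auto
  finally have "1 + cmod (\<Gamma> t) \<le> 1 + (\<bar>t\<bar> + T) / a + \<bar>t\<bar>" by simp
  moreover have "0 \<le> T * \<bar>t\<bar> / a + 1 / a + \<bar>t\<bar> + 1" using a_pos T_gt_1 by auto
  ultimately show "1 + cmod (\<Gamma> t) \<le> (1 + T / a + 1 / a + 1) * (1 + \<bar>t\<bar>)"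
    by (simp add: algebra_simps add_divide_distrib)
qed

lemma norm_\<Gamma>_lower: obtains c where "c > 0" "\<And>t. 1 + \<bar>t\<bar> \<le> c * cmod (\<Gamma> t)"
proof (rule that[of "1 / b + 1"])
  show "1 / b + 1 > 0" using b_pos by (simp add: add_pos_pos)
  fix t
  have "1 \<le> cmod (\<Gamma> t) / b" using E_norm[OF \<Gamma>_in_E] b_pos by simp
  moreover have "\<bar>t\<bar> \<le> cmod (\<Gamma> t)" using abs_Im_le_cmod[of "\<Gamma> t"] by simp
  ultimately show "1 + \<bar>t\<bar> \<le> (1 / b + 1) * cmod (\<Gamma> t)" by (simp add: algebra_simps)
qed

section \<open>Weights on the contour\<close>

text \<open>
  Growth and decay are measured in the parameter \<open>t = Im \<mu>\<close>, which is comparable with \<open>cmod \<mu>\<close> on the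
  contour.
\<close>

definition tempered :: "(complex \<Rightarrow> complex) \<Rightarrow> bool" where
  "tempered h \<longleftrightarrow> continuous_on UNIV (\<lambda>t. h (\<Gamma> t)) \<and> (\<exists>c n. \<forall>t. cmod (h (\<Gamma> t)) \<le> c * (1 + \<bar>t\<bar>) ^ n)"

definition rapid :: "(complex \<Rightarrow> complex) \<Rightarrow> bool" where
  "rapid g \<longleftrightarrow> continuous_on UNIV (\<lambda>t. g (\<Gamma> t)) \<and> (\<forall>k. \<exists>N. \<forall>t. cmod (g (\<Gamma> t)) * (1 + \<bar>t\<bar>) ^ k \<le> N)"

lemma rapid_mult:
  assumes "rapid g" "tempered h"
  shows "rapid (\<lambda>\<mu>. h \<mu> * g \<mu>)"
  unfolding rapid_def
proof (intro conjI allI)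
  show "continuous_on UNIV (\<lambda>t. h (\<Gamma> t) * g (\<Gamma> t))"
    using assms by (auto simp: rapid_def tempered_def intro: continuous_intros)
  fix k
  obtain c n where h: "\<And>t. cmod (h (\<Gamma> t)) \<le> c * (1 + \<bar>t\<bar>) ^ n" using assms by (auto simp: tempered_def)
  obtain N where N: "\<And>t. cmod (g (\<Gamma> t)) * (1 + \<bar>t\<bar>) ^ (n + k) \<le> N" using assms unfolding rapid_def by blast
  have c: "c \<ge> 0" using order_trans[OF norm_ge_zero h[of 0]] by simp
  have "cmod (h (\<Gamma> t) * g (\<Gamma> t)) * (1 + \<bar>t\<bar>) ^ k \<le> c * N" for t
  proof -
    have "cmod (h (\<Gamma> t) * g (\<Gamma> t)) * (1 + \<bar>t\<bar>) ^ k
        \<le> (c * (1 + \<bar>t\<bar>) ^ n) * (cmod (g (\<Gamma> t)) * (1 + \<bar>t\<bar>) ^ k)"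
      using mult_right_mono[OF h[of t], of "cmod (g (\<Gamma> t)) * (1 + \<bar>t\<bar>) ^ k"] by (simp add: norm_mult mult_ac)
    also have "\<dots> = c * (cmod (g (\<Gamma> t)) * (1 + \<bar>t\<bar>) ^ (n + k))" by (simp add: power_add mult_ac)
    also have "\<dots> \<le> c * N" using N c by (intro mult_left_mono)
    finally show ?thesis .
  qed
  then show "\<exists>N. \<forall>t. cmod (h (\<Gamma> t) * g (\<Gamma> t)) * (1 + \<bar>t\<bar>) ^ k \<le> N" by blast
qed

lemma rapid_add:
  assumes "rapid g" "rapid h"
  shows "rapid (\<lambda>\<mu>. g \<mu> + h \<mu>)"
  unfolding rapid_def
proof (intro conjI allI)
  show "continuous_on UNIV (\<lambda>t. g (\<Gamma> t) + h (\<Gamma> t))"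
    using assms by (auto simp: rapid_def intro: continuous_intros)
  fix k
  obtain N where N: "\<And>t. cmod (g (\<Gamma> t)) * (1 + \<bar>t\<bar>) ^ k \<le> N" using assms(1) unfolding rapid_def by blast
  obtain M where M: "\<And>t. cmod (h (\<Gamma> t)) * (1 + \<bar>t\<bar>) ^ k \<le> M" using assms(2) unfolding rapid_def by blast
  have "cmod (g (\<Gamma> t) + h (\<Gamma> t)) * (1 + \<bar>t\<bar>) ^ k \<le> N + M" for t
    using mult_right_mono[OF norm_triangle_ineq[of "g (\<Gamma> t)" "h (\<Gamma> t)"], of "(1 + \<bar>t\<bar>) ^ k"] N[of t] M[of t]
    by (simp add: distrib_right)
  then show "\<exists>N. \<forall>t. cmod (g (\<Gamma> t) + h (\<Gamma> t)) * (1 + \<bar>t\<bar>) ^ k \<le> N" by blast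
qed

lemma tempered_const: "tempered (\<lambda>_. c)"
  unfolding tempered_def by (intro conjI continuous_on_const exI[of _ "cmod c"] exI[of _ "0::nat"]) simp

lemma tempered_id: "tempered (\<lambda>\<mu>. \<mu>)"
proof -
  obtain c where "\<And>t. 1 + cmod (\<Gamma> t) \<le> c * (1 + \<bar>t\<bar>)" using norm_\<Gamma>_growth by blast
  then have "cmod (\<Gamma> t) \<le> c * (1 + \<bar>t\<bar>) ^ 1" for t by (smt (verit) power_one_right)
  then show ?thesis unfolding tempered_def using continuous_\<Gamma> by blast
qed

lemma tempered_exp: "tempered (\<lambda>\<mu>. exp (of_real h * \<mu>))"
proof -
  obtain c n where "\<And>t. exp (h * Re (\<Gamma> t)) \<le> c * (1 + \<bar>t\<bar>) ^ n" using exp_Re_\<Gamma>_growth[of h] by blast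
  then have "cmod (exp (of_real h * \<Gamma> t)) \<le> c * (1 + \<bar>t\<bar>) ^ n" for t by (simp add: norm_exp_eq_Re)
  moreover have "continuous_on UNIV (\<lambda>t. exp (of_real h * \<Gamma> t))" by (intro continuous_intros continuous_\<Gamma>)
  ultimately show ?thesis unfolding tempered_def by blast
qed

lemma rapid_scale: "rapid g \<Longrightarrow> rapid (\<lambda>\<mu>. c * g \<mu>)"
  using rapid_mult[OF _ tempered_const] .

lemma rapid_diff: "rapid g \<Longrightarrow> rapid h \<Longrightarrow> rapid (\<lambda>\<mu>. g \<mu> - h \<mu>)"
  using rapid_add[of g "\<lambda>\<mu>. - 1 * h \<mu>"] rapid_scale[of h "- 1"] by simp

text \<open>
  A single derivative, of an order that depends on \<open>m\<close> and \<open>k\<close> alone, controls the decay of the transforms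
  of all test functions supported in \<open>{-m..m}\<close>. This uniformity makes the distribution continuous.
\<close>

lemma rapid_hat_bound:
  assumes m: "m > 0"
  shows "\<exists>c>0. \<exists>N. \<forall>\<phi> B. \<phi> \<in> \<D> \<longrightarrow> supp \<phi> \<subseteq> {-m..m} \<longrightarrow> (\<forall>t. cmod (nth_vderiv N \<phi> t) \<le> B) \<longrightarrow>
    (\<forall>t. cmod (hat \<phi> (\<Gamma> t)) * (1 + \<bar>t\<bar>) ^ k \<le> c * B)"
proof -
  obtain c n where c: "c > 0" "\<And>t. exp (m * Re (\<Gamma> t)) \<le> c * (1 + \<bar>t\<bar>) ^ n" using exp_Re_\<Gamma>_growth[of m] by blast
  obtain d where d: "d > 0" "\<And>t. 1 + \<bar>t\<bar> \<le> d * cmod (\<Gamma> t)" using norm_\<Gamma>_lower by blast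
  show ?thesis
  proof (intro exI[of _ "d ^ (n + k) * (2 * m * c)"] exI[of _ "n + k"] conjI allI impI)
    show "d ^ (n + k) * (2 * m * c) > 0" using c d m by simp
    fix \<phi> B t assume \<phi>: "\<phi> \<in> \<D>" "supp \<phi> \<subseteq> {-m..m}" and B': "\<forall>t. cmod (nth_vderiv (n + k) \<phi> t) \<le> B"
    have B: "cmod (nth_vderiv (n + k) \<phi> t) \<le> B" for t using B' by blast
    have B0: "B \<ge> 0" using order_trans[OF norm_ge_zero B] .
    define X where "X = 1 + \<bar>t :: real\<bar>"
    have X: "X > 0" by (simp add: X_def add_pos_nonneg)
    have "cmod (hat \<phi> (\<Gamma> t)) * X ^ (n + k) \<le> cmod (hat \<phi> (\<Gamma> t)) * (d * cmod (\<Gamma> t)) ^ (n + k)"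
      using d(2)[of t] X unfolding X_def by (intro mult_left_mono power_mono) auto
    also have "\<dots> = d ^ (n + k) * (cmod (\<Gamma> t) ^ (n + k) * cmod (hat \<phi> (\<Gamma> t)))"
      by (simp add: power_mult_distrib)
    also have "\<dots> \<le> d ^ (n + k) * ((m - (- m)) * B * exp (m * Re (\<Gamma> t)))"
      using d m Re_\<Gamma>_pos[of t] by (intro mult_left_mono hat_decay \<phi> B) auto
    also have "\<dots> \<le> d ^ (n + k) * ((m - (- m)) * B * (c * X ^ n))"
      using d m B0 c(2)[of t] unfolding X_def by (intro mult_left_mono) auto
    finally have "(cmod (hat \<phi> (\<Gamma> t)) * X ^ k) * X ^ n \<le> (d ^ (n + k) * (2 * m * c) * B) * X ^ n"
      by (simp add: power_add mult_ac)
    then show "cmod (hat \<phi> (\<Gamma> t)) * (1 + \<bar>t\<bar>) ^ k \<le> d ^ (n + k) * (2 * m * c) * B"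
      using X by (simp add: X_def)
  qed
qed

lemma rapid_hat:
  assumes \<phi>: "\<phi> \<in> \<D>"
  shows "rapid (hat \<phi>)"
  unfolding rapid_def
proof (intro conjI allI)
  show "continuous_on UNIV (\<lambda>t. hat \<phi> (\<Gamma> t))"
    by (rule continuous_on_compose2[OF hat_continuous[OF \<phi>, of UNIV] continuous_\<Gamma>]) auto
  fix k
  obtain m where m: "m > 0" "supp \<phi> \<subseteq> {-m..m}" using test_fun_support[OF \<phi>] .
  from rapid_hat_bound[OF m(1)] obtain c N where cN: "\<And>B. \<forall>t. cmod (nth_vderiv N \<phi> t) \<le> B \<Longrightarrow>
    \<forall>t. cmod (hat \<phi> (\<Gamma> t)) * (1 + \<bar>t\<bar>) ^ k \<le> c * B"
    using \<phi> m(2) by blast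
  obtain B where "\<And>t. cmod (nth_vderiv N \<phi> t) \<le> B"
    using test_fun_bounded[OF nth_vderiv_test_fun[OF \<phi>]] by blast
  then show "\<exists>N. \<forall>t. cmod (hat \<phi> (\<Gamma> t)) * (1 + \<bar>t\<bar>) ^ k \<le> N" using cN by blast
qed

lemma one_plus_square_le: "1 + t\<^sup>2 \<le> (1 + \<bar>t\<bar>)\<^sup>2" for t :: real
  by (simp add: power2_eq_square algebra_simps)

text \<open>
  Two orders of decay in excess of the growth of \<open>v\<close> yield an integrable majorant.
\<close>

lemma weight_decay:
  assumes N: "cmod z * (1 + \<bar>t\<bar>) ^ (n + 2) \<le> N" and v: "v \<le> c * (1 + \<bar>t\<bar>) ^ n" and c: "c \<ge> 0"
  shows "cmod z * v \<le> c * N / (1 + t\<^sup>2)"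
proof -
  have "cmod z * v * (1 + t\<^sup>2) \<le> cmod z * (c * (1 + \<bar>t\<bar>) ^ n) * (1 + t\<^sup>2)"
    using v by (intro mult_right_mono mult_left_mono) auto
  also have "\<dots> \<le> cmod z * (c * (1 + \<bar>t\<bar>) ^ n) * (1 + \<bar>t\<bar>)\<^sup>2"
    using one_plus_square_le c by (intro mult_left_mono) auto
  also have "\<dots> = c * (cmod z * (1 + \<bar>t\<bar>) ^ (n + 2))" by (simp add: power_add power2_eq_square mult_ac)
  also have "\<dots> \<le> c * N" using N c by (intro mult_left_mono)
  finally show ?thesis by (simp add: pos_le_divide_eq add_pos_nonneg)
qed

definition contour_int :: "(complex \<Rightarrow> complex) \<Rightarrow> complex" where
  "contour_int g = (LBINT t. d\<Gamma> t * g (\<Gamma> t))"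

lemma contour_int_integrand:
  assumes g: "continuous_on UNIV (\<lambda>t. g (\<Gamma> t))" and K: "\<And>t. cmod (g (\<Gamma> t)) \<le> K / (1 + t\<^sup>2)"
    and c: "\<And>t. cmod (d\<Gamma> t) \<le> c"
  shows "(\<lambda>t. d\<Gamma> t * g (\<Gamma> t)) \<in> borel_measurable borel"
    and "cmod (d\<Gamma> t * g (\<Gamma> t)) \<le> c * K / (1 + t\<^sup>2)"
    and "integrable lborel (\<lambda>t. d\<Gamma> t * g (\<Gamma> t))"
proof -
  show 1: "(\<lambda>t. d\<Gamma> t * g (\<Gamma> t)) \<in> borel_measurable borel"
    using borel_measurable_continuous_onI[OF g] by measurable
  have c0: "c \<ge> 0" using order_trans[OF norm_ge_zero c] .
  show 2: "cmod (d\<Gamma> t * g (\<Gamma> t)) \<le> c * K / (1 + t\<^sup>2)" for t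
    using mult_mono[OF c[of t] K[of t] c0 norm_ge_zero] by (simp add: norm_mult)
  show "integrable lborel (\<lambda>t. d\<Gamma> t * g (\<Gamma> t))"
    by (rule integrable_decay[OF 1 2])
qed

lemma rapid_decay:
  assumes "rapid g"
  obtains K where "\<And>t. cmod (g (\<Gamma> t)) \<le> K / (1 + t\<^sup>2)"
proof -
  obtain N where N: "\<And>t. cmod (g (\<Gamma> t)) * (1 + \<bar>t\<bar>) ^ (0 + 2) \<le> N"
    using assms unfolding rapid_def by blast
  from weight_decay[OF N, of 1 1] have "cmod (g (\<Gamma> t)) \<le> N / (1 + t\<^sup>2)" for t by simp
  then show thesis using that by blast
qed

lemma rapid_integrable:
  assumes "rapid g"
  shows "integrable lborel (\<lambda>t. d\<Gamma> t * g (\<Gamma> t))"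
proof -
  obtain K where K: "\<And>t. cmod (g (\<Gamma> t)) \<le> K / (1 + t\<^sup>2)" using rapid_decay[OF assms] by blast
  obtain c where c: "\<And>t. cmod (d\<Gamma> t) \<le> c" using d\<Gamma>_bounded by blast
  have "continuous_on UNIV (\<lambda>t. g (\<Gamma> t))" using assms by (simp add: rapid_def)
  then show ?thesis by (rule contour_int_integrand(3)[OF _ K c])
qed

lemma contour_int_truncation:
  assumes g: "continuous_on UNIV (\<lambda>t. g (\<Gamma> t))" and K: "\<And>t. cmod (g (\<Gamma> t)) \<le> K / (1 + t\<^sup>2)"
  shows "(\<lambda>n. integral {- real n..real n} (\<lambda>t. d\<Gamma> t * g (\<Gamma> t))) \<longlonglongrightarrow> contour_int g"
proof -
  obtain c where c: "\<And>t. cmod (d\<Gamma> t) \<le> c" using d\<Gamma>_bounded by blast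
  have "(\<lambda>n. integral {- real n..real n} (\<lambda>t. d\<Gamma> t * g (\<Gamma> t)) - contour_int g) \<longlonglongrightarrow> 0"
    by (rule Lim_null_comparison[OF _ arctan_tail_tendsto_0[of "c * K"]])
      (use integral_decay_tail[OF contour_int_integrand(1,2)[OF g K c]] in \<open>auto simp: contour_int_def\<close>)
  then show ?thesis by (simp add: LIM_zero_iff)
qed

lemma contour_FTC:
  assumes P: "\<And>t. (P has_field_derivative g (\<Gamma> t + s)) (at (\<Gamma> t + s))" and "R \<ge> 0"
  shows "((\<lambda>t. d\<Gamma> t * g (\<Gamma> t + s)) has_integral (P (\<Gamma> R + s) - P (\<Gamma> (- R) + s))) {- R..R}"
proof (rule fundamental_theorem_of_calculus_interior_strong[where S = "{T, - T}"])
  fix t assume t: "t \<in> {- R<..<R} - {T, - T}"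
  have "((\<lambda>t. \<Gamma> t + s) has_vector_derivative d\<Gamma> t) (at t)"
    using \<Gamma>_deriv[of t] t by (auto intro!: derivative_eq_intros)
  from field_vector_diff_chain_at[OF this P]
  show "((\<lambda>t. P (\<Gamma> t + s)) has_vector_derivative d\<Gamma> t * g (\<Gamma> t + s)) (at t)" by (simp add: o_def)
next
  have "isCont P (\<Gamma> t + s)" for t using P DERIV_isCont by blast
  then have "continuous_on (range (\<lambda>t. \<Gamma> t + s)) P"
    by (intro continuous_at_imp_continuous_on) auto
  moreover have "continuous_on {- R..R} (\<lambda>t. \<Gamma> t + s)"
    by (intro continuous_intros continuous_\<Gamma>)
  ultimately show "continuous_on {- R..R} (\<lambda>t. P (\<Gamma> t + s))"
    by (rule continuous_on_compose2) auto
qed (use assms in auto)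

end

context exp_contour
begin

section \<open>Cauchy's theorem\<close>

text \<open>
  Multiplying the imaginary part by \<open>exp (- a * Re z)\<close> maps the region onto a convex half strip.
\<close>

lemma simply_connected_\<Omega>: "simply_connected \<Omega>"
proof -
  define S where "S = {z. b < Re z} \<inter> ({z. Im z < 1} \<inter> {z. Im z > - 1})"
  define h where "h z = Complex (Re z) (Im z * exp (- (a * Re z)))" for z
  define k where "k z = Complex (Re z) (Im z * exp (a * Re z))" for z
  have ex: "\<bar>x * exp (- y)\<bar> < 1 \<longleftrightarrow> \<bar>x\<bar> < exp y" for x y :: real
    by (simp add: abs_mult exp_minus field_simps)
  have "homeomorphism S \<Omega> k h"
    unfolding homeomorphism_def
  proof (intro conjI)
    show "continuous_on S k" "continuous_on \<Omega> h"
      unfolding h_def k_def Complex_eq by (intro continuous_intros)+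
    show kh: "\<forall>z\<in>\<Omega>. k (h z) = z" and hk: "\<forall>z\<in>S. h (k z) = z"
      by (auto simp: h_def k_def complex_eq_iff exp_minus)
    have kS: "k z \<in> \<Omega>" if "z \<in> S" for z
    proof -
      have "\<bar>Im z\<bar> < 1" using that by (auto simp: S_def)
      then have "\<bar>Im z\<bar> * exp (a * Re z) < 1 * exp (a * Re z)" by (intro mult_strict_right_mono) auto
      then show ?thesis using that by (simp add: k_def S_def Omega_region_eq[OF a_pos] abs_mult)
    qed
    have hS: "h z \<in> S" if "z \<in> \<Omega>" for z
    proof -
      have "\<bar>Im z * exp (- (a * Re z))\<bar> < 1" using that by (simp add: ex Omega_region_eq[OF a_pos])
      then show ?thesis using that by (auto simp: h_def S_def Omega_region_eq[OF a_pos])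
    qed
    show "k ` S = \<Omega>" using kS hS kh by force
    show "h ` \<Omega> = S" using kS hS hk by force
  qed
  moreover have "simply_connected S"
    unfolding S_def
    by (intro convex_imp_simply_connected convex_Int convex_halfspace_Re_gt convex_halfspace_Im_lt
        convex_halfspace_Im_gt)
  ultimately show ?thesis
    using homeomorphic_simply_connected homeomorphic_def by blast
qed

text \<open>
  The factor \<open>1 / Re z\<close> makes integrals along vertical lines tend to 0 as the line moves to the right,
  and \<open>1 / (1 + (Im z)\<^sup>2)\<close> is an integrable majorant along the contour.
\<close>

lemma cube_decay:
  assumes "z \<in> E" "K \<ge> 0"
  shows "K / cmod z ^ 3 \<le> (1 + 1 / b\<^sup>2) * K / Re z / (1 + (Im z)\<^sup>2)"
proof -
  define c where "c = 1 + 1 / b\<^sup>2"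
  have c: "c > 0" by (simp add: c_def add_pos_nonneg)
  have z: "Re z \<ge> b" "Re z > 0" "cmod z > 0" using E_Re[OF assms(1)] E_norm[OF assms(1)] b_pos by auto
  have sq: "(cmod z)\<^sup>2 = (Re z)\<^sup>2 + (Im z)\<^sup>2" by (simp add: cmod_power2)
  have "1 * b\<^sup>2 \<le> (Re z)\<^sup>2" using z b_pos by (simp add: power_mono)
  then have "1 \<le> (Re z)\<^sup>2 / b\<^sup>2" using b_pos by (simp add: pos_le_divide_eq)
  then have "1 + (Im z)\<^sup>2 \<le> (Re z)\<^sup>2 / b\<^sup>2 + (Im z)\<^sup>2 / b\<^sup>2 + ((Re z)\<^sup>2 + (Im z)\<^sup>2)"
    using zero_le_power2[of "Re z"] divide_nonneg_nonneg[OF zero_le_power2[of "Im z"] zero_le_power2[of b]]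
    by linarith
  also have "\<dots> = c * (cmod z)\<^sup>2" by (simp add: c_def sq algebra_simps add_divide_distrib)
  finally have "Re z * (1 + (Im z)\<^sup>2) \<le> cmod z * (c * (cmod z)\<^sup>2)"
    using z complex_Re_le_cmod[of z] by (intro mult_mono) auto
  then have le: "Re z * (1 + (Im z)\<^sup>2) \<le> c * cmod z ^ 3" by (simp add: power3_eq_cube power2_eq_square mult_ac)
  have "K / cmod z ^ 3 = c * K / (c * cmod z ^ 3)" using c by simp
  also have "\<dots> \<le> c * K / (Re z * (1 + (Im z)\<^sup>2))"
    using le c z assms(2) by (intro divide_left_mono mult_pos_pos) (auto simp: add_pos_nonneg)
  finally show ?thesis by (simp add: c_def)
qed

text \<open>
  The part of the contour between the heights \<open>- R\<close> and \<open>R\<close> has the same end points as the vertical segment at real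
  part \<open>ln R / a\<close>. As \<open>g\<close> has a primitive on the simply connected region, both integrals agree, and the
  one over the segment tends to 0. The primitive exists only in the open region, so the contour is first
  moved to the right by \<open>s > 0\<close>; dominated convergence then allows \<open>s\<close> to tend to 0.
\<close>

theorem contour_int_eq_zero:
  assumes hol: "g holomorphic_on \<Omega>" and cont: "\<And>t. continuous (at (\<Gamma> t) within E) g"
    and K: "\<And>z. z \<in> E \<Longrightarrow> cmod (g z) \<le> K / cmod z ^ 3" and K0: "K \<ge> 0"
  shows "contour_int g = 0"
proof -
  define c where "c = (1 + 1 / b\<^sup>2) * K"
  have c0: "c \<ge> 0" using K0 by (simp add: c_def)
  have gz: "cmod (g z) \<le> c / Re z / (1 + (Im z)\<^sup>2)" if "z \<in> E" for z
    using order_trans[OF K[OF that] cube_decay[OF that K0]] by (simp add: c_def)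
  have gb: "cmod (g z) \<le> c / b / (1 + (Im z)\<^sup>2)" if "z \<in> E" for z
  proof -
    have "c / Re z \<le> c / b" using E_Re[OF that] b_pos c0 by (intro divide_left_mono) auto
    then have "c / Re z / (1 + (Im z)\<^sup>2) \<le> c / b / (1 + (Im z)\<^sup>2)" by (intro divide_right_mono) auto
    then show ?thesis using gz[OF that] by linarith
  qed
  obtain P where P: "\<And>z. z \<in> \<Omega> \<Longrightarrow> (P has_field_derivative g z) (at z)"
    using simply_connected_\<Omega> hol simply_connected_eq_global_primitive[OF open_\<Omega>] by blast
  have gcont: "continuous_on \<Omega> g" using hol by (rule holomorphic_on_imp_continuous_on)
  have shifted: "(LBINT t. d\<Gamma> t * g (\<Gamma> t + complex_of_real s)) = 0" if s: "s > 0" for s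
  proof -
    have in\<Omega>: "\<Gamma> t + complex_of_real s \<in> \<Omega>" for t using E_shift[OF \<Gamma>_in_E s] .
    have cg: "continuous_on UNIV (\<lambda>t. g (\<Gamma> t + complex_of_real s))"
      by (rule continuous_on_compose2[OF gcont]) (use in\<Omega> in \<open>auto intro!: continuous_intros continuous_\<Gamma>\<close>)
    have bd: "cmod (g (\<Gamma> t + complex_of_real s)) \<le> c / b / (1 + t\<^sup>2)" for t
      using gb[of "\<Gamma> t + complex_of_real s"] in\<Omega>[of t] \<Omega>_subset_E by auto
    have lim: "(\<lambda>n. integral {- real n..real n} (\<lambda>t. d\<Gamma> t * g (\<Gamma> t + complex_of_real s)))
        \<longlonglongrightarrow> (LBINT t. d\<Gamma> t * g (\<Gamma> t + complex_of_real s))"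
      using contour_int_truncation[of "\<lambda>z. g (z + complex_of_real s)", OF cg bd] by (simp add: contour_int_def)
    have small: "cmod (integral {- real n..real n} (\<lambda>t. d\<Gamma> t * g (\<Gamma> t + complex_of_real s)))
        \<le> c * pi / (s + 1 / a * ln (real n))" if n: "real n > T" for n
    proof -
      define R where "R = real n"
      have R: "R > T" "R > 0" using n T_gt_1 by (auto simp: R_def)
      define x where "x = ln R / a + s"
      have lnR: "ln R / a > b"
      proof -
        have "a * b < ln R" using R ln_less_cancel_iff[of T R] T_gt_1 by (simp add: T_def)
        then show ?thesis using a_pos by (simp add: pos_less_divide_eq mult.commute)
      qed
      have ends: "\<Gamma> R + complex_of_real s = Complex x R" "\<Gamma> (- R) + complex_of_real s = Complex x (- R)"
        using R by (auto simp: complex_eq_iff Re_\<Gamma> x_def max_def)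
      have vert: "Complex x t \<in> \<Omega>" if "t \<in> {- R..R}" for t
      proof -
        have "\<bar>t\<bar> \<le> exp (a * (ln R / a))" using that R a_pos by auto
        also have "\<dots> < exp (a * x)" using s a_pos by (simp add: x_def distrib_left)
        finally show ?thesis using lnR s by (simp add: Omega_region_eq[OF a_pos] x_def)
      qed
      have x0: "x > 0" using lnR s b_pos by (simp add: x_def)
      have int1: "((\<lambda>t. d\<Gamma> t * g (\<Gamma> t + complex_of_real s)) has_integral (P (Complex x R) - P (Complex x (- R)))) {- R..R}"
        using contour_FTC[of P g "complex_of_real s" R] P in\<Omega> R by (simp add: ends)
      have int2: "((\<lambda>t. \<i> * g (Complex x t)) has_integral (P (Complex x R) - P (Complex x (- R)))) {- R..R}"
      proof (rule fundamental_theorem_of_calculus)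
        fix t assume t: "t \<in> {- R..R}"
        have "((\<lambda>t. Complex x t) has_vector_derivative \<i>) (at t)"
          unfolding Complex_eq by (auto intro!: derivative_eq_intros has_vector_derivative_real_field)
        from field_vector_diff_chain_at[OF this P[OF vert[OF t]]]
        show "((\<lambda>t. P (Complex x t)) has_vector_derivative \<i> * g (Complex x t)) (at t within {- R..R})"
          by (simp add: o_def has_vector_derivative_at_within)
      qed (use R in auto)
      have int3: "((\<lambda>t. c / x * (1 / (1 + t\<^sup>2))) has_integral (c / x * (arctan R - arctan (- R)))) {- R..R}"
        using R by (intro has_integral_mult_right fundamental_theorem_of_calculus)
          (auto intro!: derivative_eq_intros simp: has_real_derivative_iff_has_vector_derivative[symmetric]
            inverse_eq_divide)
      have "cmod (integral {- R..R} (\<lambda>t. \<i> * g (Complex x t))) \<le> integral {- R..R} (\<lambda>t. c / x * (1 / (1 + t\<^sup>2)))"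
      proof (rule Henstock_Kurzweil_Integration.integral_norm_bound_integral)
        fix t assume "t \<in> {- R..R}"
        then have "cmod (g (Complex x t)) \<le> c / x / (1 + t\<^sup>2)" using gz[of "Complex x t"] vert \<Omega>_subset_E by auto
        then show "cmod (\<i> * g (Complex x t)) \<le> c / x * (1 / (1 + t\<^sup>2))" by (simp add: norm_mult)
      qed (use int2 int3 has_integral_integrable in blast)+
      then have "cmod (P (Complex x R) - P (Complex x (- R))) \<le> c / x * (arctan R - arctan (- R))"
        using integral_unique[OF int2] integral_unique[OF int3] by simp
      also have "\<dots> \<le> c / x * pi"
        using arctan_ubound[of R] x0 c0 by (intro mult_left_mono) (auto simp: arctan_minus)
      finally show ?thesis using int1 by (simp add: integral_unique R_def x_def add.commute)
    qed
    have "filterlim (\<lambda>n. s + 1 / a * ln (real n)) at_top sequentially"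
      using a_pos
      by (intro filterlim_tendsto_add_at_top[OF tendsto_const] filterlim_tendsto_pos_mult_at_top[OF tendsto_const]
          filterlim_compose[OF ln_at_top filterlim_real_sequentially]) auto
    then have z: "(\<lambda>n. c * pi / (s + 1 / a * ln (real n))) \<longlonglongrightarrow> 0"
      by (intro tendsto_divide_0[OF tendsto_const] filterlim_at_top_imp_at_infinity)
    have "\<forall>\<^sub>F n in sequentially. real n > T"
      using filterlim_real_sequentially by (simp add: filterlim_at_top_dense)
    then have "\<forall>\<^sub>F n in sequentially. cmod (integral {- real n..real n} (\<lambda>t. d\<Gamma> t * g (\<Gamma> t + complex_of_real s)))
        \<le> c * pi / (s + 1 / a * ln (real n))" by eventually_elim (rule small)
    from Lim_null_comparison[OF this z] lim show ?thesis by (rule LIMSEQ_unique[rotated])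
  qed
  obtain d where d: "d > 0" "\<And>t. cmod (d\<Gamma> t) \<le> d" using d\<Gamma>_bounded by blast
  have gmeas: "(\<lambda>t. g (\<Gamma> t + complex_of_real s)) \<in> borel_measurable borel" if "s > 0" for s
    by (intro borel_measurable_continuous_onI continuous_on_compose2[OF gcont])
      (use E_shift[OF \<Gamma>_in_E that] in \<open>auto intro!: continuous_intros continuous_\<Gamma>\<close>)
  have ptw: "(\<lambda>n. g (\<Gamma> t + complex_of_real (1 / Suc n))) \<longlonglongrightarrow> g (\<Gamma> t)" for t
  proof -
    have "(\<lambda>n. \<Gamma> t + complex_of_real (1 / Suc n)) \<longlonglongrightarrow> \<Gamma> t + complex_of_real 0"
      by (intro tendsto_intros LIMSEQ_Suc[OF lim_1_over_n])
    moreover have "\<Gamma> t + complex_of_real (1 / Suc n) \<in> E" for n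
      using E_shift[OF \<Gamma>_in_E, of "1 / Suc n" t] \<Omega>_subset_E by auto
    ultimately show ?thesis
      using cont[of t] by (auto simp: continuous_within_sequentially comp_def)
  qed
  have "(\<lambda>n. (LBINT t. d\<Gamma> t * g (\<Gamma> t + complex_of_real (1 / Suc n)))) \<longlonglongrightarrow> (LBINT t. d\<Gamma> t * g (\<Gamma> t))"
  proof (rule integral_dominated_convergence)
    show "integrable lborel (\<lambda>t::real. d * (c / b) * (1 / (1 + t\<^sup>2)))"
      by (intro integrable_mult_right integrable_inverse_1_plus_square_real)
    show "AE t in lborel. (\<lambda>n. d\<Gamma> t * g (\<Gamma> t + complex_of_real (1 / Suc n))) \<longlonglongrightarrow> d\<Gamma> t * g (\<Gamma> t)"
      using ptw by (intro AE_I2 tendsto_intros)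
    show "AE t in lborel. norm (d\<Gamma> t * g (\<Gamma> t + complex_of_real (1 / Suc n))) \<le> d * (c / b) * (1 / (1 + t\<^sup>2))" for n
    proof (intro AE_I2)
      fix t
      have "cmod (g (\<Gamma> t + complex_of_real (1 / Suc n))) \<le> c / b / (1 + t\<^sup>2)"
        using gb[of "\<Gamma> t + complex_of_real (1 / Suc n)"] E_shift[OF \<Gamma>_in_E, of "1 / Suc n" t] \<Omega>_subset_E by auto
      then show "norm (d\<Gamma> t * g (\<Gamma> t + complex_of_real (1 / Suc n))) \<le> d * (c / b) * (1 / (1 + t\<^sup>2))"
        using mult_mono[OF d(2)[of t]] d by (fastforce simp: norm_mult)
    qed
    show "(\<lambda>t. d\<Gamma> t * g (\<Gamma> t + complex_of_real (1 / Suc n))) \<in> borel_measurable lborel" for n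
      using gmeas[of "1 / Suc n"] by measurable
    have "(\<lambda>t. g (\<Gamma> t)) \<in> borel_measurable borel"
      by (rule borel_measurable_LIMSEQ_metric[OF gmeas ptw]) auto
    then show "(\<lambda>t. d\<Gamma> t * g (\<Gamma> t)) \<in> borel_measurable lborel" by measurable
  qed
  moreover have "(LBINT t. d\<Gamma> t * g (\<Gamma> t + complex_of_real (1 / Suc n))) = 0" for n
    by (rule shifted) simp
  ultimately have "(\<lambda>n. 0) \<longlonglongrightarrow> (LBINT t. d\<Gamma> t * g (\<Gamma> t))" by (simp only:)
  then show ?thesis by (simp add: contour_int_def LIMSEQ_const_iff)
qed

end

section \<open>The inversion formula\<close>

lemma Fourier_kernel_integral:
  assumes "R > 0"
  shows "integral {- R..R} (\<lambda>\<xi>. exp (\<i> * of_real \<xi> * of_real t)) = complex_of_real (2 * R * sinc (R * t))"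
proof (cases "t = 0")
  case True
  then show ?thesis using assms by (simp add: scaleR_conv_of_real)
next
  case False
  have "((\<lambda>\<xi>. exp (\<i> * of_real \<xi> * of_real t)) has_integral
      (exp (\<i> * of_real R * of_real t) / (\<i> * of_real t) - exp (\<i> * of_real (- R) * of_real t) / (\<i> * of_real t))) {- R..R}"
    using assms False
    by (intro fundamental_theorem_of_calculus)
      (auto intro!: derivative_eq_intros has_vector_derivative_real_field)
  moreover have "exp (\<i> * of_real R * of_real t) - exp (\<i> * of_real (- R) * of_real t) = 2 * \<i> * of_real (sin (R * t))"
    by (simp add: complex_eq_iff Re_exp Im_exp)
  ultimately have "integral {- R..R} (\<lambda>\<xi>. exp (\<i> * of_real \<xi> * of_real t)) = 2 * \<i> * of_real (sin (R * t)) / (\<i> * of_real t)"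
    by (simp add: integral_unique diff_divide_distrib[symmetric])
  then show ?thesis using False assms by simp
qed


lemma Si_zero: "Si 0 = 0"
  using Si_neg[of 0] by simp

lemma Si_scaled_limit: "(\<lambda>n. Si (real n * t)) \<longlonglongrightarrow> pi / 2 * sgn t"
proof -
  have pos: "(\<lambda>n. Si (real n * t)) \<longlonglongrightarrow> pi / 2" if "t > 0" for t
  proof (rule filterlim_compose[OF Si_at_top])
    show "filterlim (\<lambda>n. real n * t) at_top sequentially"
      using filterlim_tendsto_pos_mult_at_top[OF tendsto_const that filterlim_real_sequentially]
      by (simp add: mult.commute)
  qed
  consider "t > 0" | "t = 0" | "t < 0" by linarith
  then show ?thesis
  proof cases
    case 3
    have "Si (real n * t) = - Si (real n * (- t))" for n
      using Si_neg[of "real n * (- t)"] 3 by (simp add: mult_nonneg_nonpos)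
    moreover have "(\<lambda>n. - Si (real n * (- t))) \<longlonglongrightarrow> - (pi / 2)" using 3 by (intro tendsto_minus pos) auto
    ultimately show ?thesis using 3 by simp
  qed (use pos in \<open>auto simp: Si_zero\<close>)
qed

lemma continuous_Si: "continuous_on S Si"
  using isCont_Si by (simp add: continuous_at_imp_continuous_on)

text \<open>
  Interchanging the integrals produces the Dirichlet kernel \<open>sin (R * t) / t\<close>, the derivative of
  \<open>Si (R * t)\<close>. After an integration by parts dominated convergence applies, since \<open>Si\<close> is bounded with
  limits \<open>pi / 2\<close> and \<open>- pi / 2\<close>.
\<close>

theorem Fourier_inversion_at_0:
  assumes \<phi>: "\<phi> \<in> \<D>"
  shows "(\<lambda>n. integral {- real n..real n} (\<lambda>\<xi>. hat \<phi> (\<i> * of_real \<xi>))) \<longlonglongrightarrow> \<phi> 0"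
proof -
  obtain m where m: "m > 0" "supp \<phi> \<subseteq> {-m..m}" using test_fun_support[OF \<phi>] .
  define M where "M = m + 1"
  have M: "M > 0" "supp \<phi> \<subseteq> {-M..M}" using m by (auto simp: M_def)
  have z: "\<phi> M = 0" "\<phi> (- M) = 0" using m by (auto intro!: test_fun_zero simp: M_def)
  have vdc: "continuous_on S (vd \<phi>)" for S by (intro test_fun_continuous vd_test_fun \<phi>)
  have Sic: "continuous_on S (\<lambda>t. complex_of_real (Si (R * t)))" for S R
    by (intro continuous_intros continuous_on_compose2[OF continuous_Si[of UNIV]]) auto
  have eq: "integral {- R..R} (\<lambda>\<xi>. hat \<phi> (\<i> * of_real \<xi>))
      = - of_real (1 / pi) * integral {- M..M} (\<lambda>t. vd \<phi> t * of_real (Si (R * t)))" if R: "R > 0" for R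
  proof -
    let ?S = "\<lambda>t. complex_of_real (R * sinc (R * t))"
    have "integral {- R..R} (\<lambda>\<xi>. hat \<phi> (\<i> * of_real \<xi>))
        = of_real (1 / (2 * pi)) * integral {- R..R} (\<lambda>\<xi>. integral {- M..M} (\<lambda>t. exp (\<i> * of_real \<xi> * of_real t) * \<phi> t))"
      unfolding hat_eq_integral[OF \<phi> M(2)] by simp
    also have "integral {- R..R} (\<lambda>\<xi>. integral {- M..M} (\<lambda>t. exp (\<i> * of_real \<xi> * of_real t) * \<phi> t))
        = integral {- M..M} (\<lambda>t. integral {- R..R} (\<lambda>\<xi>. exp (\<i> * of_real \<xi> * of_real t) * \<phi> t))"
    proof -
      have "continuous_on (cbox (- R, - M) (R, M)) (\<lambda>x. \<phi> (snd x))"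
        by (rule continuous_on_compose2[OF test_fun_continuous[OF \<phi>, of UNIV]]) (auto intro: continuous_intros)
      then have "continuous_on (cbox (- R, - M) (R, M)) (\<lambda>(\<xi>, t). exp (\<i> * of_real \<xi> * of_real t) * \<phi> t)"
        unfolding case_prod_unfold by (intro continuous_intros) auto
      from integral_swap_continuous[OF this] show ?thesis by (simp add: box_real)
    qed
    also have "\<dots> = integral {- M..M} (\<lambda>t. 2 * (?S t * \<phi> t))"
    proof (intro arg_cong[where f = "integral {- M..M}"] ext)
      fix t
      have "integral {- R..R} (\<lambda>\<xi>. exp (\<i> * of_real \<xi> * of_real t) * \<phi> t) = of_real (2 * R * sinc (R * t)) * \<phi> t"
        unfolding Fourier_kernel_integral[OF R, symmetric] by (rule integral_mult_left)
      then show "integral {- R..R} (\<lambda>\<xi>. exp (\<i> * of_real \<xi> * of_real t) * \<phi> t) = 2 * (?S t * \<phi> t)"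
        by (simp only: of_real_mult of_real_numeral mult.assoc)
    qed
    also have "\<dots> = 2 * integral {- M..M} (\<lambda>t. ?S t * \<phi> t)" by simp
    also have "integral {- M..M} (\<lambda>t. ?S t * \<phi> t) = - integral {- M..M} (\<lambda>t. vd \<phi> t * of_real (Si (R * t)))"
    proof -
      have d: "((\<lambda>t. complex_of_real (Si (R * t))) has_vector_derivative ?S t) (at t)" for t
      proof (rule has_vector_derivative_of_real)
        have "((\<lambda>t. R * t) has_real_derivative R) (at t)" by (auto intro!: derivative_eq_intros)
        from DERIV_chain2[OF DERIV_Si this]
        show "((\<lambda>t. Si (R * t)) has_real_derivative R * sinc (R * t)) (at t)" by (simp add: mult.commute)
      qed
      have "((\<lambda>t. \<phi> t * ?S t + vd \<phi> t * of_real (Si (R * t))) has_integral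
          (\<phi> M * of_real (Si (R * M)) - \<phi> (- M) * of_real (Si (R * (- M))))) {- M..M}"
        using M
        by (intro fundamental_theorem_of_calculus has_vector_derivative_at_within[OF has_vector_derivative_mult]
            test_fun_has_derivative[OF \<phi>] d) auto
      then have "integral {- M..M} (\<lambda>t. \<phi> t * ?S t + vd \<phi> t * of_real (Si (R * t))) = 0"
        using z by (simp add: integral_unique)
      moreover have "(\<lambda>t. vd \<phi> t * of_real (Si (R * t))) integrable_on {- M..M}"
        by (intro integrable_continuous_real continuous_intros vdc Sic)
      moreover have "(\<lambda>t. \<phi> t * ?S t) integrable_on {- M..M}"
        by (intro integrable_continuous_real continuous_on_mult test_fun_continuous[OF \<phi>] continuous_on_of_real
            continuous_on_const continuous_on_sinc continuous_on_id)
      ultimately have "integral {- M..M} (\<lambda>t. \<phi> t * ?S t) + integral {- M..M} (\<lambda>t. vd \<phi> t * of_real (Si (R * t))) = 0"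
        by (simp only: integral_add)
      then show ?thesis by (simp only: mult.commute[of "?S _"] eq_neg_iff_add_eq_0)
    qed
    finally show ?thesis by simp
  qed
  obtain B where B: "B \<ge> 0" "\<And>t. cmod (vd \<phi> t) \<le> B" using test_fun_bounded[OF vd_test_fun[OF \<phi>]] by blast
  obtain C where C: "\<And>t. \<bar>Si t\<bar> \<le> C" using bounded_Si by blast
  have lim: "(\<lambda>n. integral {l..r} (\<lambda>t. vd \<phi> t * of_real (Si (real n * t))))
      \<longlonglongrightarrow> integral {l..r} (\<lambda>t. vd \<phi> t * of_real (pi / 2 * sgn t))" for l r
  proof (rule dominated_convergence(2))
    show "(\<lambda>t. vd \<phi> t * of_real (Si (real n * t))) integrable_on {l..r}" for n
      by (intro integrable_continuous_real continuous_intros vdc Sic)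
    show "(\<lambda>t. B * C) integrable_on {l..r}" by (rule integrable_const_ivl)
    show "norm (vd \<phi> t * of_real (Si (real n * t))) \<le> B * C" for n t
      unfolding norm_mult using B C by (intro mult_mono) auto
    show "(\<lambda>n. vd \<phi> t * of_real (Si (real n * t))) \<longlonglongrightarrow> vd \<phi> t * of_real (pi / 2 * sgn t)" for t
      by (intro tendsto_intros Si_scaled_limit)
  qed
  have right: "integral {0..M} (\<lambda>t. vd \<phi> t * of_real (pi / 2 * sgn t)) = - of_real (pi / 2) * \<phi> 0"
  proof -
    have "((\<lambda>t. vd \<phi> t * of_real (pi / 2 * sgn t)) has_integral (\<phi> M * of_real (pi / 2) - \<phi> 0 * of_real (pi / 2))) {0..M}"
    proof (rule fundamental_theorem_of_calculus_interior)
      fix t assume t: "t \<in> {0<..<M}"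
      have "((\<lambda>t. \<phi> t * of_real (pi / 2)) has_vector_derivative vd \<phi> t * of_real (pi / 2)) (at t)"
        by (intro has_vector_derivative_mult_left test_fun_has_derivative \<phi>)
      then show "((\<lambda>t. \<phi> t * of_real (pi / 2)) has_vector_derivative vd \<phi> t * of_real (pi / 2 * sgn t)) (at t)"
        using t by simp
    next
      show "continuous_on {0..M} (\<lambda>t. \<phi> t * of_real (pi / 2))"
        by (intro continuous_on_mult continuous_on_const test_fun_continuous \<phi>)
    qed (use M in auto)
    from trans[OF integral_unique[OF this]] show ?thesis by (simp add: z)
  qed
  have left: "integral {- M..0} (\<lambda>t. vd \<phi> t * of_real (pi / 2 * sgn t)) = - of_real (pi / 2) * \<phi> 0"
  proof -
    have "((\<lambda>t. vd \<phi> t * of_real (pi / 2 * sgn t)) has_integral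
        (\<phi> 0 * - of_real (pi / 2) - \<phi> (- M) * - of_real (pi / 2))) {- M..0}"
    proof (rule fundamental_theorem_of_calculus_interior)
      fix t assume t: "t \<in> {- M<..<0}"
      have "((\<lambda>t. \<phi> t * - of_real (pi / 2)) has_vector_derivative vd \<phi> t * - of_real (pi / 2)) (at t)"
        by (intro has_vector_derivative_mult_left test_fun_has_derivative \<phi>)
      then show "((\<lambda>t. \<phi> t * - of_real (pi / 2)) has_vector_derivative vd \<phi> t * of_real (pi / 2 * sgn t)) (at t)"
        using t by simp
    next
      show "continuous_on {- M..0} (\<lambda>t. \<phi> t * - of_real (pi / 2))"
        by (intro continuous_on_mult continuous_on_const test_fun_continuous \<phi>)
    qed (use M in auto)
    from trans[OF integral_unique[OF this]] show ?thesis by (simp add: z)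
  qed
  have split: "integral {- M..M} (\<lambda>t. vd \<phi> t * of_real (Si (R * t))) =
      integral {- M..0} (\<lambda>t. vd \<phi> t * of_real (Si (R * t))) + integral {0..M} (\<lambda>t. vd \<phi> t * of_real (Si (R * t)))" for R
    using M
    by (intro Henstock_Kurzweil_Integration.integral_combine[symmetric] integrable_continuous_real continuous_intros vdc Sic) auto
  have "(\<lambda>n. - of_real (1 / pi) * integral {- M..M} (\<lambda>t. vd \<phi> t * of_real (Si (real n * t))))
      \<longlonglongrightarrow> - of_real (1 / pi) * (- of_real (pi / 2) * \<phi> 0 + - of_real (pi / 2) * \<phi> 0)"
    unfolding split
    by (intro tendsto_mult tendsto_const tendsto_add lim[of "- M" 0, unfolded left] lim[of 0 M, unfolded right])
  also have "- of_real (1 / pi) * (- of_real (pi / 2) * \<phi> 0 + - of_real (pi / 2) * \<phi> 0) = \<phi> 0"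
    by simp
  finally have *: "(\<lambda>n. - of_real (1 / pi) * integral {- M..M} (\<lambda>t. vd \<phi> t * of_real (Si (real n * t)))) \<longlonglongrightarrow> \<phi> 0" .
  have "\<forall>\<^sub>F n in sequentially. - of_real (1 / pi) * integral {- M..M} (\<lambda>t. vd \<phi> t * of_real (Si (real n * t)))
      = integral {- real n..real n} (\<lambda>\<xi>. hat \<phi> (\<i> * of_real \<xi>))"
    using eventually_gt_at_top[of 0] by eventually_elim (simp add: eq)
  from Lim_transform_eventually[OF * this] show ?thesis .
qed

context exp_contour
begin

text \<open>
  The transform is entire, so it has a primitive \<open>P\<close> on the plane, and the contour between the heights \<open>- R\<close> and
  \<open>R\<close> may be replaced by a segment of the imaginary axis and two horizontal segments. The latter have
  length of order at most \<open>R\<close> and their contribution vanishes in the limit by the decay of the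
  transform; on the axis the claim is Fourier inversion.
\<close>

theorem contour_int_hat:
  assumes \<phi>: "\<phi> \<in> \<D>"
  shows "contour_int (hat \<phi>) = \<i> * \<phi> 0"
proof -
  obtain m where m: "m > 0" "supp \<phi> \<subseteq> {-m..m}" using test_fun_support[OF \<phi>] .
  obtain c n where c: "c > 0" "\<And>t. exp (m * Re (\<Gamma> t)) \<le> c * (1 + \<bar>t\<bar>) ^ n" using exp_Re_\<Gamma>_growth[of m] by blast
  obtain d where d: "d > 0" "\<And>t. 1 + cmod (\<Gamma> t) \<le> d * (1 + \<bar>t\<bar>)" using norm_\<Gamma>_growth by blast
  obtain B where B: "B \<ge> 0" "\<And>t. cmod (nth_vderiv (n + 2) \<phi> t) \<le> B"
    using test_fun_bounded[OF nth_vderiv_test_fun[OF \<phi>]] by blast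
  obtain P where P': "\<And>z. z \<in> UNIV \<Longrightarrow> (P has_field_derivative hat \<phi> z) (at z within UNIV)"
    using holomorphic_convex_primitive'[OF convex_UNIV open_UNIV hat_holomorphic[OF \<phi>]] by blast
  have P: "(P has_field_derivative hat \<phi> z) (at z)" for z using P'[of z] by simp
  \<comment> \<open>The power of 2 comes from \<open>1 + \<bar>t\<bar> \<le> 2 * \<bar>t\<bar>\<close> for \<open>\<bar>t\<bar> \<ge> 1\<close>.\<close>
  define D where "D = 2 * m * B * (c * d * 2 ^ (n + 1))"
  have D0: "D \<ge> 0" using m B c d by (simp add: D_def)
  have horiz: "cmod (P (\<Gamma> t) - P (\<i> * of_real t)) \<le> D / \<bar>t\<bar>" if t: "\<bar>t\<bar> \<ge> 1" for t
  proof -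
    let ?S = "closed_segment (\<i> * of_real t) (\<Gamma> t)"
    have zS: "Im z = t" "0 \<le> Re z" "Re z \<le> Re (\<Gamma> t)" if z: "z \<in> ?S" for z
    proof -
      obtain u where u: "0 \<le> u" "u \<le> 1" "z = (1 - u) *\<^sub>R (\<i> * of_real t) + u *\<^sub>R \<Gamma> t"
        using z by (auto simp: closed_segment_def)
      show "Im z = t" by (simp add: u(3) algebra_simps)
      show "0 \<le> Re z" using u Re_\<Gamma>_pos[of t] by simp
      show "Re z \<le> Re (\<Gamma> t)" using u Re_\<Gamma>_pos[of t] mult_right_mono[of u 1 "Re (\<Gamma> t)"] by simp
    qed
    have bd: "cmod (hat \<phi> z) \<le> 2 * m * B * (c * (1 + \<bar>t\<bar>) ^ n) / \<bar>t\<bar> ^ (n + 2)" if z: "z \<in> ?S" for z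
    proof -
      have "\<bar>t\<bar> ^ (n + 2) * cmod (hat \<phi> z) \<le> cmod z ^ (n + 2) * cmod (hat \<phi> z)"
        using abs_Im_le_cmod[of z] zS(1)[OF z] by (intro mult_right_mono power_mono) auto
      also have "\<dots> \<le> (m - (- m)) * B * exp (m * Re z)"
        using m zS(2)[OF z] by (intro hat_decay[OF \<phi> m(2) _ B(2)]) auto
      also have "\<dots> \<le> (m - (- m)) * B * (c * (1 + \<bar>t\<bar>) ^ n)"
      proof (intro mult_left_mono)
        have "exp (m * Re z) \<le> exp (m * Re (\<Gamma> t))" using zS(3)[OF z] m by simp
        then show "exp (m * Re z) \<le> c * (1 + \<bar>t\<bar>) ^ n" using c(2)[of t] by linarith
      qed (use m B in auto)
      finally show ?thesis using t by (simp add: pos_le_divide_eq mult.commute)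
    qed
    have dist: "cmod (\<Gamma> t - \<i> * of_real t) \<le> d * (1 + \<bar>t\<bar>)"
    proof -
      have "\<Gamma> t - \<i> * of_real t = of_real (Re (\<Gamma> t))" by (simp add: complex_eq_iff)
      then have "cmod (\<Gamma> t - \<i> * of_real t) = Re (\<Gamma> t)" using Re_\<Gamma>_pos[of t] by simp
      then show ?thesis using d(2)[of t] complex_Re_le_cmod[of "\<Gamma> t"] by linarith
    qed
    have "cmod (P (\<Gamma> t) - P (\<i> * of_real t))
        \<le> 2 * m * B * (c * (1 + \<bar>t\<bar>) ^ n) / \<bar>t\<bar> ^ (n + 2) * cmod (\<Gamma> t - \<i> * of_real t)"
    proof (rule field_differentiable_bound[of ?S P "hat \<phi>"])
      show "(P has_field_derivative hat \<phi> z) (at z within ?S)" for z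
        by (rule has_field_derivative_at_within[OF P])
    qed (use bd in auto)
    also have "\<dots> \<le> 2 * m * B * (c * (1 + \<bar>t\<bar>) ^ n) / \<bar>t\<bar> ^ (n + 2) * (d * (1 + \<bar>t\<bar>))"
      using dist m B c t by (intro mult_left_mono) auto
    also have "2 * m * B * (c * (1 + \<bar>t\<bar>) ^ n) / \<bar>t\<bar> ^ (n + 2) * (d * (1 + \<bar>t\<bar>))
        = 2 * m * B * (c * d * (1 + \<bar>t\<bar>) ^ (n + 1)) / \<bar>t\<bar> ^ (n + 2)" by (simp add: mult_ac)
    also have "\<dots> \<le> 2 * m * B * (c * d * (2 * \<bar>t\<bar>) ^ (n + 1)) / \<bar>t\<bar> ^ (n + 2)"
      using t m B c d by (intro divide_right_mono mult_left_mono power_mono) auto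
    also have "\<dots> = D / \<bar>t\<bar>"
      using t by (simp add: D_def power_mult_distrib field_simps)
    finally show ?thesis .
  qed
  have trunc: "integral {- R..R} (\<lambda>t. d\<Gamma> t * hat \<phi> (\<Gamma> t)) = P (\<Gamma> R) - P (\<Gamma> (- R))" if "R \<ge> 0" for R
    using contour_FTC[of P "hat \<phi>" 0 R] P that by (simp add: integral_unique)
  have mid: "\<i> * integral {- R..R} (\<lambda>\<xi>. hat \<phi> (\<i> * of_real \<xi>)) = P (\<i> * of_real R) - P (\<i> * of_real (- R))" if "R \<ge> 0" for R
  proof -
    have "((\<lambda>\<xi>. \<i> * hat \<phi> (\<i> * of_real \<xi>)) has_integral (P (\<i> * of_real R) - P (\<i> * of_real (- R)))) {- R..R}"
    proof (rule fundamental_theorem_of_calculus)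
      fix t assume "t \<in> {- R..R}"
      have "((\<lambda>t. \<i> * of_real t) has_vector_derivative \<i>) (at t)"
        by (auto intro!: derivative_eq_intros has_vector_derivative_real_field)
      from field_vector_diff_chain_at[OF this P]
      show "((\<lambda>t. P (\<i> * of_real t)) has_vector_derivative \<i> * hat \<phi> (\<i> * of_real t)) (at t within {- R..R})"
        by (simp add: o_def has_vector_derivative_at_within)
    qed (use that in auto)
    from integral_unique[OF this] show ?thesis
      by (simp only: Henstock_Kurzweil_Integration.integral_mult_right)
  qed
  have "(\<lambda>k. integral {- real k..real k} (\<lambda>t. d\<Gamma> t * hat \<phi> (\<Gamma> t))
      - \<i> * integral {- real k..real k} (\<lambda>\<xi>. hat \<phi> (\<i> * of_real \<xi>))) \<longlonglongrightarrow> 0"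
  proof (rule Lim_null_comparison)
    show "\<forall>\<^sub>F k in sequentially. norm (integral {- real k..real k} (\<lambda>t. d\<Gamma> t * hat \<phi> (\<Gamma> t))
      - \<i> * integral {- real k..real k} (\<lambda>\<xi>. hat \<phi> (\<i> * of_real \<xi>))) \<le> 2 * D * (1 / real k)"
      using eventually_ge_at_top[of 1]
    proof eventually_elim
      case (elim k)
      have "norm ((P (\<Gamma> k) - P (\<i> * of_real k)) - (P (\<Gamma> (- real k)) - P (\<i> * of_real (- real k)))) \<le> D / k + D / k"
        using horiz[of "real k"] horiz[of "- real k"] elim
        by (intro order_trans[OF norm_triangle_ineq4 add_mono]) auto
      then have "norm ((P (\<Gamma> k) - P (\<Gamma> (- real k))) - (P (\<i> * of_real k) - P (\<i> * of_real (- real k)))) \<le> 2 * D * (1 / real k)"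
        by (simp add: algebra_simps)
      then show ?case unfolding trunc[OF of_nat_0_le_iff] mid[OF of_nat_0_le_iff] .
    qed
    show "(\<lambda>k. 2 * D * (1 / real k)) \<longlonglongrightarrow> 0"
      using tendsto_mult[OF tendsto_const lim_1_over_n] by simp
  qed
  moreover have "(\<lambda>k. \<i> * integral {- real k..real k} (\<lambda>\<xi>. hat \<phi> (\<i> * of_real \<xi>))) \<longlonglongrightarrow> \<i> * \<phi> 0"
    by (intro tendsto_intros Fourier_inversion_at_0 \<phi>)
  ultimately have "(\<lambda>k. integral {- real k..real k} (\<lambda>t. d\<Gamma> t * hat \<phi> (\<Gamma> t))) \<longlonglongrightarrow> 0 + \<i> * \<phi> 0"
    using tendsto_add by fastforce
  moreover obtain K where "\<And>t. cmod (hat \<phi> (\<Gamma> t)) \<le> K / (1 + t\<^sup>2)" using rapid_decay[OF rapid_hat[OF \<phi>]] by blast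
  then have "(\<lambda>k. integral {- real k..real k} (\<lambda>t. d\<Gamma> t * hat \<phi> (\<Gamma> t))) \<longlonglongrightarrow> contour_int (hat \<phi>)"
    using rapid_hat[OF \<phi>] by (intro contour_int_truncation) (auto simp: rapid_def)
  ultimately show ?thesis using LIMSEQ_unique by fastforce
qed

end

section \<open>The transform of the truncated convolution\<close>

text \<open>
  Up to the factor \<open>2 * pi\<close>, the transform of the restriction of \<open>\<omega>\<close> to \<open>{0..h}\<close>.
\<close>

definition half_hat :: "(real \<Rightarrow> complex) \<Rightarrow> real \<Rightarrow> complex \<Rightarrow> complex" where
  "half_hat \<omega> h \<mu> = integral {0..h} (\<lambda>r. \<omega> r * exp (\<mu> * complex_of_real r))"

text \<open>
  For fixed \<open>t\<close> let \<open>P\<close> be a primitive of \<open>s \<mapsto> \<phi> (t - s) * \<psi> s\<close>. The left-hand side is \<open>P t - P 0\<close>, and the two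
  integrals are \<open>P t - P (t - m)\<close> and \<open>P 0 - P (- m)\<close>. The points \<open>t - m\<close> and \<open>- m\<close> lie to the left of
  the supports of \<open>\<phi> (t - s)\<close> and \<open>\<psi> s\<close> respectively, where \<open>P\<close> is constant.
\<close>

lemma conv0_split:
  assumes \<phi>: "continuous_on UNIV \<phi>" and \<psi>: "continuous_on UNIV \<psi>" and m: "m > 0"
    and z: "\<And>x. \<bar>x\<bar> \<ge> m \<Longrightarrow> \<phi> x = 0" "\<And>x. \<bar>x\<bar> \<ge> m \<Longrightarrow> \<psi> x = 0"
  shows "(\<phi> *\<^sub>0 \<psi>) t =
    integral {0..m} (\<lambda>r. \<phi> r * \<psi> (t - r)) - integral {0..m} (\<lambda>r. \<psi> (- r) * \<phi> (t + r))"
proof -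
  define k where "k s = \<phi> (t - s) * \<psi> s" for s
  define c where "c = \<bar>t\<bar> + 2 * m"
  have kc: "continuous_on S k" for S
    unfolding k_def
    by (intro continuous_intros continuous_on_compose2[OF \<phi>] continuous_on_subset[OF \<psi>]) auto
  obtain P where P': "\<And>x. x \<in> {- c - 1..c + 1} \<Longrightarrow> (P has_vector_derivative k x) (at x within {- c - 1..c + 1})"
    using antiderivative_continuous[OF kc] by blast
  have P: "(P has_vector_derivative k x) (at x)" if "\<bar>x\<bar> \<le> c" for x
  proof -
    have "- c - 1 < x" "x < c + 1" using that by linarith+
    then show ?thesis using P'[of x] at_within_Icc_at[of "- c - 1" x "c + 1"] by simp
  qed
  have zero: "P x = P (- c)" if "- c \<le> x" "x \<le> c" "\<And>s. s \<in> {- c..x} \<Longrightarrow> k s = 0" for x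
  proof -
    have "(k has_integral (P x - P (- c))) {- c..x}"
    proof (rule fundamental_theorem_of_calculus)
      fix y assume "y \<in> {- c..x}"
      then have "\<bar>y\<bar> \<le> c" using that(2) by auto
      then show "(P has_vector_derivative k y) (at y within {- c..x})"
        by (rule has_vector_derivative_at_within[OF P])
    qed (use that in simp)
    moreover have "(k has_integral 0) {- c..x}" using that(3) by (rule has_integral_is_0)
    ultimately have "P x - P (- c) = 0" by (rule has_integral_unique)
    then show ?thesis by simp
  qed
  have 1: "P (t - m) = P (- c)"
    using m by (intro zero) (auto simp: c_def k_def intro!: z(1))
  have 2: "P (- m) = P (- c)"
    using m by (intro zero) (auto simp: c_def k_def intro!: z(2))
  have "(\<phi> *\<^sub>0 \<psi>) t = P t - P 0"
    unfolding conv0_def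
  proof (rule interval_integral_FTC_finite)
    show "continuous_on {min 0 t..max 0 t} (\<lambda>s. \<phi> (t - s) * \<psi> s)" using kc unfolding k_def .
    fix x assume "min 0 t \<le> x" "x \<le> max 0 t"
    then have "\<bar>x\<bar> \<le> c" using m by (auto simp: c_def)
    from has_vector_derivative_at_within[OF P[OF this]]
    show "(P has_vector_derivative \<phi> (t - x) * \<psi> x) (at x within {min 0 t..max 0 t})" by (simp add: k_def)
  qed
  moreover have "integral {0..m} (\<lambda>r. \<phi> r * \<psi> (t - r)) = P t - P (t - m)"
  proof -
    have "((\<lambda>r. \<phi> r * \<psi> (t - r)) has_integral (- P (t - m) - - P (t - 0))) {0..m}"
    proof (rule fundamental_theorem_of_calculus)
      fix r assume r: "r \<in> {0..m}"
      have "\<bar>t - r\<bar> \<le> c" using r by (auto simp: c_def)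
      moreover have "((\<lambda>r. t - r) has_vector_derivative - 1) (at r)" by (auto intro!: derivative_eq_intros)
      ultimately have "((P \<circ> (\<lambda>r. t - r)) has_vector_derivative - 1 *\<^sub>R k (t - r)) (at r)"
        by (intro vector_diff_chain_at P)
      from has_vector_derivative_minus[OF this]
      show "((\<lambda>r. - P (t - r)) has_vector_derivative \<phi> r * \<psi> (t - r)) (at r within {0..m})"
        by (simp add: o_def k_def has_vector_derivative_at_within)
    qed (use m in simp)
    then show ?thesis by (simp add: integral_unique)
  qed
  moreover have "integral {0..m} (\<lambda>r. \<psi> (- r) * \<phi> (t + r)) = P 0 - P (- m)"
  proof -
    have "((\<lambda>r. \<psi> (- r) * \<phi> (t + r)) has_integral (- P (- m) - - P (- 0))) {0..m}"
    proof (rule fundamental_theorem_of_calculus)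
      fix r assume r: "r \<in> {0..m}"
      have "\<bar>- r\<bar> \<le> c" using r by (auto simp: c_def)
      moreover have "((\<lambda>r. - r) has_vector_derivative - 1) (at r)" by (auto intro!: derivative_eq_intros)
      ultimately have "((P \<circ> (\<lambda>r. - r)) has_vector_derivative - 1 *\<^sub>R k (- r)) (at r)"
        by (intro vector_diff_chain_at P)
      from has_vector_derivative_minus[OF this]
      show "((\<lambda>r. - P (- r)) has_vector_derivative \<psi> (- r) * \<phi> (t + r)) (at r within {0..m})"
        by (simp add: o_def k_def has_vector_derivative_at_within mult.commute)
    qed (use m in simp)
    then show ?thesis by (simp add: integral_unique)
  qed
  ultimately show ?thesis using 1 2 by simp
qed

text \<open>
  The values 1 and -1 of \<open>e\<close> cover the two integrals in \<open>conv0_split\<close>.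
\<close>

lemma half_convolution:
  fixes e :: real
  assumes \<omega>: "continuous_on UNIV \<omega>" and \<psi>: "\<psi> \<in> \<D>" "supp \<psi> \<subseteq> {- m..m}" and m: "m > 0" and e: "\<bar>e\<bar> = 1"
  defines "A \<equiv> \<lambda>t. integral {0..m} (\<lambda>r. \<omega> r * \<psi> (t - e * r))"
  shows "continuous_on UNIV A" "\<And>t. \<bar>t\<bar> > 2 * m \<Longrightarrow> A t = 0"
    "complex_of_real (1 / (2 * pi)) * integral {- 2 * m..2 * m} (\<lambda>t. exp (\<mu> * of_real t) * A t)
      = half_hat \<omega> m (of_real e * \<mu>) * hat \<psi> \<mu>"
proof -
  have c1: "continuous_on S (\<lambda>x. \<omega> (snd x))" for S :: "(real \<times> real) set"
    by (rule continuous_on_compose2[OF \<omega>]) (auto intro: continuous_intros)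
  have c2: "continuous_on S (\<lambda>x. \<psi> (fst x - e * snd x))" for S
    by (rule continuous_on_compose2[OF test_fun_continuous[OF \<psi>(1), of UNIV]]) (auto intro!: continuous_intros)
  have "continuous_on (UNIV \<times> cbox 0 m) (\<lambda>(t, r). \<omega> r * \<psi> (t - e * r))"
    unfolding case_prod_unfold by (intro continuous_on_mult c1 c2)
  from integral_continuous_on_param[OF this] show "continuous_on UNIV A" by (simp add: A_def)
  have er: "\<bar>e * r\<bar> \<le> m" if "r \<in> {0..m}" for r using that e by (simp add: abs_mult)
  show "A t = 0" if t: "\<bar>t\<bar> > 2 * m" for t
  proof -
    have "((\<lambda>r. \<omega> r * \<psi> (t - e * r)) has_integral 0) {0..m}"
    proof (rule has_integral_is_0)
      fix r assume "r \<in> {0..m}"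
      then have "\<bar>t - e * r\<bar> > m" using er[of r] t by linarith
      then have "t - e * r \<notin> {- m..m}" by auto
      then have "t - e * r \<notin> supp \<psi>" using \<psi>(2) by blast
      then show "\<omega> r * \<psi> (t - e * r) = 0" using test_fun_zero by simp
    qed
    then show ?thesis by (simp add: A_def integral_unique)
  qed
  have "integral {- 2 * m..2 * m} (\<lambda>t. exp (\<mu> * of_real t) * A t)
      = integral {- 2 * m..2 * m} (\<lambda>t. integral {0..m} (\<lambda>r. exp (\<mu> * of_real t) * (\<omega> r * \<psi> (t - e * r))))"
    by (simp add: A_def)
  also have "\<dots> = integral {0..m} (\<lambda>r. integral {- 2 * m..2 * m} (\<lambda>t. exp (\<mu> * of_real t) * (\<omega> r * \<psi> (t - e * r))))"
  proof -
    have "continuous_on (cbox (- 2 * m, 0) (2 * m, m)) (\<lambda>(t, r). exp (\<mu> * of_real t) * (\<omega> r * \<psi> (t - e * r)))"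
      unfolding case_prod_unfold by (intro continuous_on_mult c1 c2 continuous_intros)
    from integral_swap_continuous[OF this] show ?thesis by (simp add: box_real)
  qed
  also have "\<dots> = integral {0..m} (\<lambda>r. of_real (2 * pi) * hat \<psi> \<mu> * (\<omega> r * exp (of_real e * \<mu> * of_real r)))"
  proof (rule integral_cong)
    fix r assume r: "r \<in> {0..m}"
    have "supp (shift (- (e * r)) \<psi>) \<subseteq> {- m - - (e * r)..m - - (e * r)}" by (rule shift_support[OF \<psi>(2)])
    also have "\<dots> \<subseteq> {- 2 * m..2 * m}" using er[OF r] by auto
    finally have s: "supp (shift (- (e * r)) \<psi>) \<subseteq> {- 2 * m..2 * m}" .
    have "integral {- 2 * m..2 * m} (\<lambda>t. exp (\<mu> * of_real t) * (\<omega> r * \<psi> (t - e * r)))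
        = integral {- 2 * m..2 * m} (\<lambda>t. \<omega> r * (exp (\<mu> * of_real t) * shift (- (e * r)) \<psi> t))"
      by (simp add: shift_def mult_ac)
    also have "\<dots> = \<omega> r * integral {- 2 * m..2 * m} (\<lambda>t. exp (\<mu> * of_real t) * shift (- (e * r)) \<psi> t)"
      by (rule Henstock_Kurzweil_Integration.integral_mult_right)
    also have "integral {- 2 * m..2 * m} (\<lambda>t. exp (\<mu> * of_real t) * shift (- (e * r)) \<psi> t)
        = of_real (2 * pi) * hat (shift (- (e * r)) \<psi>) \<mu>"
      unfolding hat_eq_integral[OF shift_test_fun[OF \<psi>(1)] s] by simp
    finally show "integral {- 2 * m..2 * m} (\<lambda>t. exp (\<mu> * of_real t) * (\<omega> r * \<psi> (t - e * r)))
        = of_real (2 * pi) * hat \<psi> \<mu> * (\<omega> r * exp (of_real e * \<mu> * of_real r))"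
      by (simp add: hat_shift mult_ac)
  qed
  also have "\<dots> = of_real (2 * pi) * hat \<psi> \<mu> * half_hat \<omega> m (of_real e * \<mu>)"
    unfolding half_hat_def by (rule Henstock_Kurzweil_Integration.integral_mult_right)
  finally show "complex_of_real (1 / (2 * pi)) * integral {- 2 * m..2 * m} (\<lambda>t. exp (\<mu> * of_real t) * A t)
      = half_hat \<omega> m (of_real e * \<mu>) * hat \<psi> \<mu>" by simp
qed

text \<open>
  With \<open>\<phi>\<^sub>+\<close> the restriction of \<open>\<phi>\<close> to the positive and \<open>\<psi>\<^sub>-\<close> that of \<open>\<psi>\<close> to the negative half line,
  \<open>\<phi> *\<^sub>0 \<psi>\<close> is the difference of the ordinary convolutions \<open>\<phi>\<^sub>+ * \<psi>\<close> and \<open>\<phi> * \<psi>\<^sub>-\<close>, which the transform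
  turns into products.
\<close>

theorem hat_conv0:
  assumes \<phi>: "\<phi> \<in> \<D>" and \<psi>: "\<psi> \<in> \<D>" and m: "m > 0"
    and s: "supp \<phi> \<subseteq> {- m..m}" "supp \<psi> \<subseteq> {- m..m}"
    and z: "\<And>x. \<bar>x\<bar> \<ge> m \<Longrightarrow> \<phi> x = 0" "\<And>x. \<bar>x\<bar> \<ge> m \<Longrightarrow> \<psi> x = 0"
  shows "hat (\<phi> *\<^sub>0 \<psi>) \<mu> = half_hat \<phi> m \<mu> * hat \<psi> \<mu> - half_hat (\<lambda>r. \<psi> (- r)) m (- \<mu>) * hat \<phi> \<mu>"
proof -
  define A where "A t = integral {0..m} (\<lambda>r. \<phi> r * \<psi> (t - 1 * r))" for t
  define B where "B t = integral {0..m} (\<lambda>r. \<psi> (- r) * \<phi> (t - (- 1) * r))" for t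
  have c\<psi>: "continuous_on UNIV (\<lambda>r. \<psi> (- r))"
    by (rule continuous_on_compose2[OF test_fun_continuous[OF \<psi>, of UNIV]]) (auto intro: continuous_intros)
  note A = half_convolution[OF test_fun_continuous[OF \<phi>] \<psi> s(2) m, of 1, folded A_def, simplified]
  note B = half_convolution[OF c\<psi> \<phi> s(1) m, of "- 1", folded B_def, simplified]
  have eq: "(\<phi> *\<^sub>0 \<psi>) t = A t - B t" for t
    using conv0_split[OF test_fun_continuous[OF \<phi>] test_fun_continuous[OF \<psi>] m z] by (simp add: A_def B_def)
  have int: "set_integrable lborel {- 2 * m..2 * m} (\<lambda>t. exp (\<mu> * of_real t) * (\<phi> *\<^sub>0 \<psi>) t)"
    unfolding eq
    by (intro borel_integrable_atLeastAtMost' continuous_intros continuous_on_subset[OF A(1)]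
        continuous_on_subset[OF B(1)]) auto
  have "(LBINT t. exp (\<mu> * of_real t) * (\<phi> *\<^sub>0 \<psi>) t)
      = (LBINT t. indicator {- 2 * m..2 * m} t *\<^sub>R (exp (\<mu> * of_real t) * (\<phi> *\<^sub>0 \<psi>) t))"
    using A(2) B(2) by (intro Bochner_Integration.integral_cong) (auto simp: eq indicator_def)
  also have "\<dots> = integral {- 2 * m..2 * m} (\<lambda>t. exp (\<mu> * of_real t) * (\<phi> *\<^sub>0 \<psi>) t)"
    using set_borel_integral_eq_integral(2)[OF int] by (simp add: set_lebesgue_integral_def)
  also have "\<dots> = integral {- 2 * m..2 * m} (\<lambda>t. exp (\<mu> * of_real t) * A t - exp (\<mu> * of_real t) * B t)"
    by (simp add: eq right_diff_distrib)
  also have "\<dots> = integral {- 2 * m..2 * m} (\<lambda>t. exp (\<mu> * of_real t) * A t)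
      - integral {- 2 * m..2 * m} (\<lambda>t. exp (\<mu> * of_real t) * B t)"
    by (intro Henstock_Kurzweil_Integration.integral_diff integrable_continuous_real continuous_intros
        continuous_on_subset[OF A(1)] continuous_on_subset[OF B(1)]) auto
  finally show ?thesis
    using A(3)[of \<mu>] B(3)[of \<mu>] by (simp add: hat_def diff_divide_distrib)
qed

section \<open>Operators from weights on the contour\<close>

lemma functional_continuous:
  fixes f :: "'a::complex_lcs \<Rightarrow> complex"
  assumes p: "cseminorm p" and f: "functional_le f p"
  shows "continuous_on S f"
  unfolding continuous_on_def
proof
  fix x
  show "(f \<longlongrightarrow> f x) (at x within S)"
  proof (rule tendstoI)
    fix e :: real assume "e > 0"
    from cseminorm_tendstoD[OF tendsto_ident_at p this]
    show "\<forall>\<^sub>F y in at x within S. dist (f y) (f x) < e"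
    proof eventually_elim
      case (elim y)
      then show ?case
        using functional_bound[OF f, of "y - x"] functional_diff[OF f, of y x] by (simp add: dist_norm)
    qed
  qed
qed

lemma cseminorm_continuous_compose:
  assumes p: "cseminorm p" and v: "continuous_on S v"
  shows "continuous_on S (\<lambda>x. p (v x))"
proof -
  have "continuous_on UNIV p" using p by (simp add: cseminorm_def)
  then show ?thesis by (rule continuous_on_compose2[OF _ v]) simp
qed

lemma cseminorm_uniformly_continuous:
  fixes v :: "real \<Rightarrow> 'a::complex_lcs"
  assumes p: "cseminorm p" and v: "continuous_on UNIV v" and e: "e > 0"
  obtains d where "d > 0" "\<And>x y. x \<in> {r..s} \<Longrightarrow> y \<in> {r..s} \<Longrightarrow> \<bar>x - y\<bar> < d \<Longrightarrow> p (v x - v y) < e"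
proof -
  have c1: "continuous_on UNIV (\<lambda>z. v (fst z))" "continuous_on UNIV (\<lambda>z. v (snd z))"
    by (auto intro!: continuous_on_compose2[OF v] continuous_intros)
  have "continuous_on ({r..s} \<times> {r..s}) (\<lambda>z. p (v (fst z) - v (snd z)))"
    by (intro cseminorm_continuous_compose[OF p] continuous_on_diff continuous_on_subset[OF c1(1)]
        continuous_on_subset[OF c1(2)]) auto
  then have "uniformly_continuous_on ({r..s} \<times> {r..s}) (\<lambda>z. p (v (fst z) - v (snd z)))"
    by (intro compact_uniformly_continuous compact_Times compact_Icc)
  then obtain d where d: "d > 0" "\<And>z w. z \<in> {r..s} \<times> {r..s} \<Longrightarrow> w \<in> {r..s} \<times> {r..s} \<Longrightarrow> dist w z < d \<Longrightarrow>
      dist (p (v (fst w) - v (snd w))) (p (v (fst z) - v (snd z))) < e"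
    using e unfolding uniformly_continuous_on_def by metis
  have "p (v x - v y) < e" if "x \<in> {r..s}" "y \<in> {r..s}" "\<bar>x - y\<bar> < d" for x y
    using d(2)[of "(x, x)" "(x, y)"] that seminorm_zero[OF cseminorm_seminorm[OF p]]
    by (simp add: dist_Pair_Pair dist_real_def abs_minus_commute)
  then show thesis using that d(1) by blast
qed

text \<open>
  Used with \<open>m\<close> the derivative of the contour, which is Lipschitz between its jumps.
\<close>

lemma piecewise_ucont_scaleC:
  fixes v :: "real \<Rightarrow> 'a::complex_lcs"
  assumes v: "continuous_on UNIV v" and c: "c > 0" "\<And>t. cmod (m t) \<le> c"
    and L: "L \<ge> 0" "\<And>x y. closed_segment x y \<inter> K = {} \<Longrightarrow> cmod (m x - m y) \<le> L * \<bar>x - y\<bar>"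
  shows "piecewise_ucont K (\<lambda>t. m t *\<^sub>C v t)"
  unfolding piecewise_ucont_def
proof (intro allI impI conjI)
  fix p :: "'a \<Rightarrow> real" and r s :: real assume p: "cseminorm p"
  note p' = cseminorm_seminorm[OF p]
  have "compact ((\<lambda>t. p (v t)) ` {r..s})"
    by (intro compact_continuous_image cseminorm_continuous_compose[OF p] continuous_on_subset[OF v]) auto
  then have "bounded ((\<lambda>t. p (v t)) ` {r..s})" by (rule compact_imp_bounded)
  then obtain B where B: "B > 0" "\<And>t. t \<in> {r..s} \<Longrightarrow> p (v t) \<le> B"
    unfolding bounded_pos by (force simp: seminorm_nonneg[OF p'])
  show "\<exists>B. \<forall>x\<in>{r..s}. p (m x *\<^sub>C v x) \<le> B"
  proof (intro exI ballI)
    fix x assume "x \<in> {r..s}"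
    then show "p (m x *\<^sub>C v x) \<le> c * B"
      unfolding seminorm_scaleC[OF p'] using c B seminorm_nonneg[OF p'] by (intro mult_mono) auto
  qed
  fix e :: real assume e: "e > 0"
  define e' where "e' = e / (2 * c)"
  have "e' > 0" using e c by (simp add: e'_def)
  then obtain d where d: "d > 0" "\<And>x y. x \<in> {r..s} \<Longrightarrow> y \<in> {r..s} \<Longrightarrow> \<bar>x - y\<bar> < d \<Longrightarrow> p (v x - v y) < e'"
    using cseminorm_uniformly_continuous[OF p v] by blast
  \<comment> \<open>The denominator has \<open>L + 1\<close> because \<open>L\<close> may be 0.\<close>
  define d' where "d' = e / (2 * ((L + 1) * B))"
  have d': "d' > 0" using e L B by (simp add: d'_def)
  show "\<exists>d>0. \<forall>x\<in>{r..s}. \<forall>y\<in>{r..s}. \<bar>x - y\<bar> < d \<longrightarrow> closed_segment x y \<inter> K = {} \<longrightarrow>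
      p (m x *\<^sub>C v x - m y *\<^sub>C v y) \<le> e"
  proof (intro exI[of _ "min d d'"] conjI ballI impI)
    show "min d d' > 0" using d d' by simp
    fix x y assume xy: "x \<in> {r..s}" "y \<in> {r..s}" "\<bar>x - y\<bar> < min d d'" "closed_segment x y \<inter> K = {}"
    have "m x *\<^sub>C v x - m y *\<^sub>C v y = m x *\<^sub>C (v x - v y) + (m x - m y) *\<^sub>C v y"
      by (simp add: complex_vector.scale_right_diff_distrib complex_vector.scale_left_diff_distrib)
    then have "p (m x *\<^sub>C v x - m y *\<^sub>C v y) \<le> cmod (m x) * p (v x - v y) + cmod (m x - m y) * p (v y)"
      using seminorm_add[OF p', of "m x *\<^sub>C (v x - v y)" "(m x - m y) *\<^sub>C v y"]
      by (simp add: seminorm_scaleC[OF p'])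
    also have "cmod (m x) * p (v x - v y) \<le> c * e'"
      using c d(2)[of x y] xy seminorm_nonneg[OF p'] by (intro mult_mono) auto
    also have "cmod (m x - m y) * p (v y) \<le> ((L + 1) * d') * B"
    proof (intro mult_mono)
      have "cmod (m x - m y) \<le> L * \<bar>x - y\<bar>" by (rule L(2)[OF xy(4)])
      also have "\<dots> \<le> (L + 1) * d'" using xy(3) L(1) d' by (intro mult_mono) auto
      finally show "cmod (m x - m y) \<le> (L + 1) * d'" .
    qed (use B xy L d' seminorm_nonneg[OF p'] in auto)
    also have "c * e' = e / 2" using c by (simp add: e'_def)
    also have "((L + 1) * d') * B = e / 2"
    proof -
      have "L + 1 \<noteq> 0" "B \<noteq> 0" using L(1) B(1) by auto
      then show ?thesis by (simp add: d'_def)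
    qed
    finally show "p (m x *\<^sub>C v x - m y *\<^sub>C v y) \<le> e" by simp
  qed
qed

lemma clin_add: "T \<in> clin_ops \<Longrightarrow> T (x + y) = T x + T (y :: 'a::complex_lcs)"
  and clin_scale: "T \<in> clin_ops \<Longrightarrow> T (c *\<^sub>C x) = c *\<^sub>C T (x :: 'a::complex_lcs)"
proof -
  assume "T \<in> clin_ops"
  then interpret T: Vector_Spaces.linear scaleC scaleC T by (simp add: clin_ops_def)
  show "T (x + y) = T x + T y" "T (c *\<^sub>C x) = c *\<^sub>C T x" by (rule T.add, rule T.scale)
qed

lemma clin_diff: "T \<in> clin_ops \<Longrightarrow> T (x - y) = T x - T (y :: 'a::complex_lcs)"
proof -
  assume "T \<in> clin_ops"
  then interpret T: Vector_Spaces.linear scaleC scaleC T by (simp add: clin_ops_def)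
  show "T (x - y) = T x - T y" by (rule T.diff)
qed

text \<open>
  The resolvent identity stands for the multivalued operator, and an integer power for the
  growth exponent.
\<close>

locale contour_calculus = exp_contour a b for a b +
  fixes C :: "'a::{complex_lcs, seq_complete_space, t2_space} \<Rightarrow> 'a"
    and F :: "complex \<Rightarrow> 'a \<Rightarrow> 'a" and n :: nat
  assumes C: "C \<in> clin_ops"
    and F: "\<mu> \<in> exp_region a b \<Longrightarrow> F \<mu> \<in> clin_ops"
    and F_C: "\<mu> \<in> exp_region a b \<Longrightarrow> F \<mu> (C x) = C (F \<mu> x)"
    and resolvent: "\<nu> \<in> exp_region a b \<Longrightarrow> \<mu> \<in> exp_region a b \<Longrightarrow>
      (\<nu> - \<mu>) *\<^sub>C F \<nu> (F \<mu> x) = F \<mu> (C x) - F \<nu> (C x)"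
    and F_analytic: "analytic_into (Omega_region a b) (\<lambda>\<mu>. F \<mu> x)"
    and F_continuous: "\<mu> \<in> range (Gamma_curve a b) \<Longrightarrow> continuous (at \<mu> within exp_region a b) (\<lambda>\<mu>. F \<mu> x)"
    and F_growth: "cseminorm p \<Longrightarrow> \<exists>q. cseminorm q \<and>
      (\<forall>\<mu>\<in>exp_region a b. \<forall>x. p (F \<mu> x) \<le> (1 + cmod \<mu>) ^ n * q x)"
begin

lemma F_\<Gamma>_continuous: "continuous_on UNIV (\<lambda>t. F (\<Gamma> t) x)"
  unfolding continuous_on_def
proof
  fix t
  have 1: "((\<lambda>\<mu>. F \<mu> x) \<longlongrightarrow> F (\<Gamma> t) x) (at (\<Gamma> t) within E)"
    using F_continuous[OF \<Gamma>_range] by (simp add: continuous_within)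
  have 2: "(\<Gamma> \<longlongrightarrow> \<Gamma> t) (at t within UNIV)"
    using continuous_\<Gamma>[of UNIV] by (simp add: continuous_on_def)
  have "filterlim \<Gamma> (at (\<Gamma> t) within E) (at t)"
    unfolding filterlim_at
  proof (intro conjI)
    have "\<Gamma> s \<noteq> \<Gamma> t" if "s \<noteq> t" for s using that Im_\<Gamma> by metis
    then show "\<forall>\<^sub>F s in at t. \<Gamma> s \<in> E \<and> \<Gamma> s \<noteq> \<Gamma> t"
      using \<Gamma>_in_E by (auto simp: eventually_at_filter)
  qed (use 2 in simp)
  from filterlim_compose[OF 1 this] show "((\<lambda>t. F (\<Gamma> t) x) \<longlongrightarrow> F (\<Gamma> t) x) (at t within UNIV)" by simp
qed

lemma \<Gamma>_growth:
  assumes "cseminorm p"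
  obtains q c where "cseminorm q" "c > 0" "\<And>t x. p (F (\<Gamma> t) x) \<le> c * (1 + \<bar>t\<bar>) ^ n * q x"
proof -
  obtain q where q: "cseminorm q" "\<And>\<mu> x. \<mu> \<in> E \<Longrightarrow> p (F \<mu> x) \<le> (1 + cmod \<mu>) ^ n * q x"
    using F_growth[OF assms] by blast
  obtain c where c: "c > 0" "\<And>t. 1 + cmod (\<Gamma> t) \<le> c * (1 + \<bar>t\<bar>)" using norm_\<Gamma>_growth by blast
  have "p (F (\<Gamma> t) x) \<le> c ^ n * (1 + \<bar>t\<bar>) ^ n * q x" for t x
  proof -
    have "(1 + cmod (\<Gamma> t)) ^ n \<le> (c * (1 + \<bar>t\<bar>)) ^ n" using c by (intro power_mono) auto
    then have "(1 + cmod (\<Gamma> t)) ^ n * q x \<le> (c * (1 + \<bar>t\<bar>)) ^ n * q x"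
      using seminorm_nonneg[OF cseminorm_seminorm[OF q(1)]] by (intro mult_right_mono)
    then show ?thesis using q(2)[OF \<Gamma>_in_E, of t x] by (simp add: power_mult_distrib)
  qed
  then show thesis using that[OF q(1), of "c ^ n"] c(1) by simp
qed

definition S :: "(complex \<Rightarrow> complex) \<Rightarrow> 'a \<Rightarrow> 'a" where
  "S g x = line_integral \<Gamma> (\<lambda>\<mu>. g \<mu> *\<^sub>C F \<mu> x)"

lemma integrand_decay:
  assumes p: "cseminorm p"
  shows "\<exists>q c. cseminorm q \<and> c \<ge> 0 \<and> (\<forall>z N t x. cmod z * (1 + \<bar>t\<bar>) ^ (n + 2) \<le> N \<longrightarrow>
      p (d\<Gamma> t *\<^sub>C z *\<^sub>C F (\<Gamma> t) x) \<le> c * N * q x / (1 + t\<^sup>2))"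
proof -
  obtain q c where q: "cseminorm q" "c > 0" "\<And>t x. p (F (\<Gamma> t) x) \<le> c * (1 + \<bar>t\<bar>) ^ n * q x"
    using \<Gamma>_growth[OF p] by blast
  obtain d where d: "d > 0" "\<And>t. cmod (d\<Gamma> t) \<le> d" using d\<Gamma>_bounded by blast
  show ?thesis
  proof (intro exI[of _ q] exI[of _ "d * c"] conjI allI impI)
    fix z N t x assume N: "cmod z * (1 + \<bar>t\<bar>) ^ (n + 2) \<le> N"
    have "p (F (\<Gamma> t) x) \<le> c * q x * (1 + \<bar>t\<bar>) ^ n" using q(3)[of t x] by (simp add: mult_ac)
    from weight_decay[OF N this]
    have "cmod z * p (F (\<Gamma> t) x) \<le> c * q x * N / (1 + t\<^sup>2)"
      using q seminorm_nonneg[OF cseminorm_seminorm[OF q(1)]] by simp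
    then have "cmod (d\<Gamma> t) * (cmod z * p (F (\<Gamma> t) x)) \<le> d * (c * q x * N / (1 + t\<^sup>2))"
      using d seminorm_nonneg[OF cseminorm_seminorm[OF p]] by (intro mult_mono) auto
    then show "p (d\<Gamma> t *\<^sub>C z *\<^sub>C F (\<Gamma> t) x) \<le> d * c * N * q x / (1 + t\<^sup>2)"
      by (simp add: seminorm_scaleC[OF cseminorm_seminorm[OF p]] norm_mult mult_ac)
  qed (use q d in auto)
qed

lemma integrand_measurable:
  assumes g: "continuous_on UNIV (\<lambda>t. g (\<Gamma> t))" and p: "cseminorm p" and f: "functional_le f p"
  shows "(\<lambda>t. d\<Gamma> t * (g (\<Gamma> t) * f (F (\<Gamma> t) x))) \<in> borel_measurable borel"
proof -
  have "continuous_on UNIV (\<lambda>t. g (\<Gamma> t) * f (F (\<Gamma> t) x))"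
    by (intro continuous_on_mult g continuous_on_compose2[OF functional_continuous[OF p f, of UNIV] F_\<Gamma>_continuous])
      simp
  then have "(\<lambda>t. g (\<Gamma> t) * f (F (\<Gamma> t) x)) \<in> borel_measurable borel"
    by (rule borel_measurable_continuous_onI)
  then show ?thesis by measurable
qed

lemma S_integrable:
  assumes g: "rapid g" and p: "cseminorm p" and f: "functional_le f p"
  shows "integrable lborel (\<lambda>t. d\<Gamma> t * (g (\<Gamma> t) * f (F (\<Gamma> t) x)))"
proof -
  have gc: "continuous_on UNIV (\<lambda>t. g (\<Gamma> t))" using g by (simp add: rapid_def)
  obtain q c where q: "\<forall>z N t x. cmod z * (1 + \<bar>t\<bar>) ^ (n + 2) \<le> N \<longrightarrow>
      p (d\<Gamma> t *\<^sub>C z *\<^sub>C F (\<Gamma> t) x) \<le> c * N * q x / (1 + t\<^sup>2)"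
    using integrand_decay[OF p] by blast
  obtain N where N: "\<And>t. cmod (g (\<Gamma> t)) * (1 + \<bar>t\<bar>) ^ (n + 2) \<le> N" using g unfolding rapid_def by blast
  show ?thesis
  proof (rule integrable_decay[OF integrand_measurable[OF gc p f]])
    fix t
    have "cmod (f (d\<Gamma> t *\<^sub>C g (\<Gamma> t) *\<^sub>C F (\<Gamma> t) x)) \<le> c * N * q x / (1 + t\<^sup>2)"
      using order_trans[OF functional_bound[OF f] q[rule_format, OF N]] .
    then show "cmod (d\<Gamma> t * (g (\<Gamma> t) * f (F (\<Gamma> t) x))) \<le> c * N * q x / (1 + t\<^sup>2)"
      by (simp add: functional_scaleC[OF f] mult.assoc)
  qed
qed

lemma S_line_integral: "rapid g \<Longrightarrow> has_line_integral \<Gamma> (\<lambda>\<mu>. g \<mu> *\<^sub>C F \<mu> x) (S g x)"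
  and S_weak: "rapid g \<Longrightarrow> cseminorm p \<Longrightarrow> functional_le f p \<Longrightarrow> f (S g x) = contour_int (\<lambda>\<mu>. g \<mu> * f (F \<mu> x))"
proof -
  assume g: "rapid g"
  have gc: "continuous_on UNIV (\<lambda>t. g (\<Gamma> t))" using g by (simp add: rapid_def)
  define u where "u = (\<lambda>t. d\<Gamma> t *\<^sub>C (g (\<Gamma> t) *\<^sub>C F (\<Gamma> t) x))"
  obtain d where d: "d > 0" "\<And>t. cmod (d\<Gamma> t) \<le> d" using d\<Gamma>_bounded by blast
  have u: "piecewise_ucont {T, - T} u"
    unfolding u_def
    by (rule piecewise_ucont_scaleC[where L = "1 / a", OF _ d])
      (use d\<Gamma>_osc a_pos in \<open>auto intro!: continuous_on_scaleC gc F_\<Gamma>_continuous\<close>)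
  have meas: "(\<lambda>t. f (u t)) \<in> borel_measurable borel" if "cseminorm p" "functional_le f p" for f p
    using integrand_measurable[OF gc that] by (simp add: u_def functional_scaleC[OF that(2)] mult.assoc)
  have decay: "\<exists>K. \<forall>t. p (u t) \<le> K / (1 + t\<^sup>2)" if p: "cseminorm p" for p
  proof -
    obtain q c where q: "\<forall>z N t x. cmod z * (1 + \<bar>t\<bar>) ^ (n + 2) \<le> N \<longrightarrow>
        p (d\<Gamma> t *\<^sub>C z *\<^sub>C F (\<Gamma> t) x) \<le> c * N * q x / (1 + t\<^sup>2)"
      using integrand_decay[OF p] by blast
    obtain N where N: "\<And>t. cmod (g (\<Gamma> t)) * (1 + \<bar>t\<bar>) ^ (n + 2) \<le> N" using g unfolding rapid_def by blast
    from q[rule_format, OF N] show ?thesis unfolding u_def by blast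
  qed
  show "has_line_integral \<Gamma> (\<lambda>\<mu>. g \<mu> *\<^sub>C F \<mu> x) (S g x)"
    unfolding S_def by (rule line_integral_weak(1)[OF u_def u]) (use meas decay in auto)
  show "f (S g x) = contour_int (\<lambda>\<mu>. g \<mu> * f (F \<mu> x))" if pf: "cseminorm p" "functional_le f p"
  proof -
    have "f (S g x) = (LBINT t. f (u t))"
      unfolding S_def by (rule line_integral_weak(2)[OF u_def u _ _ _ pf]) (use meas decay in auto)
    then show ?thesis by (simp add: contour_int_def u_def functional_scaleC[OF pf(2)] mult.assoc)
  qed
qed

lemma S_bound:
  assumes p: "cseminorm p"
  shows "\<exists>q c. cseminorm q \<and> c \<ge> 0 \<and>
    (\<forall>g N x. rapid g \<longrightarrow> (\<forall>t. cmod (g (\<Gamma> t)) * (1 + \<bar>t\<bar>) ^ (n + 2) \<le> N) \<longrightarrow> p (S g x) \<le> c * N * q x)"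
proof -
  obtain q c where q: "cseminorm q" "c \<ge> 0" "\<forall>z N t x. cmod z * (1 + \<bar>t\<bar>) ^ (n + 2) \<le> N \<longrightarrow>
      p (d\<Gamma> t *\<^sub>C z *\<^sub>C F (\<Gamma> t) x) \<le> c * N * q x / (1 + t\<^sup>2)"
    using integrand_decay[OF p] by blast
  show ?thesis
  proof (intro exI[of _ q] exI[of _ "c * pi"] conjI allI impI)
    fix g N x assume g: "rapid g" and N: "\<forall>t. cmod (g (\<Gamma> t)) * (1 + \<bar>t\<bar>) ^ (n + 2) \<le> N"
    have gc: "continuous_on UNIV (\<lambda>t. g (\<Gamma> t))" using g by (simp add: rapid_def)
    show "p (S g x) \<le> c * pi * N * q x"
    proof (rule seminorm_le_functional[OF cseminorm_seminorm[OF p]])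
      fix f assume f: "functional_le f p"
      have "cmod (d\<Gamma> t * (g (\<Gamma> t) * f (F (\<Gamma> t) x))) \<le> c * N * q x / (1 + t\<^sup>2)" for t
        using order_trans[OF functional_bound[OF f] q(3)[rule_format, OF N[rule_format, of t], of x]]
        by (simp add: functional_scaleC[OF f] mult.assoc)
      from integral_decay_bound[OF integrand_measurable[OF gc p f] this]
      show "cmod (f (S g x)) \<le> c * pi * N * q x"
        by (simp add: S_weak[OF g p f] contour_int_def mult_ac)
    qed
  qed (use q in auto)
qed

lemma S_add_vec: "rapid g \<Longrightarrow> S g (x + y) = S g x + S g y"
  and S_scale_vec: "rapid g \<Longrightarrow> S g (c *\<^sub>C x) = c *\<^sub>C S g x"
proof -
  assume g: "rapid g"
  show "S g (x + y) = S g x + S g y"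
  proof (rule functional_eqI)
    fix f :: "'a \<Rightarrow> complex" and p assume pf: "cseminorm p" "functional_le f p"
    show "f (S g (x + y)) = f (S g x + S g y)"
      using S_integrable[OF g pf, of x] S_integrable[OF g pf, of y]
      by (simp add: functional_add[OF pf(2)] S_weak[OF g pf] contour_int_def clin_add[OF F[OF \<Gamma>_in_E]] distrib_left)
  qed
  show "S g (c *\<^sub>C x) = c *\<^sub>C S g x"
  proof (rule functional_eqI)
    fix f :: "'a \<Rightarrow> complex" and p assume pf: "cseminorm p" "functional_le f p"
    have "(LBINT t. c * (d\<Gamma> t * (g (\<Gamma> t) * f (F (\<Gamma> t) x)))) = c * (LBINT t. d\<Gamma> t * (g (\<Gamma> t) * f (F (\<Gamma> t) x)))"
      by (rule integral_mult_right_zero)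
    then show "f (S g (c *\<^sub>C x)) = f (c *\<^sub>C S g x)"
      by (simp add: functional_scaleC[OF pf(2)] S_weak[OF g pf] contour_int_def clin_scale[OF F[OF \<Gamma>_in_E]] mult_ac)
  qed
qed

lemma S_clin:
  assumes g: "rapid g"
  shows "S g \<in> clin_ops"
proof -
  have "Vector_Spaces.linear scaleC scaleC (S g)"
    by unfold_locales (auto simp: S_add_vec[OF g] S_scale_vec[OF g])
  moreover have "continuous_on UNIV (S g)"
    unfolding continuous_on_def
  proof
    fix x
    show "(S g \<longlongrightarrow> S g x) (at x within UNIV)"
    proof (rule cseminorm_tendstoI)
      fix p :: "'a \<Rightarrow> real" and e :: real assume p: "cseminorm p" and e: "e > 0"
      obtain q c where q: "cseminorm q" "c \<ge> 0"
        "\<forall>g N x. rapid g \<longrightarrow> (\<forall>t. cmod (g (\<Gamma> t)) * (1 + \<bar>t\<bar>) ^ (n + 2) \<le> N) \<longrightarrow> p (S g x) \<le> c * N * q x"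
        using S_bound[OF p] by blast
      obtain N where N: "\<forall>t. cmod (g (\<Gamma> t)) * (1 + \<bar>t\<bar>) ^ (n + 2) \<le> N" using g unfolding rapid_def by blast
      have N0: "N \<ge> 0" using order_trans[OF mult_nonneg_nonneg N[rule_format, of 0]] by simp
      define k where "k = c * N + 1"
      have k: "k > 0" using q(2) N0 by (simp add: k_def add_nonneg_pos)
      have "e / k > 0" using e k by simp
      from cseminorm_tendstoD[OF tendsto_ident_at q(1) this]
      show "\<forall>\<^sub>F y in at x within UNIV. p (S g y - S g x) < e"
      proof eventually_elim
        case (elim y)
        have "S g y - S g x = S g (y - x)" using S_add_vec[OF g, of "y - x" x] by simp
        then have "p (S g y - S g x) \<le> c * N * q (y - x)" using q(3) g N by simp
        also have "\<dots> \<le> k * q (y - x)"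
          using seminorm_nonneg[OF cseminorm_seminorm[OF q(1)]] by (intro mult_right_mono) (auto simp: k_def)
        also have "\<dots> < e" using elim k by (simp add: pos_less_divide_eq mult.commute)
        finally show ?case .
      qed
    qed
  qed
  ultimately show ?thesis by (simp add: clin_ops_def)
qed

lemma S_add: "rapid g \<Longrightarrow> rapid h \<Longrightarrow> S (\<lambda>\<mu>. g \<mu> + h \<mu>) x = S g x + S h x"
proof (rule functional_eqI)
  fix f :: "'a \<Rightarrow> complex" and p
  assume g: "rapid g" "rapid h" and pf: "cseminorm p" "functional_le f p"
  show "f (S (\<lambda>\<mu>. g \<mu> + h \<mu>) x) = f (S g x + S h x)"
    using S_integrable[OF g(1) pf, of x] S_integrable[OF g(2) pf, of x]
    by (simp add: functional_add[OF pf(2)] S_weak[OF g(1) pf] S_weak[OF g(2) pf] S_weak[OF rapid_add[OF g] pf]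
        contour_int_def distrib_left distrib_right)
qed

lemma S_scale: "rapid g \<Longrightarrow> S (\<lambda>\<mu>. c * g \<mu>) x = c *\<^sub>C S g x"
proof (rule functional_eqI)
  fix f :: "'a \<Rightarrow> complex" and p
  assume g: "rapid g" and pf: "cseminorm p" "functional_le f p"
  have "(LBINT t. c * (d\<Gamma> t * (g (\<Gamma> t) * f (F (\<Gamma> t) x)))) = c * (LBINT t. d\<Gamma> t * (g (\<Gamma> t) * f (F (\<Gamma> t) x)))"
    by (rule integral_mult_right_zero)
  then show "f (S (\<lambda>\<mu>. c * g \<mu>) x) = f (c *\<^sub>C S g x)"
    by (simp add: functional_scaleC[OF pf(2)] S_weak[OF g pf] S_weak[OF rapid_scale[OF g] pf] contour_int_def mult_ac)
qed

lemma S_diff: "rapid g \<Longrightarrow> rapid h \<Longrightarrow> S (\<lambda>\<mu>. g \<mu> - h \<mu>) x = S g x - S h x"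
  using S_add[of g "\<lambda>\<mu>. (- 1) * h \<mu>" x] S_scale[of h "- 1" x] rapid_scale[of h "- 1"]
  by (simp add: complex_vector.scale_minus_left scaleC_one)

lemma S_commute:
  assumes g: "rapid g"
  shows "S g (C x) = C (S g x)"
proof (rule functional_eqI)
  fix f :: "'a \<Rightarrow> complex" and p assume pf: "cseminorm p" "functional_le f p"
  have "f (C (S g x)) = contour_int (\<lambda>\<mu>. g \<mu> * f (C (F \<mu> x)))"
    by (rule S_weak[OF g cseminorm_compose[OF pf(1) C] functional_compose[OF pf(2) C]])
  then show "f (S g (C x)) = f (C (S g x))"
    by (simp add: S_weak[OF g pf] contour_int_def F_C[OF \<Gamma>_in_E])
qed

text \<open>
  Under a functional the left-hand side is the integral of \<open>g(\<mu>) (\<nu> - \<mu>) F(\<nu>) F(\<mu>) x\<close>, to which the resolvent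
  identity applies.
\<close>

lemma F_S:
  assumes g: "rapid g" and \<nu>: "\<nu> \<in> E"
  shows "\<nu> *\<^sub>C F \<nu> (S g x) - F \<nu> (S (\<lambda>\<mu>. \<mu> * g \<mu>) x) = S g (C x) - contour_int g *\<^sub>C F \<nu> (C x)"
proof (rule functional_eqI)
  fix f :: "'a \<Rightarrow> complex" and p assume pf: "cseminorm p" "functional_le f p"
  note pf' = cseminorm_compose[OF pf(1) F[OF \<nu>]] functional_compose[OF pf(2) F[OF \<nu>]]
  have g': "rapid (\<lambda>\<mu>. \<mu> * g \<mu>)" by (rule rapid_mult[OF g tempered_id])
  note int1 = S_integrable[OF g pf', of x] and int2 = S_integrable[OF g' pf', of x]
  have eq: "(\<nu> - \<Gamma> t) * f (F \<nu> (F (\<Gamma> t) x)) = f (F (\<Gamma> t) (C x)) - f (F \<nu> (C x))" for t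
    using arg_cong[OF resolvent[OF \<nu> \<Gamma>_in_E[of t], of x], of f]
    by (simp add: functional_scaleC[OF pf(2)] functional_diff[OF pf(2)])
  have "f (\<nu> *\<^sub>C F \<nu> (S g x) - F \<nu> (S (\<lambda>\<mu>. \<mu> * g \<mu>) x))
      = \<nu> * (LBINT t. d\<Gamma> t * (g (\<Gamma> t) * f (F \<nu> (F (\<Gamma> t) x))))
        - (LBINT t. d\<Gamma> t * (\<Gamma> t * g (\<Gamma> t) * f (F \<nu> (F (\<Gamma> t) x))))"
    by (simp add: functional_diff[OF pf(2)] functional_scaleC[OF pf(2)] S_weak[OF g pf'] S_weak[OF g' pf'] contour_int_def)
  also have "\<dots> = (LBINT t. \<nu> * (d\<Gamma> t * (g (\<Gamma> t) * f (F \<nu> (F (\<Gamma> t) x))))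
        - d\<Gamma> t * (\<Gamma> t * g (\<Gamma> t) * f (F \<nu> (F (\<Gamma> t) x))))"
    using int1 int2 by simp
  also have "\<dots> = (LBINT t. d\<Gamma> t * (g (\<Gamma> t) * f (F (\<Gamma> t) (C x))) - d\<Gamma> t * g (\<Gamma> t) * f (F \<nu> (C x)))"
  proof (rule Bochner_Integration.integral_cong)
    fix t
    have "\<nu> * (d\<Gamma> t * (g (\<Gamma> t) * f (F \<nu> (F (\<Gamma> t) x)))) - d\<Gamma> t * (\<Gamma> t * g (\<Gamma> t) * f (F \<nu> (F (\<Gamma> t) x)))
        = d\<Gamma> t * g (\<Gamma> t) * ((\<nu> - \<Gamma> t) * f (F \<nu> (F (\<Gamma> t) x)))"
      by (simp add: algebra_simps)
    then show "\<nu> * (d\<Gamma> t * (g (\<Gamma> t) * f (F \<nu> (F (\<Gamma> t) x)))) - d\<Gamma> t * (\<Gamma> t * g (\<Gamma> t) * f (F \<nu> (F (\<Gamma> t) x)))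
        = d\<Gamma> t * (g (\<Gamma> t) * f (F (\<Gamma> t) (C x))) - d\<Gamma> t * g (\<Gamma> t) * f (F \<nu> (C x))"
      unfolding eq by (simp add: algebra_simps)
  qed simp
  also have "\<dots> = f (S g (C x)) - contour_int g * f (F \<nu> (C x))"
    using S_integrable[OF g pf, of "C x"] rapid_integrable[OF g] by (simp add: S_weak[OF g pf] contour_int_def)
  finally show "f (\<nu> *\<^sub>C F \<nu> (S g x) - F \<nu> (S (\<lambda>\<mu>. \<mu> * g \<mu>) x)) = f (S g (C x) - contour_int g *\<^sub>C F \<nu> (C x))"
    by (simp add: functional_diff[OF pf(2)] functional_scaleC[OF pf(2)])
qed

text \<open>
  The preceding identity for \<open>\<nu>\<close> on the contour, integrated against \<open>g\<close>. With \<open>k\<close> for the second weight,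
  the left-hand side is minus the derivative of \<open>S(exp(-t \<mu>) g) S(exp(t \<mu>) k) x\<close> at \<open>t = 0\<close>.
\<close>

theorem S_S:
  assumes g: "rapid g" and h: "rapid h"
  shows "S (\<lambda>\<mu>. \<mu> * g \<mu>) (S h x) - S g (S (\<lambda>\<mu>. \<mu> * h \<mu>) x) = contour_int g *\<^sub>C S h (C x) - contour_int h *\<^sub>C S g (C x)"
proof (rule functional_eqI)
  fix f :: "'a \<Rightarrow> complex" and p assume pf: "cseminorm p" "functional_le f p"
  have g': "rapid (\<lambda>\<mu>. \<mu> * g \<mu>)" by (rule rapid_mult[OF g tempered_id])
  let ?y = "S h x" and ?y' = "S (\<lambda>\<mu>. \<mu> * h \<mu>) x"
  note int1 = S_integrable[OF g' pf, of ?y] and int2 = S_integrable[OF g pf, of ?y']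
  have eq: "\<Gamma> t * f (F (\<Gamma> t) ?y) - f (F (\<Gamma> t) ?y') = f (S h (C x)) - contour_int h * f (F (\<Gamma> t) (C x))" for t
    using arg_cong[OF F_S[OF h \<Gamma>_in_E[of t], of x], of f]
    by (simp add: functional_scaleC[OF pf(2)] functional_diff[OF pf(2)])
  have "f (S (\<lambda>\<mu>. \<mu> * g \<mu>) ?y - S g ?y')
      = (LBINT t. d\<Gamma> t * (\<Gamma> t * g (\<Gamma> t) * f (F (\<Gamma> t) ?y)) - d\<Gamma> t * (g (\<Gamma> t) * f (F (\<Gamma> t) ?y')))"
    using int1 int2 by (simp add: functional_diff[OF pf(2)] S_weak[OF g' pf] S_weak[OF g pf] contour_int_def)
  also have "\<dots> = (LBINT t. d\<Gamma> t * g (\<Gamma> t) * f (S h (C x)) - contour_int h * (d\<Gamma> t * (g (\<Gamma> t) * f (F (\<Gamma> t) (C x)))))"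
  proof (rule Bochner_Integration.integral_cong)
    fix t
    have "d\<Gamma> t * (\<Gamma> t * g (\<Gamma> t) * f (F (\<Gamma> t) ?y)) - d\<Gamma> t * (g (\<Gamma> t) * f (F (\<Gamma> t) ?y'))
        = d\<Gamma> t * g (\<Gamma> t) * (\<Gamma> t * f (F (\<Gamma> t) ?y) - f (F (\<Gamma> t) ?y'))"
      by (simp add: algebra_simps)
    then show "d\<Gamma> t * (\<Gamma> t * g (\<Gamma> t) * f (F (\<Gamma> t) ?y)) - d\<Gamma> t * (g (\<Gamma> t) * f (F (\<Gamma> t) ?y'))
        = d\<Gamma> t * g (\<Gamma> t) * f (S h (C x)) - contour_int h * (d\<Gamma> t * (g (\<Gamma> t) * f (F (\<Gamma> t) (C x))))"
      unfolding eq by (simp add: algebra_simps)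
  qed simp
  also have "\<dots> = contour_int g * f (S h (C x)) - contour_int h * f (S g (C x))"
    using S_integrable[OF g pf, of "C x"] rapid_integrable[OF g]
    by (simp add: S_weak[OF g pf] contour_int_def)
  finally show "f (S (\<lambda>\<mu>. \<mu> * g \<mu>) ?y - S g ?y') = f (contour_int g *\<^sub>C S h (C x) - contour_int h *\<^sub>C S g (C x))"
    by (simp add: functional_diff[OF pf(2)] functional_scaleC[OF pf(2)])
qed

lemma functional_F_holomorphic:
  assumes p: "cseminorm p" and f: "functional_le f p"
  shows "(\<lambda>\<mu>. f (F \<mu> x)) holomorphic_on \<Omega>"
  unfolding holomorphic_on_def
proof
  fix z assume z: "z \<in> \<Omega>"
  obtain d where d: "((\<lambda>w. inverse (w - z) *\<^sub>C (F w x - F z x)) \<longlongrightarrow> d) (at z)"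
    using F_analytic z unfolding analytic_into_def by blast
  have "isCont f d" using functional_continuous[OF p f, of UNIV] by (simp add: continuous_on_eq_continuous_at)
  from isCont_tendsto_compose[OF this d]
  have "((\<lambda>w. (f (F w x) - f (F z x)) / (w - z)) \<longlongrightarrow> f d) (at z)"
    by (simp add: functional_scaleC[OF f] functional_diff[OF f] divide_inverse mult.commute)
  then have "((\<lambda>\<mu>. f (F \<mu> x)) has_field_derivative f d) (at z)" by (simp add: has_field_derivative_iff)
  then show "(\<lambda>\<mu>. f (F \<mu> x)) field_differentiable at z within \<Omega>"
    using field_differentiable_at_within field_differentiable_def by blast
qed

text \<open>
  For support in the negative half line \<open>hat \<phi>\<close> decays faster than any power in the right half plane,
  so it beats the growth of \<open>F\<close> and Cauchy's theorem applies.
\<close>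

theorem S_hat_eq_zero:
  assumes \<phi>: "\<phi> \<in> \<D>" and s: "supp \<phi> \<subseteq> {..0}"
  shows "S (hat \<phi>) x = 0"
proof (rule functional_eqI)
  fix f :: "'a \<Rightarrow> complex" and p assume pf: "cseminorm p" "functional_le f p"
  obtain q where q: "cseminorm q" "\<And>\<mu> x. \<mu> \<in> E \<Longrightarrow> p (F \<mu> x) \<le> (1 + cmod \<mu>) ^ n * q x"
    using F_growth[OF pf(1)] by blast
  obtain m where m: "m > 0" "supp \<phi> \<subseteq> {-m..m}" using test_fun_support[OF \<phi>] .
  have "supp \<phi> \<subseteq> {-m..m} \<inter> {..0}" using m(2) s by blast
  also have "\<dots> \<subseteq> {-m..0}" by auto
  finally have m': "supp \<phi> \<subseteq> {-m..0}" .
  obtain B where B: "B \<ge> 0" "\<And>t. cmod (nth_vderiv (n + 3) \<phi> t) \<le> B"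
    using test_fun_bounded[OF nth_vderiv_test_fun[OF \<phi>]] by blast
  define K where "K = m * B * ((1 / b + 1) ^ n * q x)"
  have q0: "q x \<ge> 0" using seminorm_nonneg[OF cseminorm_seminorm[OF q(1)]] .
  have "contour_int (\<lambda>\<mu>. hat \<phi> \<mu> * f (F \<mu> x)) = 0"
  proof (rule contour_int_eq_zero)
    show "(\<lambda>\<mu>. hat \<phi> \<mu> * f (F \<mu> x)) holomorphic_on \<Omega>"
      by (intro holomorphic_intros hat_holomorphic[OF \<phi>] functional_F_holomorphic[OF pf])
    show "continuous (at (\<Gamma> t) within E) (\<lambda>\<mu>. hat \<phi> \<mu> * f (F \<mu> x))" for t
    proof (intro continuous_mult)
      show "continuous (at (\<Gamma> t) within E) (hat \<phi>)"
        using hat_continuous[OF \<phi>, of UNIV] by (simp add: continuous_on_eq_continuous_at continuous_at_imp_continuous_within)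
      have "isCont f (F (\<Gamma> t) x)"
        using functional_continuous[OF pf, of UNIV] by (simp add: continuous_on_eq_continuous_at)
      then show "continuous (at (\<Gamma> t) within E) (\<lambda>\<mu>. f (F \<mu> x))"
        using F_continuous[OF \<Gamma>_range, of t x] isCont_tendsto_compose unfolding continuous_within by blast
    qed
    show "K \<ge> 0" using m B q0 b_pos by (simp add: K_def)
    fix z assume z: "z \<in> E"
    have z0: "cmod z \<ge> b" "cmod z > 0" using E_norm[OF z] b_pos by auto
    have "1 + cmod z \<le> (1 / b + 1) * cmod z" using z0 b_pos by (simp add: field_simps)
    then have "(1 + cmod z) ^ n \<le> (1 / b + 1) ^ n * cmod z ^ n"
      using power_mono[of "1 + cmod z" "(1 / b + 1) * cmod z" n] by (simp add: power_mult_distrib)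
    then have "(1 + cmod z) ^ n * q x \<le> (1 / b + 1) ^ n * cmod z ^ n * q x"
      using q0 by (rule mult_right_mono)
    then have 1: "cmod (f (F z x)) \<le> (1 / b + 1) ^ n * cmod z ^ n * q x"
      using functional_bound[OF pf(2), of "F z x"] q(2)[OF z, of x] by linarith
    have 2: "cmod z ^ (n + 3) * cmod (hat \<phi> z) \<le> m * B"
      using hat_decay[OF \<phi> m' _ B(2), of z] m E_Re[OF z] b_pos by simp
    have "cmod (hat \<phi> z * f (F z x)) * cmod z ^ 3 \<le> cmod (hat \<phi> z) * ((1 / b + 1) ^ n * cmod z ^ n * q x) * cmod z ^ 3"
      unfolding norm_mult by (intro mult_right_mono mult_left_mono 1) auto
    also have "\<dots> = (cmod z ^ (n + 3) * cmod (hat \<phi> z)) * ((1 / b + 1) ^ n * q x)" by (simp add: power_add mult_ac)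
    also have "\<dots> \<le> K" unfolding K_def using b_pos q0 by (intro mult_right_mono 2) auto
    finally show "cmod (hat \<phi> z * f (F z x)) \<le> K / cmod z ^ 3" using z0 by (simp add: pos_le_divide_eq)
  qed
  then show "f (S (hat \<phi>) x) = f 0" by (simp add: S_weak[OF rapid_hat[OF \<phi>] pf] functional_zero[OF pf(2)])
qed

end

section \<open>The product formula\<close>

text \<open>
  Cutting \<open>{0..H}\<close> into \<open>N\<close> equal parts leaves \<open>N\<close> increments of size at most \<open>K * (H / N)\<^sup>2\<close>.
\<close>

lemma quadratic_variation_constant:
  fixes Z :: "real \<Rightarrow> 'a::{complex_lcs, t2_space}"
  assumes H: "H \<ge> 0"
    and Z: "\<And>p. cseminorm p \<Longrightarrow> \<exists>K. \<forall>h\<in>{0..H}. \<forall>h'\<in>{0..H}. p (Z h' - Z h) \<le> K * (h' - h)\<^sup>2"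
  shows "Z H = Z 0"
proof (rule cseminorm_separates)
  fix p :: "'a \<Rightarrow> real" assume p: "cseminorm p"
  note p' = cseminorm_seminorm[OF p]
  obtain K where K: "\<And>h h'. h \<in> {0..H} \<Longrightarrow> h' \<in> {0..H} \<Longrightarrow> p (Z h' - Z h) \<le> K * (h' - h)\<^sup>2"
    using Z[OF p] by blast
  have bound: "p (Z H - Z 0) \<le> K * H\<^sup>2 * (1 / real (Suc N))" for N
  proof -
    define d where "d = H / real (Suc N)"
    have dN: "real (Suc N) * d = H" by (simp add: d_def)
    have in_range: "real i * d \<in> {0..H}" if "i \<le> Suc N" for i
    proof -
      have "real i * d \<le> real (Suc N) * d" using that H by (intro mult_right_mono) (auto simp: d_def)
      then show ?thesis using H by (simp add: dN d_def)
    qed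
    have "Z H - Z 0 = (\<Sum>i<Suc N. Z (real (Suc i) * d) - Z (real i * d))"
      using sum_lessThan_telescope[of "\<lambda>i. Z (real i * d)" "Suc N"] by (simp only: dN) simp
    then have "p (Z H - Z 0) \<le> (\<Sum>i<Suc N. p (Z (real (Suc i) * d) - Z (real i * d)))"
      using seminorm_sum[OF p'] by metis
    also have "\<dots> \<le> (\<Sum>i<Suc N. K * d\<^sup>2)"
    proof (rule sum_mono)
      fix i assume "i \<in> {..<Suc N}"
      then have "p (Z (real (Suc i) * d) - Z (real i * d)) \<le> K * (real (Suc i) * d - real i * d)\<^sup>2"
        by (intro K in_range) auto
      also have "real (Suc i) * d - real i * d = d" by (simp add: algebra_simps)
      finally show "p (Z (real (Suc i) * d) - Z (real i * d)) \<le> K * d\<^sup>2" .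
    qed
    also have "\<dots> = K * (real (Suc N) * d) * d" by (simp add: power2_eq_square algebra_simps)
    also have "\<dots> = K * H\<^sup>2 * (1 / real (Suc N))" unfolding dN by (simp add: d_def power2_eq_square)
    finally show ?thesis .
  qed
  have "(\<lambda>N. K * H\<^sup>2 * (1 / real (Suc N))) \<longlonglongrightarrow> K * H\<^sup>2 * 0"
    by (intro tendsto_intros LIMSEQ_Suc[OF lim_1_over_n])
  then have "p (Z H - Z 0) \<le> K * H\<^sup>2 * 0"
    by (rule LIMSEQ_le_const) (use bound in blast)
  then show "p (Z H - Z 0) = 0" using seminorm_nonneg[OF p', of "Z H - Z 0"] by simp
qed

lemma quadratic_Taylor_bound:
  fixes g :: "real \<Rightarrow> complex"
  assumes d1: "\<And>h. h \<in> {0..H} \<Longrightarrow> (g has_vector_derivative g' h) (at h within {0..H})"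
    and d2: "\<And>h. h \<in> {0..H} \<Longrightarrow> (g' has_vector_derivative g'' h) (at h within {0..H})"
    and B: "\<And>h. h \<in> {0..H} \<Longrightarrow> cmod (g'' h) \<le> B"
    and h: "h \<in> {0..H}" and h': "h' \<in> {0..H}"
  shows "cmod (g h' - g h - of_real (h' - h) * g' h) \<le> 3 * B * (h' - h)\<^sup>2"
proof -
  have B0: "B \<ge> 0" using order_trans[OF norm_ge_zero B[OF h]] .
  have lip: "cmod (g' x - g' h) \<le> 3 * B * \<bar>x - h\<bar>" if x: "x \<in> {0..H}" for x
  proof -
    have "norm (g' x - g' h - (x - h) *\<^sub>R g'' h) \<le> norm (x - h) * (2 * B)"
    proof (rule vector_differentiable_bound_linearization[OF d2])
      show "closed_segment h x \<subseteq> {0..H}" using h x by (auto simp: closed_segment_eq_real_ivl split: if_splits)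
      show "norm (g'' y - g'' h) \<le> 2 * B" if "y \<in> {0..H}" for y
        using norm_triangle_ineq4[of "g'' y" "g'' h"] B[OF that] B[OF h] by linarith
    qed (use h in auto)
    moreover have "norm ((x - h) *\<^sub>R g'' h) \<le> \<bar>x - h\<bar> * B"
      using B[OF h] by (simp add: mult_left_mono)
    ultimately have "cmod (g' x - g' h) \<le> \<bar>x - h\<bar> * (2 * B) + \<bar>x - h\<bar> * B"
      using norm_triangle_ineq2[of "g' x - g' h" "(x - h) *\<^sub>R g'' h"] by (simp only: real_norm_def)
    then show ?thesis by (simp add: algebra_simps)
  qed
  let ?I = "closed_segment h h'"
  have I: "?I \<subseteq> {0..H}" using h h' by (auto simp: closed_segment_eq_real_ivl split: if_splits)
  have "norm (g h' - g h - (h' - h) *\<^sub>R g' h) \<le> norm (h' - h) * (3 * B * \<bar>h' - h\<bar>)"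
  proof (rule vector_differentiable_bound_linearization[where S = ?I])
    fix x assume x: "x \<in> ?I"
    show "(g has_vector_derivative g' x) (at x within ?I)"
      using has_vector_derivative_within_subset[OF d1 I] x I by blast
    have "\<bar>x - h\<bar> \<le> \<bar>h' - h\<bar>" using x by (auto simp: closed_segment_eq_real_ivl split: if_splits)
    then have "3 * B * \<bar>x - h\<bar> \<le> 3 * B * \<bar>h' - h\<bar>" using B0 by (intro mult_left_mono) auto
    then show "norm (g' x - g' h) \<le> 3 * B * \<bar>h' - h\<bar>" using lip[of x] x I by force
  qed auto
  also have "norm (h' - h) * (3 * B * \<bar>h' - h\<bar>) = 3 * B * (h' - h)\<^sup>2"
    using abs_mult_self_eq[of "h' - h"] by (simp add: power2_eq_square mult_ac)
  finally show ?thesis by (simp add: scaleR_conv_of_real)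
qed

context exp_contour
begin

text \<open>
  A curve \<open>g\<close> of weights that is differentiable with derivative \<open>g'\<close>, with respect to every
  order of decay. Differentiability is expressed by a quadratic remainder that is uniform on \<open>{0..H}\<close>,
  because such a bound survives seminorm estimates and products.
\<close>

definition smooth_family ::
    "real \<Rightarrow> (real \<Rightarrow> complex \<Rightarrow> complex) \<Rightarrow> (real \<Rightarrow> complex \<Rightarrow> complex) \<Rightarrow> bool" where
  "smooth_family H g g' \<longleftrightarrow> (\<forall>h\<in>{0..H}. rapid (g h) \<and> rapid (g' h)) \<and>
    (\<forall>k. \<exists>N. \<forall>h\<in>{0..H}. \<forall>t. cmod (g h (\<Gamma> t)) * (1 + \<bar>t\<bar>) ^ k \<le> N \<and>
      cmod (g' h (\<Gamma> t)) * (1 + \<bar>t\<bar>) ^ k \<le> N \<and>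
      (\<forall>h'\<in>{0..H}. cmod (g h' (\<Gamma> t) - g h (\<Gamma> t) - of_real (h' - h) * g' h (\<Gamma> t)) * (1 + \<bar>t\<bar>) ^ k
        \<le> N * (h' - h)\<^sup>2))"

lemma smooth_familyI:
  assumes cont: "\<And>h. h \<in> {0..H} \<Longrightarrow> continuous_on UNIV (\<lambda>t. g h (\<Gamma> t))"
      "\<And>h. h \<in> {0..H} \<Longrightarrow> continuous_on UNIV (\<lambda>t. g' h (\<Gamma> t))"
    and d1: "\<And>h t. h \<in> {0..H} \<Longrightarrow> ((\<lambda>h. g h (\<Gamma> t)) has_vector_derivative g' h (\<Gamma> t)) (at h within {0..H})"
    and d2: "\<And>h t. h \<in> {0..H} \<Longrightarrow> ((\<lambda>h. g' h (\<Gamma> t)) has_vector_derivative g'' h (\<Gamma> t)) (at h within {0..H})"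
    and \<beta>: "rapid \<beta>0" "rapid \<beta>1" "rapid \<beta>2"
    and dom: "\<And>h t. h \<in> {0..H} \<Longrightarrow> cmod (g h (\<Gamma> t)) \<le> cmod (\<beta>0 (\<Gamma> t))"
      "\<And>h t. h \<in> {0..H} \<Longrightarrow> cmod (g' h (\<Gamma> t)) \<le> cmod (\<beta>1 (\<Gamma> t))"
      "\<And>h t. h \<in> {0..H} \<Longrightarrow> cmod (g'' h (\<Gamma> t)) \<le> cmod (\<beta>2 (\<Gamma> t))"
  shows "smooth_family H g g'"
proof -
  have decay: "\<exists>N. \<forall>t. cmod (\<beta> (\<Gamma> t)) * (1 + \<bar>t\<bar>) ^ k \<le> N" if "rapid \<beta>" for \<beta> k
    using that unfolding rapid_def by blast
  have dominated: "cmod z * (1 + \<bar>t\<bar>) ^ k \<le> N" if "cmod z \<le> cmod w" "cmod w * (1 + \<bar>t\<bar>) ^ k \<le> N" for z w k N and t :: real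
    by (rule order_trans[OF mult_right_mono[OF that(1)] that(2)]) simp
  have dominated_rapid: "rapid f" if f: "continuous_on UNIV (\<lambda>t. f (\<Gamma> t))" and \<beta>: "rapid \<beta>"
    and dom: "\<And>t. cmod (f (\<Gamma> t)) \<le> cmod (\<beta> (\<Gamma> t))" for f \<beta>
    unfolding rapid_def
  proof (intro conjI allI f)
    fix k
    obtain N where "\<And>t. cmod (\<beta> (\<Gamma> t)) * (1 + \<bar>t\<bar>) ^ k \<le> N" using decay[OF \<beta>] by blast
    then have "cmod (f (\<Gamma> t)) * (1 + \<bar>t\<bar>) ^ k \<le> N" for t by (rule dominated[OF dom])
    then show "\<exists>N. \<forall>t. cmod (f (\<Gamma> t)) * (1 + \<bar>t\<bar>) ^ k \<le> N" by blast
  qed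
  have "rapid (g h) \<and> rapid (g' h)" if h: "h \<in> {0..H}" for h
    using dominated_rapid[OF cont(1)[OF h] \<beta>(1) dom(1)[OF h]]
      dominated_rapid[OF cont(2)[OF h] \<beta>(2) dom(2)[OF h]] by simp
  moreover have "\<exists>N. \<forall>h\<in>{0..H}. \<forall>t. cmod (g h (\<Gamma> t)) * (1 + \<bar>t\<bar>) ^ k \<le> N \<and>
      cmod (g' h (\<Gamma> t)) * (1 + \<bar>t\<bar>) ^ k \<le> N \<and>
      (\<forall>h'\<in>{0..H}. cmod (g h' (\<Gamma> t) - g h (\<Gamma> t) - of_real (h' - h) * g' h (\<Gamma> t)) * (1 + \<bar>t\<bar>) ^ k
        \<le> N * (h' - h)\<^sup>2)" for k
  proof -
    obtain N0 N1 N2 where N: "\<And>t. cmod (\<beta>0 (\<Gamma> t)) * (1 + \<bar>t\<bar>) ^ k \<le> N0"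
      "\<And>t. cmod (\<beta>1 (\<Gamma> t)) * (1 + \<bar>t\<bar>) ^ k \<le> N1" "\<And>t. cmod (\<beta>2 (\<Gamma> t)) * (1 + \<bar>t\<bar>) ^ k \<le> N2"
      using decay \<beta> by meson
    have nn: "N0 \<ge> 0" "N1 \<ge> 0" "N2 \<ge> 0"
      using order_trans[OF _ N(1)[of 0]] order_trans[OF _ N(2)[of 0]] order_trans[OF _ N(3)[of 0]] by auto
    show ?thesis
    proof (intro exI[of _ "N0 + N1 + 3 * N2"] ballI allI conjI)
      fix h t assume h: "h \<in> {0..H}"
      show "cmod (g h (\<Gamma> t)) * (1 + \<bar>t\<bar>) ^ k \<le> N0 + N1 + 3 * N2"
        using dominated[OF dom(1)[OF h] N(1)[of t]] nn by linarith
      show "cmod (g' h (\<Gamma> t)) * (1 + \<bar>t\<bar>) ^ k \<le> N0 + N1 + 3 * N2"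
        using dominated[OF dom(2)[OF h] N(2)[of t]] nn by linarith
      fix h' assume h': "h' \<in> {0..H}"
      have "cmod (g h' (\<Gamma> t) - g h (\<Gamma> t) - of_real (h' - h) * g' h (\<Gamma> t))
          \<le> 3 * cmod (\<beta>2 (\<Gamma> t)) * (h' - h)\<^sup>2"
        by (rule quadratic_Taylor_bound[OF d1 d2 dom(3) h h'])
      then have "cmod (g h' (\<Gamma> t) - g h (\<Gamma> t) - of_real (h' - h) * g' h (\<Gamma> t)) * (1 + \<bar>t\<bar>) ^ k
          \<le> 3 * cmod (\<beta>2 (\<Gamma> t)) * (h' - h)\<^sup>2 * (1 + \<bar>t\<bar>) ^ k"
        by (intro mult_right_mono) auto
      also have "\<dots> = 3 * (cmod (\<beta>2 (\<Gamma> t)) * (1 + \<bar>t\<bar>) ^ k) * (h' - h)\<^sup>2" by (simp add: mult_ac)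
      also have "\<dots> \<le> 3 * N2 * (h' - h)\<^sup>2" by (intro mult_right_mono mult_left_mono N) auto
      also have "\<dots> \<le> (N0 + N1 + 3 * N2) * (h' - h)\<^sup>2" using nn by (intro mult_right_mono) auto
      finally show "cmod (g h' (\<Gamma> t) - g h (\<Gamma> t) - of_real (h' - h) * g' h (\<Gamma> t)) * (1 + \<bar>t\<bar>) ^ k
          \<le> (N0 + N1 + 3 * N2) * (h' - h)\<^sup>2" .
    qed
  qed
  ultimately show ?thesis by (simp add: smooth_family_def)
qed

text \<open>
  As \<open>Re \<mu> > 0\<close> on the contour, the exponential for the largest parameter dominates all the others.
\<close>

lemma exp_dominated:
  assumes "\<bar>s\<bar> = 1" "h \<in> {0..H}"
  shows "cmod (exp (of_real s * of_real h * \<Gamma> t)) \<le> cmod (exp (of_real H * \<Gamma> t))"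
proof -
  have "s * h \<le> H" using assms abs_le_D1[of "s * h" h] by (auto simp: abs_mult)
  then have "s * h * Re (\<Gamma> t) \<le> H * Re (\<Gamma> t)" using Re_\<Gamma>_pos[of t] by (intro mult_right_mono) auto
  then show ?thesis by (simp add: norm_exp_eq_Re)
qed

lemma exp_family_derivative:
  fixes z :: complex
  shows "((\<lambda>h. exp (of_real s * of_real h * z)) has_vector_derivative of_real s * z * exp (of_real s * of_real h * z)) (at h within A)"
  by (rule has_vector_derivative_real_field[where f = "\<lambda>w. exp (of_real s * w * z)"])
    (auto intro!: derivative_eq_intros)

lemma rapid_continuous: "rapid g \<Longrightarrow> continuous_on UNIV (\<lambda>t. g (\<Gamma> t))"
  by (simp add: rapid_def)

lemma smooth_family_exp:
  assumes \<theta>: "rapid \<theta>" and s: "\<bar>s\<bar> = 1"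
  shows "smooth_family H (\<lambda>h \<mu>. exp (of_real s * of_real h * \<mu>) * \<theta> \<mu>)
    (\<lambda>h \<mu>. of_real s * \<mu> * (exp (of_real s * of_real h * \<mu>) * \<theta> \<mu>))"
proof -
  let ?e = "\<lambda>\<mu>. exp (of_real H * \<mu>) * \<theta> \<mu>"
  have e: "rapid ?e" by (rule rapid_mult[OF \<theta> tempered_exp])
  have e1: "rapid (\<lambda>\<mu>. \<mu> * ?e \<mu>)" by (rule rapid_mult[OF e tempered_id])
  have e2: "rapid (\<lambda>\<mu>. \<mu> * (\<mu> * ?e \<mu>))" by (rule rapid_mult[OF e1 tempered_id])
  have s': "cmod (of_real s) = 1" using s by simp
  show ?thesis
  proof (rule smooth_familyI[OF _ _ _ _ e e1 e2])
    fix h t assume h: "h \<in> {0..H}"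
    show "continuous_on UNIV (\<lambda>t. exp (of_real s * of_real h * \<Gamma> t) * \<theta> (\<Gamma> t))"
      by (intro continuous_intros continuous_\<Gamma> rapid_continuous \<theta>)
    show "continuous_on UNIV (\<lambda>t. of_real s * \<Gamma> t * (exp (of_real s * of_real h * \<Gamma> t) * \<theta> (\<Gamma> t)))"
      by (intro continuous_intros continuous_\<Gamma> rapid_continuous \<theta>)
    let ?z = "\<Gamma> t"
    show "((\<lambda>h. exp (of_real s * of_real h * ?z) * \<theta> ?z) has_vector_derivative
        of_real s * ?z * (exp (of_real s * of_real h * ?z) * \<theta> ?z)) (at h within {0..H})"
      using has_vector_derivative_mult_left[OF exp_family_derivative[of s ?z h "{0..H}"], of "\<theta> ?z"]
      by (simp add: mult.assoc)
    show "((\<lambda>h. of_real s * ?z * (exp (of_real s * of_real h * ?z) * \<theta> ?z)) has_vector_derivative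
        of_real s * ?z * (of_real s * ?z * (exp (of_real s * of_real h * ?z) * \<theta> ?z))) (at h within {0..H})"
      using has_vector_derivative_mult_right[OF has_vector_derivative_mult_left[OF
          exp_family_derivative[of s ?z h "{0..H}"], of "\<theta> ?z"], of "of_real s * ?z"]
      by (simp add: mult.assoc)
    have 0: "cmod (exp (of_real s * of_real h * ?z) * \<theta> ?z) \<le> cmod (?e ?z)"
      unfolding norm_mult by (intro mult_right_mono exp_dominated s h) auto
    show "cmod (exp (of_real s * of_real h * ?z) * \<theta> ?z) \<le> cmod (?e ?z)" by (rule 0)
    have 1: "cmod (of_real s * ?z * w) \<le> cmod (?z * v)" if "cmod w \<le> cmod v" for w v
      using that s' by (simp add: norm_mult mult_left_mono)
    show "cmod (of_real s * ?z * (exp (of_real s * of_real h * ?z) * \<theta> ?z)) \<le> cmod (?z * ?e ?z)"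
      by (rule 1[OF 0])
    show "cmod (of_real s * ?z * (of_real s * ?z * (exp (of_real s * of_real h * ?z) * \<theta> ?z)))
        \<le> cmod (?z * (?z * ?e ?z))"
      by (rule 1[OF 1[OF 0]])
  qed
qed

lemma smooth_family_half_hat:
  assumes \<theta>: "rapid \<theta>" and s: "\<bar>s\<bar> = 1" and H: "H \<ge> 0"
    and w: "\<And>r. (w has_vector_derivative w' r) (at r)"
    and B: "\<And>r. cmod (w r) \<le> B" "\<And>r. cmod (w' r) \<le> B"
  shows "smooth_family H (\<lambda>h \<mu>. half_hat w h (of_real s * \<mu>) * \<theta> \<mu>)
    (\<lambda>h \<mu>. w h * (exp (of_real s * of_real h * \<mu>) * \<theta> \<mu>))"
proof -
  let ?e = "\<lambda>\<mu>. exp (of_real H * \<mu>) * \<theta> \<mu>"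
  have e: "rapid ?e" by (rule rapid_mult[OF \<theta> tempered_exp])
  have e0: "rapid (\<lambda>\<mu>. of_real (H * B) * ?e \<mu>)" by (rule rapid_scale[OF e])
  have e1: "rapid (\<lambda>\<mu>. of_real B * ?e \<mu>)" by (rule rapid_scale[OF e])
  have e2: "rapid (\<lambda>\<mu>. (of_real B + of_real B * of_real (cmod \<mu>)) * ?e \<mu>)"
  proof (rule rapid_mult[OF e])
    obtain c where c: "\<And>t. 1 + cmod (\<Gamma> t) \<le> c * (1 + \<bar>t\<bar>)" using norm_\<Gamma>_growth by blast
    have B0: "B \<ge> 0" using order_trans[OF norm_ge_zero B(1)] .
    have "cmod (of_real B + of_real B * of_real (cmod (\<Gamma> t))) \<le> B * c * (1 + \<bar>t\<bar>) ^ 1" for t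
    proof -
      have "of_real B + of_real B * complex_of_real (cmod (\<Gamma> t)) = of_real (B * (1 + cmod (\<Gamma> t)))"
        by (simp add: distrib_left)
      then have "cmod (of_real B + of_real B * of_real (cmod (\<Gamma> t))) = B * (1 + cmod (\<Gamma> t))"
        using B0 by (simp only: norm_of_real abs_of_nonneg mult_nonneg_nonneg add_nonneg_nonneg norm_ge_zero zero_le_one)
      also have "\<dots> \<le> B * (c * (1 + \<bar>t\<bar>))" using c B0 by (intro mult_left_mono)
      finally show ?thesis by simp
    qed
    moreover have "continuous_on UNIV (\<lambda>t. of_real B + of_real B * complex_of_real (cmod (\<Gamma> t)))"
      by (intro continuous_intros continuous_\<Gamma>)
    ultimately show "tempered (\<lambda>\<mu>. of_real B + of_real B * of_real (cmod \<mu>))" unfolding tempered_def by blast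
  qed
  have B0: "B \<ge> 0" using order_trans[OF norm_ge_zero B(1)] .
  have wc: "continuous_on A w" for A
    using w by (meson continuous_at_imp_continuous_on has_vector_derivative_continuous)
  show ?thesis
  proof (rule smooth_familyI[OF _ _ _ _ e0 e1 e2])
    fix h t assume h: "h \<in> {0..H}"
    have "continuous_on (UNIV \<times> cbox 0 h) (\<lambda>(z, r). w r * exp (z * complex_of_real r))"
      unfolding case_prod_unfold
      by (intro continuous_intros continuous_on_compose2[OF wc[of UNIV]]) auto
    from integral_continuous_on_param[OF this]
    have hc: "continuous_on UNIV (half_hat w h)" by (simp add: half_hat_def)
    show "continuous_on UNIV (\<lambda>t. half_hat w h (of_real s * \<Gamma> t) * \<theta> (\<Gamma> t))"
      by (intro continuous_on_mult continuous_on_compose2[OF hc] rapid_continuous \<theta> continuous_on_const continuous_\<Gamma>) auto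
    show "continuous_on UNIV (\<lambda>t. w h * (exp (of_real s * of_real h * \<Gamma> t) * \<theta> (\<Gamma> t)))"
      by (intro continuous_intros continuous_\<Gamma> rapid_continuous \<theta>)
    let ?z = "\<Gamma> t"
    let ?E = "exp (of_real s * of_real h * ?z)"
    have ic: "continuous_on {0..H} (\<lambda>r. w r * exp (of_real s * ?z * complex_of_real r))"
      by (intro continuous_intros wc)
    have "((\<lambda>h. half_hat w h (of_real s * ?z)) has_vector_derivative w h * exp (of_real s * ?z * of_real h)) (at h within {0..H})"
      unfolding half_hat_def by (rule integral_has_vector_derivative[OF ic h])
    from has_vector_derivative_mult_left[OF this, of "\<theta> ?z"]
    show "((\<lambda>h. half_hat w h (of_real s * ?z) * \<theta> ?z) has_vector_derivative w h * (?E * \<theta> ?z)) (at h within {0..H})"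
      by (simp add: mult_ac)
    have "((\<lambda>h. w h * exp (of_real s * of_real h * ?z)) has_vector_derivative
        w h * (of_real s * ?z * ?E) + w' h * ?E) (at h within {0..H})"
      by (rule has_vector_derivative_mult[OF has_vector_derivative_at_within[OF w] exp_family_derivative])
    from has_vector_derivative_mult_left[OF this, of "\<theta> ?z"]
    show "((\<lambda>h. w h * (exp (of_real s * of_real h * ?z) * \<theta> ?z)) has_vector_derivative
        (w h * (of_real s * ?z) + w' h) * (?E * \<theta> ?z)) (at h within {0..H})"
      by (simp add: algebra_simps)
    have E0: "cmod (?E * \<theta> ?z) \<le> cmod (?e ?z)"
      unfolding norm_mult by (intro mult_right_mono exp_dominated s h) auto
    have "cmod (half_hat w h (of_real s * ?z)) \<le> B * cmod (exp (of_real H * ?z)) * (h - 0)"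
      unfolding half_hat_def
    proof (rule integral_bound)
      show "continuous_on {0..h} (\<lambda>r. w r * exp (of_real s * ?z * complex_of_real r))"
        by (intro continuous_intros wc)
      fix r assume r: "r \<in> {0..h}"
      then have "cmod (exp (of_real s * of_real r * ?z)) \<le> cmod (exp (of_real H * ?z))"
        using h by (intro exp_dominated s) auto
      then show "cmod (w r * exp (of_real s * ?z * complex_of_real r)) \<le> B * cmod (exp (of_real H * ?z))"
        using B(1)[of r] B0 unfolding norm_mult by (intro mult_mono) (auto simp: mult_ac)
    qed (use h in auto)
    also have "\<dots> \<le> B * cmod (exp (of_real H * ?z)) * H" using h B0 by (intro mult_left_mono) auto
    finally have "cmod (half_hat w h (of_real s * ?z)) * cmod (\<theta> ?z) \<le> B * cmod (exp (of_real H * ?z)) * H * cmod (\<theta> ?z)"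
      by (rule mult_right_mono) simp
    then show "cmod (half_hat w h (of_real s * ?z) * \<theta> ?z) \<le> cmod (of_real (H * B) * ?e ?z)"
      using H B0 by (simp add: norm_mult mult_ac)
    show "cmod (w h * (?E * \<theta> ?z)) \<le> cmod (of_real B * ?e ?z)"
      unfolding norm_mult[of "w h"] norm_mult[of "of_real B"] using B(1)[of h] E0 B0 by (intro mult_mono) auto
    have "cmod (w h * (of_real s * ?z) + w' h) \<le> B * cmod ?z + B"
    proof (rule order_trans[OF norm_triangle_ineq add_mono])
      show "cmod (w h * (of_real s * ?z)) \<le> B * cmod ?z"
        using B(1)[of h] s by (simp add: norm_mult mult_right_mono)
    qed (rule B(2))
    also have "\<dots> = cmod (of_real B + of_real B * of_real (cmod ?z))"
    proof -
      have "of_real B + of_real B * complex_of_real (cmod ?z) = of_real (B + B * cmod ?z)" by simp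
      then show ?thesis using B0 by (simp only: norm_of_real) simp
    qed
    finally show "cmod ((w h * (of_real s * ?z) + w' h) * (?E * \<theta> ?z))
        \<le> cmod ((of_real B + of_real B * of_real (cmod ?z)) * ?e ?z)"
      unfolding norm_mult[of "w h * _ + _"] norm_mult[of "of_real B + _"] using E0 by (intro mult_mono) auto
  qed
qed

end

context contour_calculus
begin

lemma smooth_family_S:
  assumes sf: "smooth_family H g g'" and p: "cseminorm p"
  shows "\<exists>q K. cseminorm q \<and> K \<ge> 0 \<and> (\<forall>h\<in>{0..H}. \<forall>x. p (S (g h) x) \<le> K * q x \<and> p (S (g' h) x) \<le> K * q x \<and>
    (\<forall>h'\<in>{0..H}. p (S (g h') x - S (g h) x - of_real (h' - h) *\<^sub>C S (g' h) x) \<le> K * (h' - h)\<^sup>2 * q x))"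
proof -
  obtain q c where q: "cseminorm q" "c \<ge> 0"
    "\<forall>g N x. rapid g \<longrightarrow> (\<forall>t. cmod (g (\<Gamma> t)) * (1 + \<bar>t\<bar>) ^ (n + 2) \<le> N) \<longrightarrow> p (S g x) \<le> c * N * q x"
    using S_bound[OF p] by blast
  have r: "rapid (g h)" "rapid (g' h)" if "h \<in> {0..H}" for h using sf that by (auto simp: smooth_family_def)
  obtain N where N: "\<forall>h\<in>{0..H}. \<forall>t. cmod (g h (\<Gamma> t)) * (1 + \<bar>t\<bar>) ^ (n + 2) \<le> N \<and>
      cmod (g' h (\<Gamma> t)) * (1 + \<bar>t\<bar>) ^ (n + 2) \<le> N \<and>
      (\<forall>h'\<in>{0..H}. cmod (g h' (\<Gamma> t) - g h (\<Gamma> t) - of_real (h' - h) * g' h (\<Gamma> t)) * (1 + \<bar>t\<bar>) ^ (n + 2)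
        \<le> N * (h' - h)\<^sup>2)"
    using sf unfolding smooth_family_def by blast
  have N': "\<bar>N\<bar> \<ge> N" by simp
  have q0: "q x \<ge> 0" for x using seminorm_nonneg[OF cseminorm_seminorm[OF q(1)]] .
  have up: "c * N * q x \<le> c * \<bar>N\<bar> * q x" for x using q(2) q0 by (intro mult_right_mono mult_left_mono) auto
  show ?thesis
  proof (intro exI[of _ q] exI[of _ "c * \<bar>N\<bar>"] conjI ballI allI)
    show "cseminorm q" "c * \<bar>N\<bar> \<ge> 0" using q by auto
    fix h x assume h: "h \<in> {0..H}"
    show "p (S (g h) x) \<le> c * \<bar>N\<bar> * q x"
      by (rule order_trans[OF q(3)[rule_format, OF r(1)[OF h]] up])
        (rule N[rule_format, OF h, THEN conjunct1])
    show "p (S (g' h) x) \<le> c * \<bar>N\<bar> * q x"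
      by (rule order_trans[OF q(3)[rule_format, OF r(2)[OF h]] up])
        (rule N[rule_format, OF h, THEN conjunct2, THEN conjunct1])
    fix h' assume h': "h' \<in> {0..H}"
    let ?k = "complex_of_real (h' - h)"
    have rd: "rapid (\<lambda>\<mu>. g h' \<mu> - g h \<mu>)" by (rule rapid_diff[OF r(1)[OF h'] r(1)[OF h]])
    have rs: "rapid (\<lambda>\<mu>. ?k * g' h \<mu>)" by (rule rapid_scale[OF r(2)[OF h]])
    have "S (\<lambda>\<mu>. g h' \<mu> - g h \<mu> - ?k * g' h \<mu>) x = S (g h') x - S (g h) x - ?k *\<^sub>C S (g' h) x"
      by (simp only: S_diff[OF rd rs] S_diff[OF r(1)[OF h'] r(1)[OF h]] S_scale[OF r(2)[OF h]])
    moreover have "p (S (\<lambda>\<mu>. g h' \<mu> - g h \<mu> - ?k * g' h \<mu>) x) \<le> c * (N * (h' - h)\<^sup>2) * q x"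
    proof (rule q(3)[rule_format, OF rapid_diff[OF rd rs]])
      show "cmod (g h' (\<Gamma> t) - g h (\<Gamma> t) - ?k * g' h (\<Gamma> t)) * (1 + \<bar>t\<bar>) ^ (n + 2) \<le> N * (h' - h)\<^sup>2" for t
        by (rule N[rule_format, OF h, THEN conjunct2, THEN conjunct2, rule_format, OF h'])
    qed
    moreover have "c * (N * (h' - h)\<^sup>2) * q x \<le> c * \<bar>N\<bar> * (h' - h)\<^sup>2 * q x"
    proof -
      have "c * (N * (h' - h)\<^sup>2) * q x = c * N * q x * (h' - h)\<^sup>2" by (simp add: mult_ac)
      also have "\<dots> \<le> c * \<bar>N\<bar> * q x * (h' - h)\<^sup>2" by (rule mult_right_mono[OF up]) simp
      finally show ?thesis by (simp add: mult_ac)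
    qed
    ultimately show "p (S (g h') x - S (g h) x - ?k *\<^sub>C S (g' h) x) \<le> c * \<bar>N\<bar> * (h' - h)\<^sup>2 * q x" by simp
  qed
qed

text \<open>
  The product rule. With \<open>k = h' - h\<close> the remainder is the sum of \<open>t1\<close>, the remainder of the outer
  factor, of \<open>t3\<close>, that of the inner factor, and of \<open>t2\<close>, the product of \<open>k\<close> with the increment of the
  inner factor.
\<close>

lemma smooth_family_S_S:
  assumes g: "smooth_family H g g'" and f: "smooth_family H f f'" and p: "cseminorm p"
  shows "\<exists>K. \<forall>h\<in>{0..H}. \<forall>h'\<in>{0..H}. p (S (g h') (S (f h') x) - S (g h) (S (f h) x)
    - of_real (h' - h) *\<^sub>C (S (g' h) (S (f h) x) + S (g h) (S (f' h) x))) \<le> K * (h' - h)\<^sup>2"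
proof -
  obtain q K where q: "cseminorm q" "K \<ge> 0" "\<forall>h\<in>{0..H}. \<forall>x. p (S (g h) x) \<le> K * q x \<and> p (S (g' h) x) \<le> K * q x \<and>
    (\<forall>h'\<in>{0..H}. p (S (g h') x - S (g h) x - of_real (h' - h) *\<^sub>C S (g' h) x) \<le> K * (h' - h)\<^sup>2 * q x)"
    using smooth_family_S[OF g p] by blast
  obtain q1 L where q1: "cseminorm q1" "L \<ge> 0" "\<forall>h\<in>{0..H}. \<forall>x. q (S (f h) x) \<le> L * q1 x \<and> q (S (f' h) x) \<le> L * q1 x \<and>
    (\<forall>h'\<in>{0..H}. q (S (f h') x - S (f h) x - of_real (h' - h) *\<^sub>C S (f' h) x) \<le> L * (h' - h)\<^sup>2 * q1 x)"
    using smooth_family_S[OF f q(1)] by blast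
  note p' = cseminorm_seminorm[OF p] and q' = cseminorm_seminorm[OF q(1)]
  have x0: "q1 x \<ge> 0" using seminorm_nonneg[OF cseminorm_seminorm[OF q1(1)]] .
  define M where "M = L * q1 x"
  have M0: "M \<ge> 0" using q1 x0 by (simp add: M_def)
  show ?thesis
  proof (intro exI[of _ "K * M * (H + 3)"] ballI)
    fix h h' assume h: "h \<in> {0..H}" "h' \<in> {0..H}"
    define k where "k = h' - h"
    have kH: "\<bar>k\<bar> \<le> H" using h by (auto simp: k_def)
    have rg: "rapid (g h)" "rapid (g' h)" "rapid (g h')" using g h by (auto simp: smooth_family_def)
    define y y' yh where "y = S (f h) x" and "y' = S (f' h) x" and "yh = S (f h') x"
    have lin: "S (g h) (u - v) = S (g h) u - S (g h) v" "S (g' h) (u - v) = S (g' h) u - S (g' h) v"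
      "S (g h) (c *\<^sub>C u) = c *\<^sub>C S (g h) u" for u v c
      using clin_diff[OF S_clin[OF rg(1)]] clin_diff[OF S_clin[OF rg(2)]] clin_scale[OF S_clin[OF rg(1)]] by auto
    have dy: "q (yh - y - of_real k *\<^sub>C y') \<le> M * k\<^sup>2"
      using q1(3)[rule_format, OF h(1), of x] h(2) by (simp add: y_def y'_def yh_def k_def M_def mult_ac)
    have y'b: "q y' \<le> M" and yhb: "q yh \<le> M"
      using q1(3) h by (simp_all add: y'_def yh_def M_def)
    have "q (yh - y) \<le> q (yh - y - of_real k *\<^sub>C y') + q (of_real k *\<^sub>C y')"
      using seminorm_add[OF q', of "yh - y - of_real k *\<^sub>C y'" "of_real k *\<^sub>C y'"] by simp
    also have "q (of_real k *\<^sub>C y') \<le> \<bar>k\<bar> * M" using y'b by (simp add: seminorm_scaleC[OF q'] mult_left_mono)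
    also have "q (yh - y - of_real k *\<^sub>C y') \<le> \<bar>k\<bar> * (H * M)"
    proof -
      have "k\<^sup>2 = \<bar>k\<bar> * \<bar>k\<bar>" by (simp add: power2_eq_square)
      then have "M * k\<^sup>2 = \<bar>k\<bar> * (\<bar>k\<bar> * M)" by (simp only: mult_ac)
      also have "\<dots> \<le> \<bar>k\<bar> * (H * M)" using kH M0 by (intro mult_left_mono mult_right_mono) auto
      finally show ?thesis using dy by linarith
    qed
    finally have dy1: "q (yh - y) \<le> \<bar>k\<bar> * ((H + 1) * M)" by (simp add: algebra_simps)
    define t1 t2 t3 where "t1 = S (g h') yh - S (g h) yh - of_real k *\<^sub>C S (g' h) yh"
      and "t2 = of_real k *\<^sub>C S (g' h) (yh - y)" and "t3 = S (g h) (yh - y - of_real k *\<^sub>C y')"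
    have "S (g h') yh - S (g h) y - of_real k *\<^sub>C (S (g' h) y + S (g h) y') = t1 + (t2 + t3)"
      by (simp add: t1_def t2_def t3_def lin complex_vector.scale_right_diff_distrib scaleC_add_right)
    then have "p (S (g h') yh - S (g h) y - of_real k *\<^sub>C (S (g' h) y + S (g h) y')) \<le> p t1 + (p t2 + p t3)"
      using seminorm_add[OF p', of t1 "t2 + t3"] seminorm_add[OF p', of t2 t3] by simp
    also have "p t1 \<le> K * k\<^sup>2 * M"
    proof -
      have "p t1 \<le> K * k\<^sup>2 * q yh" using q(3) h by (simp add: t1_def k_def)
      also have "\<dots> \<le> K * k\<^sup>2 * M" using q(2) yhb by (intro mult_left_mono) auto
      finally show ?thesis .
    qed
    also have "p t2 \<le> K * M * (H + 1) * k\<^sup>2"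
    proof -
      have "p (S (g' h) (yh - y)) \<le> K * q (yh - y)" using q(3) h by blast
      also have "\<dots> \<le> K * (\<bar>k\<bar> * ((H + 1) * M))" using dy1 q(2) by (intro mult_left_mono)
      finally have "p t2 \<le> \<bar>k\<bar> * (K * (\<bar>k\<bar> * ((H + 1) * M)))"
        by (simp add: t2_def seminorm_scaleC[OF p'] mult_left_mono)
      also have "\<dots> = K * M * (H + 1) * (\<bar>k\<bar> * \<bar>k\<bar>)" by (simp add: mult_ac)
      finally show ?thesis by (simp add: power2_eq_square)
    qed
    also have "p t3 \<le> K * M * k\<^sup>2"
    proof -
      have "p t3 \<le> K * q (yh - y - of_real k *\<^sub>C y')" using q(3) h by (simp add: t3_def)
      also have "\<dots> \<le> K * (M * k\<^sup>2)" using dy q(2) by (intro mult_left_mono)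
      finally show ?thesis by simp
    qed
    finally show "p (S (g h') (S (f h') x) - S (g h) (S (f h) x)
        - of_real (h' - h) *\<^sub>C (S (g' h) (S (f h) x) + S (g h) (S (f' h) x))) \<le> K * M * (H + 3) * (h' - h)\<^sup>2"
      by (simp add: y_def y'_def yh_def k_def algebra_simps)
  qed
qed

text \<open>
  With \<open>g1 h\<close> and \<open>g2 h\<close> the transforms of \<open>\<phi>\<close> translated to the left and of \<open>\<psi>\<close> translated to the right
  by \<open>h\<close>, the curves \<open>W h = S (g1 h) (S (g2 h) x)\<close> and \<open>V\<close> have the same derivative \<open>D\<close>. At \<open>h = m\<close> the
  first translate is supported in \<open>{..0}\<close>, whence \<open>W m = 0\<close>, and \<open>V m\<close> is given by the transform of
  \<open>\<phi> *\<^sub>0 \<psi>\<close>; at \<open>h = 0\<close> the curve \<open>V\<close> vanishes and \<open>W\<close> is the product in question.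
\<close>

theorem S_hat_product:
  assumes \<phi>: "\<phi> \<in> \<D>" and \<psi>: "\<psi> \<in> \<D>"
  shows "S (hat \<phi>) (S (hat \<psi>) x) = \<i> *\<^sub>C S (hat (\<phi> *\<^sub>0 \<psi>)) (C x)"
proof -
  obtain m1 where m1: "m1 > 0" "supp \<phi> \<subseteq> {-m1..m1}" using test_fun_support[OF \<phi>] .
  obtain m2 where m2: "m2 > 0" "supp \<psi> \<subseteq> {-m2..m2}" using test_fun_support[OF \<psi>] .
  \<comment> \<open>Larger than \<open>m1\<close> and \<open>m2\<close>, so that \<open>\<phi>\<close> and \<open>\<psi>\<close> vanish at \<open>m\<close> and \<open>- m\<close> as well.\<close>
  define m where "m = m1 + m2"
  have m: "m > 0" using m1 m2 by (simp add: m_def)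
  have "{-m1..m1} \<subseteq> {-m..m}" "{-m2..m2} \<subseteq> {-m..m}" using m1(1) m2(1) by (auto simp: m_def)
  then have s: "supp \<phi> \<subseteq> {-m..m}" "supp \<psi> \<subseteq> {-m..m}" using m1 m2 by blast+
  have z: "\<phi> x = 0" "\<psi> x = 0" if x: "\<bar>x\<bar> \<ge> m" for x
  proof -
    have "x \<notin> {-m1..m1}" "x \<notin> {-m2..m2}" using x m1(1) m2(1) by (auto simp: m_def)
    then show "\<phi> x = 0" "\<psi> x = 0" using m1(2) m2(2) test_fun_zero by blast+
  qed
  define g1 where "g1 h \<mu> = exp (of_real (- 1) * of_real h * \<mu>) * hat \<phi> \<mu>" for h \<mu>
  define g1' where "g1' h \<mu> = of_real (- 1) * \<mu> * (exp (of_real (- 1) * of_real h * \<mu>) * hat \<phi> \<mu>)" for h \<mu>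
  define g2 where "g2 h \<mu> = exp (of_real 1 * of_real h * \<mu>) * hat \<psi> \<mu>" for h \<mu>
  define g2' where "g2' h \<mu> = of_real 1 * \<mu> * (exp (of_real 1 * of_real h * \<mu>) * hat \<psi> \<mu>)" for h \<mu>
  define u where "u h \<mu> = half_hat (\<lambda>r. \<psi> (- r)) h (of_real (- 1) * \<mu>) * hat \<phi> \<mu>" for h \<mu>
  define u' where "u' h \<mu> = \<psi> (- h) * (exp (of_real (- 1) * of_real h * \<mu>) * hat \<phi> \<mu>)" for h \<mu>
  define v where "v h \<mu> = half_hat \<phi> h (of_real 1 * \<mu>) * hat \<psi> \<mu>" for h \<mu>
  define v' where "v' h \<mu> = \<phi> h * (exp (of_real 1 * of_real h * \<mu>) * hat \<psi> \<mu>)" for h \<mu>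
  note r\<phi> = rapid_hat[OF \<phi>] and r\<psi> = rapid_hat[OF \<psi>]
  have sf1: "smooth_family m g1 g1'" unfolding g1_def[abs_def] g1'_def[abs_def]
    by (rule smooth_family_exp[OF r\<phi>]) simp
  have sf2: "smooth_family m g2 g2'" unfolding g2_def[abs_def] g2'_def[abs_def]
    by (rule smooth_family_exp[OF r\<psi>]) simp
  obtain B1 where B1: "B1 \<ge> 0" "\<And>t. cmod (\<phi> t) \<le> B1" using test_fun_bounded[OF \<phi>] by blast
  obtain B2 where B2: "B2 \<ge> 0" "\<And>t. cmod (vd \<phi> t) \<le> B2" using test_fun_bounded[OF vd_test_fun[OF \<phi>]] by blast
  obtain B3 where B3: "B3 \<ge> 0" "\<And>t. cmod (\<psi> t) \<le> B3" using test_fun_bounded[OF \<psi>] by blast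
  obtain B4 where B4: "B4 \<ge> 0" "\<And>t. cmod (vd \<psi> t) \<le> B4" using test_fun_bounded[OF vd_test_fun[OF \<psi>]] by blast
  have sfv: "smooth_family m v v'" unfolding v_def[abs_def] v'_def[abs_def]
  proof (rule smooth_family_half_hat[OF r\<psi> _ _ test_fun_has_derivative[OF \<phi>]])
    show "cmod (\<phi> r) \<le> B1 + B2" "cmod (vd \<phi> r) \<le> B1 + B2" for r
      using B1(1) B1(2)[of r] B2(1) B2(2)[of r] by linarith+
  qed (use m in auto)
  have sfu: "smooth_family m u u'" unfolding u_def[abs_def] u'_def[abs_def]
  proof (rule smooth_family_half_hat[OF r\<phi>])
    show "((\<lambda>r. \<psi> (- r)) has_vector_derivative - vd \<psi> (- r)) (at r)" for r
    proof -
      have "((\<lambda>r. - r) has_vector_derivative - 1) (at r)" by (auto intro!: derivative_eq_intros)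
      from vector_diff_chain_at[OF this test_fun_has_derivative[OF \<psi>]] show ?thesis by (simp add: o_def)
    qed
    show "cmod (\<psi> (- r)) \<le> B3 + B4" "cmod (- vd \<psi> (- r)) \<le> B3 + B4" for r
      using B3(1) B3(2)[of "- r"] B4(1) B4(2)[of "- r"] by (simp_all add: add_increasing add_increasing2)
  qed (use m in auto)
  define W where "W h = S (g1 h) (S (g2 h) x)" for h
  define V where "V h = \<i> *\<^sub>C (S (u h) (C x) - S (v h) (C x))" for h
  define D where "D h = \<i> *\<^sub>C (S (u' h) (C x) - S (v' h) (C x))" for h
  have hat1: "hat (shift h \<phi>) = g1 h" and hat2: "hat (shift (- h) \<psi>) = g2 h" for h
    by (auto simp: fun_eq_iff hat_shift g1_def g2_def)
  have rg: "rapid (g1 h)" "rapid (g2 h)" for h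
    unfolding hat1[symmetric] hat2[symmetric] by (intro rapid_hat shift_test_fun \<phi> \<psi>)+
  have ctr12: "contour_int (g1 h) = \<i> * \<phi> h" "contour_int (g2 h) = \<i> * \<psi> (- h)" for h
    unfolding hat1[symmetric] hat2[symmetric] using contour_int_hat[OF shift_test_fun] \<phi> \<psi> by (simp_all add: shift_def)
  \<comment> \<open>The product rule turns the derivative of \<open>W\<close> into the expression that \<open>S_S\<close> evaluates.\<close>
  have W': "S (g1' h) (S (g2 h) x) + S (g1 h) (S (g2' h) x) = D h" for h
  proof -
    have 1: "S (g1' h) y = - S (\<lambda>\<mu>. \<mu> * g1 h \<mu>) y" for y
      using S_scale[OF rapid_mult[OF rg(1) tempered_id], of "- 1" h y]
      by (simp add: g1'_def[abs_def] g1_def[abs_def] complex_vector.scale_minus_left scaleC_one)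
    have 2: "S (g2' h) = S (\<lambda>\<mu>. \<mu> * g2 h \<mu>)" by (simp add: g2'_def[abs_def] g2_def[abs_def])
    have 3: "S (u' h) y = \<psi> (- h) *\<^sub>C S (g1 h) y" for y
      using S_scale[OF rg(1)[of h], of "\<psi> (- h)" y] by (simp add: u'_def[abs_def] g1_def[abs_def])
    have 4: "S (v' h) y = \<phi> h *\<^sub>C S (g2 h) y" for y
      using S_scale[OF rg(2)[of h], of "\<phi> h" y] by (simp add: v'_def[abs_def] g2_def[abs_def])
    have "S (g1' h) (S (g2 h) x) + S (g1 h) (S (g2' h) x)
        = - (S (\<lambda>\<mu>. \<mu> * g1 h \<mu>) (S (g2 h) x) - S (g1 h) (S (\<lambda>\<mu>. \<mu> * g2 h \<mu>) x))"
      unfolding 1 2 by simp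
    also have "\<dots> = contour_int (g2 h) *\<^sub>C S (g1 h) (C x) - contour_int (g1 h) *\<^sub>C S (g2 h) (C x)"
      unfolding S_S[OF rg] by simp
    also have "\<dots> = D h"
      unfolding ctr12 D_def 3 4 by (simp add: complex_vector.scale_right_diff_distrib)
    finally show ?thesis .
  qed
  have "W m - V m = W 0 - V 0"
  proof (rule quadratic_variation_constant[where Z = "\<lambda>h. W h - V h"])
    show "m \<ge> 0" using m by simp
    fix p :: "'a \<Rightarrow> real" assume p: "cseminorm p"
    note p' = cseminorm_seminorm[OF p]
    obtain K1 where K1: "\<forall>h\<in>{0..m}. \<forall>h'\<in>{0..m}. p (W h' - W h - of_real (h' - h) *\<^sub>C D h) \<le> K1 * (h' - h)\<^sup>2"
      using smooth_family_S_S[OF sf1 sf2 p, of x] unfolding W_def W'[symmetric] by blast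
    obtain q K2 where K2: "\<forall>h\<in>{0..m}. \<forall>x. p (S (u h) x) \<le> K2 * q x \<and> p (S (u' h) x) \<le> K2 * q x \<and>
      (\<forall>h'\<in>{0..m}. p (S (u h') x - S (u h) x - of_real (h' - h) *\<^sub>C S (u' h) x) \<le> K2 * (h' - h)\<^sup>2 * q x)"
      using smooth_family_S[OF sfu p] by blast
    obtain r K3 where K3: "\<forall>h\<in>{0..m}. \<forall>x. p (S (v h) x) \<le> K3 * r x \<and> p (S (v' h) x) \<le> K3 * r x \<and>
      (\<forall>h'\<in>{0..m}. p (S (v h') x - S (v h) x - of_real (h' - h) *\<^sub>C S (v' h) x) \<le> K3 * (h' - h)\<^sup>2 * r x)"
      using smooth_family_S[OF sfv p] by blast
    show "\<exists>K. \<forall>h\<in>{0..m}. \<forall>h'\<in>{0..m}. p (W h' - V h' - (W h - V h)) \<le> K * (h' - h)\<^sup>2"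
    proof (intro exI[of _ "K1 + (K2 * q (C x) + K3 * r (C x))"] ballI)
      fix h h' assume h: "h \<in> {0..m}" "h' \<in> {0..m}"
      let ?k = "complex_of_real (h' - h)"
      define w1 where "w1 = W h' - W h - ?k *\<^sub>C D h"
      define w2 where "w2 = S (u h') (C x) - S (u h) (C x) - ?k *\<^sub>C S (u' h) (C x)"
      define w3 where "w3 = S (v h') (C x) - S (v h) (C x) - ?k *\<^sub>C S (v' h) (C x)"
      have "W h' - V h' - (W h - V h) = w1 - \<i> *\<^sub>C (w2 - w3)"
        unfolding w1_def w2_def w3_def V_def D_def
        by (simp add: complex_vector.scale_right_diff_distrib mult.commute)
      then have "p (W h' - V h' - (W h - V h)) \<le> p w1 + (p w2 + p w3)"
        using seminorm_diff[OF p', of w1 "\<i> *\<^sub>C (w2 - w3)"] seminorm_diff[OF p', of w2 w3]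
        by (simp add: seminorm_scaleC[OF p'])
      also have "p w1 \<le> K1 * (h' - h)\<^sup>2" using K1 h by (simp add: w1_def)
      also have "p w2 \<le> K2 * (h' - h)\<^sup>2 * q (C x)" using K2 h by (simp add: w2_def)
      also have "p w3 \<le> K3 * (h' - h)\<^sup>2 * r (C x)" using K3 h by (simp add: w3_def)
      finally show "p (W h' - V h' - (W h - V h)) \<le> (K1 + (K2 * q (C x) + K3 * r (C x))) * (h' - h)\<^sup>2"
        by (simp add: algebra_simps)
    qed
  qed
  moreover have "W m = 0"
  proof -
    have "supp (shift m \<phi>) \<subseteq> {- m - m..m - m}" by (rule shift_support[OF s(1)])
    also have "\<dots> \<subseteq> {..0}" by auto
    finally show ?thesis unfolding W_def hat1[symmetric] by (rule S_hat_eq_zero[OF shift_test_fun[OF \<phi>]])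
  qed
  moreover have "W 0 = S (hat \<phi>) (S (hat \<psi>) x)"
    by (simp add: W_def g1_def[abs_def] g2_def[abs_def])
  moreover have "V 0 = 0"
  proof -
    have "S (\<lambda>\<mu>. 0) y = 0" for y
      using S_scale[OF r\<phi>, of 0 y] by simp
    then show ?thesis by (simp add: V_def u_def[abs_def] v_def[abs_def] half_hat_def)
  qed
  moreover have "V m = - (\<i> *\<^sub>C S (hat (\<phi> *\<^sub>0 \<psi>)) (C x))"
  proof -
    have "rapid (u m)" "rapid (v m)" using sfu sfv m by (auto simp: smooth_family_def)
    moreover have "hat (\<phi> *\<^sub>0 \<psi>) = (\<lambda>\<mu>. v m \<mu> - u m \<mu>)"
      by (rule ext) (simp add: hat_conv0[OF \<phi> \<psi> m s z] u_def v_def)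
    ultimately have "S (hat (\<phi> *\<^sub>0 \<psi>)) (C x) = S (v m) (C x) - S (u m) (C x)" by (simp add: S_diff)
    then show ?thesis by (simp add: V_def complex_vector.scale_right_diff_distrib)
  qed
  ultimately show ?thesis by simp
qed

lemma S_graph:
  assumes g: "rapid g" and xy: "\<And>\<mu>. \<mu> \<in> E \<Longrightarrow> \<mu> *\<^sub>C F \<mu> x - C x = F \<mu> y"
  shows "S (\<lambda>\<mu>. \<mu> * g \<mu>) x - S g y = contour_int g *\<^sub>C C x"
proof (rule functional_eqI)
  fix f :: "'a \<Rightarrow> complex" and p assume pf: "cseminorm p" "functional_le f p"
  have g': "rapid (\<lambda>\<mu>. \<mu> * g \<mu>)" by (rule rapid_mult[OF g tempered_id])
  have eq: "f (F (\<Gamma> t) y) = \<Gamma> t * f (F (\<Gamma> t) x) - f (C x)" for t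
    using arg_cong[OF xy[OF \<Gamma>_in_E[of t]], of f]
    by (simp add: functional_diff[OF pf(2)] functional_scaleC[OF pf(2)])
  have "f (S (\<lambda>\<mu>. \<mu> * g \<mu>) x - S g y)
      = (LBINT t. d\<Gamma> t * (\<Gamma> t * g (\<Gamma> t) * f (F (\<Gamma> t) x)) - d\<Gamma> t * (g (\<Gamma> t) * f (F (\<Gamma> t) y)))"
    using S_integrable[OF g' pf, of x] S_integrable[OF g pf, of y]
    by (simp add: functional_diff[OF pf(2)] S_weak[OF g' pf] S_weak[OF g pf] contour_int_def)
  also have "\<dots> = (LBINT t. d\<Gamma> t * g (\<Gamma> t) * f (C x))"
    by (simp add: eq algebra_simps)
  finally show "f (S (\<lambda>\<mu>. \<mu> * g \<mu>) x - S g y) = f (contour_int g *\<^sub>C C x)"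
    by (simp add: functional_scaleC[OF pf(2)] contour_int_def)
qed

end

section \<open>The generated distribution\<close>

lemma tvs_bounded_cseminorm:
  assumes B: "tvs_bounded B" and q: "cseminorm q"
  obtains r where "r > 0" "\<And>x. x \<in> B \<Longrightarrow> q x \<le> r"
proof -
  note q' = cseminorm_seminorm[OF q]
  have "open {x. q (x - 0) < 1}" by (rule open_cseminorm_ball[OF q])
  moreover have "0 \<in> {x. q (x - 0) < 1}" by (simp add: seminorm_zero[OF q'])
  ultimately have "absorbs {x. q (x - 0) < 1} B" using B unfolding tvs_bounded_def by blast
  then obtain r where r: "r > 0" "\<And>c. r \<le> cmod c \<Longrightarrow> B \<subseteq> (\<lambda>x. c *\<^sub>C x) ` {x. q (x - 0) < 1}"
    unfolding absorbs_def by blast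
  have "q x \<le> r" if "x \<in> B" for x
  proof -
    have "x \<in> (\<lambda>x. complex_of_real r *\<^sub>C x) ` {x. q (x - 0) < 1}"
      using r(2)[of "complex_of_real r"] r(1) that by auto
    then obtain w where w: "q w < 1" "x = complex_of_real r *\<^sub>C w" by auto
    then show ?thesis using r(1) by (simp add: seminorm_scaleC[OF q'])
  qed
  then show thesis using that r(1) by blast
qed

lemma scaleC_clin_ops:
  assumes T: "T \<in> clin_ops"
  shows "(\<lambda>x. c *\<^sub>C T x) \<in> clin_ops"
proof -
  interpret T: Vector_Spaces.linear scaleC scaleC T using T by (simp add: clin_ops_def)
  have "Vector_Spaces.linear scaleC scaleC (\<lambda>x. c *\<^sub>C T x)"
    by unfold_locales (simp_all add: T.add T.scale scaleC_add_right mult.commute)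
  moreover have "continuous_on UNIV (\<lambda>x. c *\<^sub>C T x)"
    using T by (auto simp: clin_ops_def intro: continuous_on_scaleC continuous_on_const)
  ultimately show ?thesis by (simp add: clin_ops_def)
qed

context contour_calculus
begin

definition distr :: "(real \<Rightarrow> complex) \<Rightarrow> 'a \<Rightarrow> 'a" where
  "distr \<phi> x = (- \<i>) *\<^sub>C S (hat \<phi>) x"

lemma distr_clin: "\<phi> \<in> \<D> \<Longrightarrow> distr \<phi> \<in> clin_ops"
  using scaleC_clin_ops[OF S_clin[OF rapid_hat], of \<phi> "- \<i>"] by (simp add: distr_def[abs_def])

lemma distr_lincomb:
  assumes "\<phi> \<in> \<D>" "\<psi> \<in> \<D>"
  shows "distr (\<lambda>t. c * \<phi> t + d * \<psi> t) x = c *\<^sub>C distr \<phi> x + d *\<^sub>C distr \<psi> x"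
proof -
  have "hat (\<lambda>t. c * \<phi> t + d * \<psi> t) = (\<lambda>\<mu>. c * hat \<phi> \<mu> + d * hat \<psi> \<mu>)"
    by (rule ext) (rule hat_lincomb[OF assms])
  then have "S (hat (\<lambda>t. c * \<phi> t + d * \<psi> t)) x = c *\<^sub>C S (hat \<phi>) x + d *\<^sub>C S (hat \<psi>) x"
    using S_add[OF rapid_scale[OF rapid_hat[OF assms(1)]] rapid_scale[OF rapid_hat[OF assms(2)]], of c d x]
    by (simp add: S_scale rapid_hat assms)
  then show ?thesis
    unfolding distr_def by (simp add: scaleC_add_right mult.commute)
qed

lemma distr_add: "\<phi> \<in> \<D> \<Longrightarrow> \<psi> \<in> \<D> \<Longrightarrow> distr (\<lambda>t. \<phi> t + \<psi> t) x = distr \<phi> x + distr \<psi> x"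
  using distr_lincomb[of \<phi> \<psi> 1 1 x] by (simp add: scaleC_one)

lemma distr_scale: "\<phi> \<in> \<D> \<Longrightarrow> distr (\<lambda>t. c * \<phi> t) x = c *\<^sub>C distr \<phi> x"
  using distr_lincomb[of \<phi> \<phi> c 0 x] by simp

text \<open>
  On test functions supported in a fixed compact set, one derivative bounds the weight (\<open>rapid_hat_bound\<close>)
  and hence the values of the distribution, uniformly on the bounded set \<open>B\<close>.
\<close>

lemma distr_nhd:
  assumes B: "tvs_bounded B" and p: "cseminorm p"
  shows "test_nhd0 {\<psi> \<in> \<D>. \<forall>x\<in>B. p (distr \<psi> x) < 1}" (is "test_nhd0 ?V")
  unfolding test_nhd0_def
proof (intro conjI ballI allI impI)
  note p' = cseminorm_seminorm[OF p]
  show "?V \<subseteq> \<D>" by blast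
  show "(\<lambda>t. of_real u * \<phi> t + of_real (1 - u) * \<psi> t) \<in> ?V"
    if \<phi>: "\<phi> \<in> ?V" and \<psi>: "\<psi> \<in> ?V" and u: "u \<in> {0..1}" for \<phi> \<psi> and u :: real
  proof -
    have "p (distr (\<lambda>t. of_real u * \<phi> t + of_real (1 - u) * \<psi> t) x) < 1" if x: "x \<in> B" for x
    proof -
      have "distr (\<lambda>t. of_real u * \<phi> t + of_real (1 - u) * \<psi> t) x
          = of_real u *\<^sub>C distr \<phi> x + of_real (1 - u) *\<^sub>C distr \<psi> x"
        using \<phi> \<psi> by (intro distr_lincomb) auto
      then have "p (distr (\<lambda>t. of_real u * \<phi> t + of_real (1 - u) * \<psi> t) x)
          \<le> cmod (of_real u) * p (distr \<phi> x) + cmod (of_real (1 - u)) * p (distr \<psi> x)"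
        using seminorm_add[OF p', of "of_real u *\<^sub>C distr \<phi> x" "of_real (1 - u) *\<^sub>C distr \<psi> x"]
        by (simp only: seminorm_scaleC[OF p'])
      also have "\<dots> = u * p (distr \<phi> x) + (1 - u) * p (distr \<psi> x)"
        using u unfolding norm_of_real by simp
      also have "\<dots> < 1"
        using \<phi> \<psi> x u by (intro convex_bound_lt) auto
      finally show ?thesis .
    qed
    then show ?thesis using test_funs_lincomb[of \<phi> \<psi> "of_real u" "of_real (1 - u)"] \<phi> \<psi> by blast
  qed
  show "(\<lambda>t. c * \<phi> t) \<in> ?V" if \<phi>: "\<phi> \<in> ?V" and c: "cmod c \<le> 1" for \<phi> c
  proof -
    have "p (distr (\<lambda>t. c * \<phi> t) x) < 1" if x: "x \<in> B" for x
    proof -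
      have "p (distr (\<lambda>t. c * \<phi> t) x) = cmod c * p (distr \<phi> x)"
        using \<phi> by (simp add: distr_scale seminorm_scaleC[OF p'])
      also have "\<dots> \<le> 1 * p (distr \<phi> x)"
        using c seminorm_nonneg[OF p'] by (intro mult_right_mono)
      finally show ?thesis using \<phi> x by force
    qed
    moreover have "(\<lambda>t. c * \<phi> t) \<in> \<D>" using test_funs_lincomb[of \<phi> \<phi> c 0] \<phi> by simp
    ultimately show ?thesis by blast
  qed
  fix K :: "real set" assume K: "compact K"
  then have "bounded K" by (rule compact_imp_bounded)
  then obtain m where m: "m > 0" "\<And>t. t \<in> K \<Longrightarrow> \<bar>t\<bar> \<le> m" unfolding bounded_pos by auto
  have Km: "K \<subseteq> {-m..m}" using m(2) by (auto simp: abs_le_iff minus_le_iff)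
  obtain c N where c: "c > 0" "\<forall>\<phi> B. \<phi> \<in> \<D> \<longrightarrow> supp \<phi> \<subseteq> {-m..m} \<longrightarrow> (\<forall>t. cmod (nth_vderiv N \<phi> t) \<le> B) \<longrightarrow>
    (\<forall>t. cmod (hat \<phi> (\<Gamma> t)) * (1 + \<bar>t\<bar>) ^ (n + 2) \<le> c * B)"
    using rapid_hat_bound[OF m(1), of "n + 2"] by blast
  obtain q d where q: "cseminorm q" "d \<ge> 0"
    "\<forall>g N x. rapid g \<longrightarrow> (\<forall>t. cmod (g (\<Gamma> t)) * (1 + \<bar>t\<bar>) ^ (n + 2) \<le> N) \<longrightarrow> p (S g x) \<le> d * N * q x"
    using S_bound[OF p] by blast
  obtain r where r: "r > 0" "\<And>x. x \<in> B \<Longrightarrow> q x \<le> r" using tvs_bounded_cseminorm[OF B q(1)] by blast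
  define e where "e = 1 / (d * c * r + 1)"
  have den: "d * c * r + 1 > 0" using q c r by (simp add: add_nonneg_pos)
  then have e: "e > 0" by (simp add: e_def)
  show "\<exists>m. \<exists>\<epsilon>>0. {\<phi> \<in> \<D>. supp \<phi> \<subseteq> K \<and> (\<forall>k\<le>m. \<forall>t. cmod (nth_vderiv k \<phi> t) < \<epsilon>)} \<subseteq> ?V"
  proof (intro exI[of _ N] exI[of _ e] conjI subsetI e)
    fix \<phi> assume "\<phi> \<in> {\<phi> \<in> \<D>. supp \<phi> \<subseteq> K \<and> (\<forall>k\<le>N. \<forall>t. cmod (nth_vderiv k \<phi> t) < e)}"
    then have \<phi>: "\<phi> \<in> \<D>" "supp \<phi> \<subseteq> {-m..m}" "\<forall>t. cmod (nth_vderiv N \<phi> t) \<le> e"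
      using Km by (auto intro: less_imp_le)
    have "p (distr \<phi> x) < 1" if x: "x \<in> B" for x
    proof -
      have "p (distr \<phi> x) = p (S (hat \<phi>) x)" unfolding distr_def seminorm_scaleC[OF p'] by simp
      also have "\<dots> \<le> d * (c * e) * q x"
        by (rule q(3)[rule_format, OF rapid_hat[OF \<phi>(1)] c(2)[rule_format, OF \<phi>(1,2) \<phi>(3)[rule_format]]])
      also have "\<dots> \<le> d * (c * e) * r" using q(2) c(1) e r(2)[OF x] by (intro mult_left_mono) auto
      also have "\<dots> = (d * c * r) / (d * c * r + 1)" by (simp add: e_def)
      also have "\<dots> < 1" using den by simp
      finally show ?thesis .
    qed
    then show "\<phi> \<in> ?V" using \<phi>(1) by blast
  qed
qed

lemma distr_continuous: "continuous_map test_topology clin_ops_topology distr"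
  unfolding continuous_map_def
proof (intro conjI allI impI)
  show "distr \<in> topspace test_topology \<rightarrow> topspace clin_ops_topology"
    using distr_clin by auto
  fix U :: "('a \<Rightarrow> 'a) set" assume "openin clin_ops_topology U"
  then have U: "clin_ops_open U" by (simp add: openin_clin_ops_topology)
  have "test_open {\<phi> \<in> \<D>. distr \<phi> \<in> U}"
    unfolding test_open_def
  proof (intro conjI ballI)
    fix \<phi> assume \<phi>: "\<phi> \<in> {\<phi> \<in> \<D>. distr \<phi> \<in> U}"
    then have \<phi>': "\<phi> \<in> \<D>" "distr \<phi> \<in> U" by auto
    obtain B W where BW: "tvs_bounded B" "open W" "0 \<in> W"
        "{R \<in> clin_ops. \<forall>x\<in>B. R x - distr \<phi> x \<in> W} \<subseteq> U"
      using U \<phi>'(2) unfolding clin_ops_open_def by blast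
    obtain p where p: "cseminorm p" "{x. p x < 1} \<subseteq> W" using exists_cseminorm[OF BW(2,3)] by blast
    let ?V = "{\<psi> \<in> \<D>. \<forall>x\<in>B. p (distr \<psi> x) < 1}"
    have "(\<lambda>t. \<phi> t + \<psi> t) \<in> {\<phi> \<in> \<D>. distr \<phi> \<in> U}" if \<psi>: "\<psi> \<in> ?V" for \<psi>
    proof -
      have D: "(\<lambda>t. \<phi> t + \<psi> t) \<in> \<D>" using test_funs_lincomb[of \<phi> \<psi> 1 1] \<phi>'(1) \<psi> by simp
      have "distr (\<lambda>t. \<phi> t + \<psi> t) x - distr \<phi> x \<in> W" if x: "x \<in> B" for x
      proof -
        have "distr (\<lambda>t. \<phi> t + \<psi> t) x - distr \<phi> x = distr \<psi> x" using \<phi>'(1) \<psi> by (simp add: distr_add)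
        then show ?thesis using \<psi> x p(2) by auto
      qed
      then show ?thesis using D distr_clin[OF D] BW(4) by blast
    qed
    then show "\<exists>V. test_nhd0 V \<and> (\<forall>\<psi>\<in>V. (\<lambda>t. \<phi> t + \<psi> t) \<in> {\<phi> \<in> \<D>. distr \<phi> \<in> U})"
      using distr_nhd[OF BW(1) p(1)] by blast
  qed auto
  then show "openin test_topology {\<phi> \<in> topspace test_topology. distr \<phi> \<in> U}"
    by (simp add: openin_test_topology)
qed

theorem distr_pre_C_DS: "pre_C_DS C distr"
  unfolding pre_C_DS_def op_distribution_def
proof (intro conjI ballI allI)
  show "distr \<phi> \<in> clin_ops" if "\<phi> \<in> \<D>" for \<phi> using distr_clin that .
  show "distr (\<lambda>t. \<phi> t + \<psi> t) x = distr \<phi> x + distr \<psi> x" if "\<phi> \<in> \<D>" "\<psi> \<in> \<D>" for \<phi> \<psi> x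
    using distr_add that .
  show "distr (\<lambda>t. c * \<phi> t) x = c *\<^sub>C distr \<phi> x" if "\<phi> \<in> \<D>" for \<phi> c x
    using distr_scale that .
  show "continuous_map test_topology clin_ops_topology distr" by (rule distr_continuous)
  show "distr_supp distr \<subseteq> {0..}"
  proof -
    have "distr \<phi> x = 0" if "\<phi> \<in> \<D>" "supp \<phi> \<subseteq> {..<0}" for \<phi> x
    proof -
      have "{..<0} \<subseteq> {..0::real}" by auto
      then have "supp \<phi> \<subseteq> {..0}" using that(2) by blast
      then show ?thesis using S_hat_eq_zero[OF that(1)] by (simp add: distr_def)
    qed
    then have "{..<0} \<in> {U. open U \<and> (\<forall>\<phi>\<in>\<D>. supp \<phi> \<subseteq> U \<longrightarrow> (\<forall>x. distr \<phi> x = 0))}" by simp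
    then have "{..<0} \<subseteq> \<Union>{U. open U \<and> (\<forall>\<phi>\<in>\<D>. supp \<phi> \<subseteq> U \<longrightarrow> (\<forall>x. distr \<phi> x = 0))}"
      by (rule Union_upper)
    then have "distr_supp distr \<subseteq> - {..<0}"
      unfolding distr_supp_def by (rule Compl_subset_Compl_iff[THEN iffD2])
    also have "- {..<0} = {0::real..}" by auto
    finally show ?thesis .
  qed
  show "C \<circ> distr \<phi> = distr \<phi> \<circ> C" if "\<phi> \<in> \<D>" for \<phi>
    by (simp only: fun_eq_iff o_def distr_def S_commute[OF rapid_hat[OF that]] clin_scale[OF C] simp_thms)
  show "distr (\<phi> *\<^sub>0 \<psi>) \<circ> C = distr \<phi> \<circ> distr \<psi>" if "\<phi> \<in> \<D>" "\<psi> \<in> \<D>" for \<phi> \<psi>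
  proof (rule ext)
    fix x
    have "(distr \<phi> \<circ> distr \<psi>) x = ((- \<i>) * (- \<i>)) *\<^sub>C S (hat \<phi>) (S (hat \<psi>) x)"
      by (simp only: o_def distr_def S_scale_vec[OF rapid_hat[OF that(1)]] scaleC_scaleC)
    also have "\<dots> = ((- \<i>) * (- \<i>) * \<i>) *\<^sub>C S (hat (\<phi> *\<^sub>0 \<psi>)) (C x)"
      by (simp only: S_hat_product[OF that] scaleC_scaleC)
    finally show "(distr (\<phi> *\<^sub>0 \<psi>) \<circ> C) x = (distr \<phi> \<circ> distr \<psi>) x" by (simp add: distr_def)
  qed
qed

lemma test_funs0_at_0: "\<phi> \<in> \<D>\<^sub>0 \<Longrightarrow> \<phi> 0 = 0"
proof -
  assume "\<phi> \<in> \<D>\<^sub>0"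
  then have \<phi>: "\<phi> \<in> \<D>" "supp \<phi> \<subseteq> {0..}" by (auto simp: test_funs0_def)
  have "(\<phi> \<longlongrightarrow> \<phi> 0) (at_left 0)"
    using test_fun_continuous[OF \<phi>(1), of UNIV]
    by (simp add: continuous_on_eq_continuous_at isCont_def filterlim_at_split)
  moreover have "\<forall>\<^sub>F t in at_left 0. 0 = \<phi> t"
  proof -
    have "\<phi> t = 0" if "t < 0" for t
    proof -
      have "t \<notin> {0..}" using that by simp
      then show ?thesis using \<phi>(2) test_fun_zero by blast
    qed
    then show ?thesis by (auto simp: eventually_at_filter)
  qed
  then have "(\<phi> \<longlongrightarrow> 0) (at_left 0)" using tendsto_cong[of "\<lambda>_. 0"] tendsto_const by blast
  ultimately show "\<phi> 0 = 0" by (rule tendsto_unique[OF trivial_limit_at_left_real])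
qed

lemma graph_in_generator:
  assumes xy: "\<And>\<mu>. \<mu> \<in> E \<Longrightarrow> \<mu> *\<^sub>C F \<mu> x - C x = F \<mu> y"
  shows "(x, y) \<in> generator distr"
proof -
  have "distr (\<lambda>t. - vector_derivative \<phi> (at t)) x = distr \<phi> y" if \<phi>0: "\<phi> \<in> \<D>\<^sub>0" for \<phi>
  proof -
    have \<phi>: "\<phi> \<in> \<D>" using \<phi>0 by (simp add: test_funs0_def)
    have "hat (\<lambda>t. - vector_derivative \<phi> (at t)) \<mu> = \<mu> * hat \<phi> \<mu>" for \<mu>
      using hat_lincomb[OF vd_test_fun[OF \<phi>] \<phi>, of "- 1" 0 \<mu>] hat_vd[OF \<phi>, of \<mu>] by (simp add: vd_def)
    then have "hat (\<lambda>t. - vector_derivative \<phi> (at t)) = (\<lambda>\<mu>. \<mu> * hat \<phi> \<mu>)" by (rule ext)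
    moreover have "S (\<lambda>\<mu>. \<mu> * hat \<phi> \<mu>) x = S (hat \<phi>) y"
      using S_graph[OF rapid_hat[OF \<phi>] xy] contour_int_hat[OF \<phi>] test_funs0_at_0[OF \<phi>0] by simp
    ultimately show ?thesis by (simp add: distr_def)
  qed
  then show ?thesis by (simp add: generator_def)
qed

end

text \<open>
  The exponent is rounded up so that growth is measured by integer powers; this only weakens the bound,
  since \<open>1 + cmod \<mu> \<ge> 1\<close>.
\<close>

lemma equicontinuous_polynomial_growth:
  fixes F :: "complex \<Rightarrow> 'a::complex_lcs \<Rightarrow> 'a"
  assumes F: "\<And>\<mu>. \<mu> \<in> D \<Longrightarrow> F \<mu> \<in> clin_ops"
    and eq: "equicontinuous_ops {(\<lambda>x. ((1 + cmod \<mu>) powr (- \<alpha>)) *\<^sub>R F \<mu> x) | \<mu>. \<mu> \<in> D}"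
    and p: "cseminorm p"
  shows "\<exists>q. cseminorm q \<and> (\<forall>\<mu>\<in>D. \<forall>x. p (F \<mu> x) \<le> (1 + cmod \<mu>) ^ nat \<lceil>\<alpha>\<rceil> * q x)"
proof -
  note p' = cseminorm_seminorm[OF p]
  let ?T = "{(\<lambda>x. ((1 + cmod \<mu>) powr (- \<alpha>)) *\<^sub>R F \<mu> x) | \<mu>. \<mu> \<in> D}"
  have lin: "T (c *\<^sub>C x) = c *\<^sub>C T x" if T: "T \<in> ?T" for T c x
  proof -
    obtain \<mu> where \<mu>: "\<mu> \<in> D" "T = (\<lambda>x. ((1 + cmod \<mu>) powr (- \<alpha>)) *\<^sub>R F \<mu> x)" using T by blast
    show ?thesis unfolding \<mu>(2) by (simp add: clin_scale[OF F[OF \<mu>(1)]] scaleR_scaleC mult.commute)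
  qed
  obtain q where q: "cseminorm q" "\<forall>T\<in>?T. \<forall>x. p (T x) \<le> q x"
    using equicontinuous_ops_cseminorm[OF eq p lin] by blast
  have "p (F \<mu> x) \<le> (1 + cmod \<mu>) ^ nat \<lceil>\<alpha>\<rceil> * q x" if \<mu>: "\<mu> \<in> D" for \<mu> x
  proof -
    define r where "r = 1 + cmod \<mu>"
    have r: "r \<ge> 1" by (simp add: r_def)
    have q0: "q x \<ge> 0" using seminorm_nonneg[OF cseminorm_seminorm[OF q(1)]] .
    have "(\<lambda>x. (r powr (- \<alpha>)) *\<^sub>R F \<mu> x) \<in> ?T" using \<mu> by (auto simp: r_def)
    from q(2)[rule_format, OF this, of x] have "r powr (- \<alpha>) * p (F \<mu> x) \<le> q x"
      by (simp add: seminorm_scaleR[OF p'])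
    then have "r powr \<alpha> * (r powr (- \<alpha>) * p (F \<mu> x)) \<le> r powr \<alpha> * q x" by (intro mult_left_mono) auto
    also have "r powr \<alpha> * (r powr (- \<alpha>) * p (F \<mu> x)) = p (F \<mu> x)"
      using r by (simp add: powr_minus)
    also have "r powr \<alpha> \<le> r powr (real (nat \<lceil>\<alpha>\<rceil>))"
      using r by (intro powr_mono) (auto simp: real_nat_ceiling_ge)
    also have "r powr (real (nat \<lceil>\<alpha>\<rceil>)) = r ^ nat \<lceil>\<alpha>\<rceil>" using r by (simp add: powr_realpow)
    finally show ?thesis using q0 by (simp add: r_def mult_right_mono)
  qed
  then show ?thesis using q(1) by blast
qed

theorem theorem4p15:
  fixes C :: "'a::{complex_lcs, seq_complete_space, t2_space} \<Rightarrow> 'a"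
    and a b \<alpha> :: real
    and A :: "('a \<times> 'a) set"
    and F :: "complex \<Rightarrow> 'a \<Rightarrow> 'a"
    and G :: "(real \<Rightarrow> complex) \<Rightarrow> 'a \<Rightarrow> 'a"
  assumes "barreled TYPE('a)"
    and "C \<in> clin_ops"
    and "a > 0" and "b > 0" and "\<alpha> > 0"
    and "closed_MLO A"
    and "\<And>\<mu>. \<mu> \<in> exp_region a b \<Longrightarrow> F \<mu> \<in> clin_ops"
    and "\<And>\<mu> x y. \<mu> \<in> exp_region a b \<Longrightarrow> (x, y) \<in> A \<Longrightarrow> (F \<mu> x, F \<mu> y) \<in> A"
    and "\<And>\<mu> x. \<mu> \<in> exp_region a b \<Longrightarrow> F \<mu> x \<in> (shift_MLO \<mu> A)\<inverse> `` {C x}"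
    and "\<And>\<mu>. \<mu> \<in> exp_region a b \<Longrightarrow> F \<mu> \<circ> C = C \<circ> F \<mu>"
    and "\<And>\<mu> x y. \<mu> \<in> exp_region a b \<Longrightarrow> (x, y) \<in> A \<Longrightarrow> \<mu> *\<^sub>C F \<mu> x - C x = F \<mu> y"
    and "\<And>x. analytic_into (Omega_region a b) (\<lambda>\<mu>. F \<mu> x)"
    and "\<And>x \<mu>. \<mu> \<in> range (Gamma_curve a b) \<Longrightarrow>
            continuous (at \<mu> within exp_region a b) (\<lambda>\<mu>. F \<mu> x)"
    and "equicontinuous_ops
           {(\<lambda>x. ((1 + cmod \<mu>) powr (- \<alpha>)) *\<^sub>R F \<mu> x) | \<mu>. \<mu> \<in> exp_region a b}"
    and G_def: "\<And>\<phi> x. G \<phi> x = (- \<i>) *\<^sub>C line_integral (Gamma_curve a b) (\<lambda>\<mu>. hat \<phi> \<mu> *\<^sub>C F \<mu> x)"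
  shows "(\<forall>\<phi>\<in>\<D>. \<forall>x. line_integrable (Gamma_curve a b) (\<lambda>\<mu>. hat \<phi> \<mu> *\<^sub>C F \<mu> x)) \<and>
         pre_C_DS C G \<and> A \<subseteq> generator G"
proof -
  note hyps = assms
  have F_A: "(F \<mu> x, \<mu> *\<^sub>C F \<mu> x - C x) \<in> A" if \<mu>: "\<mu> \<in> exp_region a b" for \<mu> x
    using hyps(9)[OF \<mu>, of x] by (auto simp: shift_MLO_def)
  have C_F: "F \<mu> (C x) = C (F \<mu> x)" if "\<mu> \<in> exp_region a b" for \<mu> x
    using hyps(10)[OF that] by (simp add: fun_eq_iff)
  interpret contour_calculus a b C F "nat \<lceil>\<alpha>\<rceil>"
  proof
    show "a > 0" "b > 0" "C \<in> clin_ops" using hyps(2,3,4) by auto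
    show "F \<mu> \<in> clin_ops" if "\<mu> \<in> exp_region a b" for \<mu> using hyps(7) that .
    show "F \<mu> (C x) = C (F \<mu> x)" if "\<mu> \<in> exp_region a b" for \<mu> x using C_F that .
    show "(\<nu> - \<mu>) *\<^sub>C F \<nu> (F \<mu> x) = F \<mu> (C x) - F \<nu> (C x)"
      if \<nu>: "\<nu> \<in> exp_region a b" and \<mu>: "\<mu> \<in> exp_region a b" for \<nu> \<mu> x
    proof -
      have "\<nu> *\<^sub>C F \<nu> (F \<mu> x) - C (F \<mu> x) = F \<nu> (\<mu> *\<^sub>C F \<mu> x - C x)"
        by (rule hyps(11)[OF \<nu> F_A[OF \<mu>]])
      also have "\<dots> = \<mu> *\<^sub>C F \<nu> (F \<mu> x) - F \<nu> (C x)"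
        using hyps(7)[OF \<nu>] by (simp add: clin_diff clin_scale)
      finally show ?thesis
        by (simp add: C_F[OF \<mu>] complex_vector.scale_left_diff_distrib algebra_simps)
    qed
    show "analytic_into (Omega_region a b) (\<lambda>\<mu>. F \<mu> x)" for x by (rule hyps(12))
    show "continuous (at \<mu> within exp_region a b) (\<lambda>\<mu>. F \<mu> x)" if "\<mu> \<in> range (Gamma_curve a b)" for \<mu> x
      using hyps(13) that .
    show "\<exists>q. cseminorm q \<and> (\<forall>\<mu>\<in>exp_region a b. \<forall>x. p (F \<mu> x) \<le> (1 + cmod \<mu>) ^ nat \<lceil>\<alpha>\<rceil> * q x)"
      if "cseminorm p" for p
      by (rule equicontinuous_polynomial_growth[OF hyps(7) hyps(14) that])
  qed
  have G: "G = distr"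
    by (intro ext) (simp only: G_def distr_def S_def)
  have "line_integrable (Gamma_curve a b) (\<lambda>\<mu>. hat \<phi> \<mu> *\<^sub>C F \<mu> x)" if "\<phi> \<in> \<D>" for \<phi> x
    unfolding line_integrable_def using S_line_integral[OF rapid_hat[OF that]] by blast
  moreover have "A \<subseteq> generator distr"
    using graph_in_generator hyps(11) by auto
  ultimately show ?thesis using distr_pre_C_DS by (simp add: G)
qed

end
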